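(* Let $n\ge 2$, $A\in GL(n,\mathbb{R})$, $v\in\mathbb{R}^n$, and suppose that $f_{A,v}(x)=Ax+v$ on $\mathbb{R}^n$ admits a complete Anosov metric. Then: 1. If $A$ is hyperbolic, then $\operatorname{Ind}(f_{A,v})=\{\dim E^s_A\}$, where $E^s_A=\bigoplus_{|\lambda|<1}E_\lambda^{\mathrm{gen}}$ is the stable generalized eigenspace of $A$. 2. If $A$ is not hyperbolic and $v\notin\operatorname{Im}(I-A)$, then $\operatorname{Ind}(f_{A,v})=\{1,2,\dots,n-1\}$. Moreover, in case 2, for every $k\in\{1,\dots,n-1\}$ there exist a complete Riemannian metric $g_k$ on $\mathbb{R}^n$ and an Anosov splitting $T\mathbb{R}^n=E^s_k\oplus E^u_k$ for $f_{A,v}$ with respect to $g_k$ such that $\dim E^s_k=k$ and $\dim E^u_k=n-k$; and the metrics $g_1,\dots,g_{n-1}$ may be chosen so that $g_k$ and $g_j$ are not uniformly equivalent whenever $k\neq j$, i.e. the identity map $(\mathbb{R}^n,g_k)\to(\mathbb{R}^n,g_j)$ is not bi-Lipschitz.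
   Context: A diffeomorphism $f$ of a smooth manifold $M$ is Anosov with respect to a Riemannian metric $\rho$ if there are a continuous $Df$-invariant splitting $TM=E^s\oplus E^u$ (an Anosov splitting; possibly trivial: $E^s=\{0\}$ or $E^u=\{0\}$ allowed) and constants $C\ge 1$, $\lambda\in(0,1)$ such that for all integers $m\ge 0$: $\|Df^m(w)\|_\rho\le C\lambda^m\|w\|_\rho$ for $w\in E^s$ and $\|Df^{-m}(w)\|_\rho\le C\lambda^m\|w\|_\rho$ for $w\in E^u$. A complete Anosov metric for $f$ is a complete Riemannian metric with respect to which $f$ is Anosov. $A$ is hyperbolic if it has no complex eigenvalue of modulus $1$. $E^s_A$ is the real $A$-invariant subspace of $\mathbb{R}^n$ given by the sum of the generalized eigenspaces for eigenvalues of modulus less than $1$. The index spectrum $\operatorname{Ind}(f_{A,v})$ is the set of all numbers $\dim E^s_g$, where $g$ ranges over all complete Riemannian metrics on $\mathbb{R}^n$ with respect to which $f_{A,v}$ is Anosov, and $E^s_g$ over the stable bundles of Anosov splittings associated with $g$ (the dimension is constant in $x$ since $\mathbb{R}^n$ is connected). *)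

theory Defs
  imports "HOL-Analysis.Analysis"
begin

text \<open>
  The manifold is a Euclidean space, so every tangent space is identified with the space itself.
  A Riemannian metric is a function \<open>g\<close> with \<open>g x v w\<close> the inner product of the tangent vectors
  \<open>v\<close> and \<open>w\<close> at the point \<open>x\<close>.
\<close>

primrec Ck :: "nat \<Rightarrow> ('a::euclidean_space \<Rightarrow> 'b::real_normed_vector) \<Rightarrow> bool" where
  "Ck 0 f = continuous_on UNIV f"
| "Ck (Suc k) f =
     ((\<forall>x. f differentiable (at x)) \<and> (\<forall>v. Ck k (\<lambda>x. frechet_derivative f (at x) v)))"

definition smooth :: "('a::euclidean_space \<Rightarrow> 'b::real_normed_vector) \<Rightarrow> bool" where
  "smooth f \<longleftrightarrow> (\<forall>k. Ck k f)"

definition riemannian_metric :: "('a::euclidean_space \<Rightarrow> 'a \<Rightarrow> 'a \<Rightarrow> real) \<Rightarrow> bool" where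
  "riemannian_metric g \<longleftrightarrow>
     (\<forall>x. bilinear (g x)) \<and>
     (\<forall>x v w. g x v w = g x w v) \<and>
     (\<forall>x v. v \<noteq> 0 \<longrightarrow> g x v v > 0) \<and>
     (\<forall>v w. smooth (\<lambda>x. g x v w))"

definition rnorm :: "('a \<Rightarrow> 'a \<Rightarrow> 'a \<Rightarrow> real) \<Rightarrow> 'a \<Rightarrow> 'a \<Rightarrow> real" where
  "rnorm g x v = sqrt (g x v v)"

definition rspeed ::
  "('a::euclidean_space \<Rightarrow> 'a \<Rightarrow> 'a \<Rightarrow> real) \<Rightarrow> (real \<Rightarrow> 'a) \<Rightarrow> real \<Rightarrow> real" where
  "rspeed g \<gamma> t = rnorm g (\<gamma> t) (vector_derivative \<gamma> (at t))"

text \<open>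
  The library's piecewise \<open>C\<^sup>1\<close> paths need not have bounded velocity near the finitely many
  exceptional parameters. The integrability condition excludes paths of infinite length, for which
  \<open>integral\<close> would return the default value 0.
\<close>

definition rdist :: "('a::euclidean_space \<Rightarrow> 'a \<Rightarrow> 'a \<Rightarrow> real) \<Rightarrow> 'a \<Rightarrow> 'a \<Rightarrow> real" where
  "rdist g x y =
     Inf {integral {0..1} (rspeed g \<gamma>) | \<gamma>.
            valid_path \<gamma> \<and> pathstart \<gamma> = x \<and> pathfinish \<gamma> = y \<and>
            rspeed g \<gamma> integrable_on {0..1}}"

definition complete_riemannian_metric :: "('a::euclidean_space \<Rightarrow> 'a \<Rightarrow> 'a \<Rightarrow> real) \<Rightarrow> bool" where
  "complete_riemannian_metric g \<longleftrightarrow>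
     riemannian_metric g \<and> Metric_space.mcomplete UNIV (rdist g)"

definition uniformly_equivalent ::
  "('a::euclidean_space \<Rightarrow> 'a \<Rightarrow> 'a \<Rightarrow> real) \<Rightarrow> ('a \<Rightarrow> 'a \<Rightarrow> 'a \<Rightarrow> real) \<Rightarrow> bool" where
  "uniformly_equivalent g h \<longleftrightarrow>
     (\<exists>L>0. \<forall>x y. rdist h x y \<le> L * rdist g x y \<and> rdist g x y \<le> L * rdist h x y)"

definition continuous_subbundle :: "('a::euclidean_space \<Rightarrow> 'a set) \<Rightarrow> bool" where
  "continuous_subbundle E \<longleftrightarrow>
     (\<forall>x. \<exists>U k. \<exists>X::nat \<Rightarrow> 'a \<Rightarrow> 'a. open U \<and> x \<in> U \<and> (\<forall>i<k. continuous_on U (X i)) \<and>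
        (\<forall>y\<in>U. inj_on (\<lambda>i. X i y) {..<k} \<and> independent ((\<lambda>i. X i y) ` {..<k}) \<and>
               span ((\<lambda>i. X i y) ` {..<k}) = E y))"

definition continuous_splitting ::
  "('a::euclidean_space \<Rightarrow> 'a set) \<Rightarrow> ('a \<Rightarrow> 'a set) \<Rightarrow> bool" where
  "continuous_splitting Es Eu \<longleftrightarrow>
     continuous_subbundle Es \<and> continuous_subbundle Eu \<and>
     (\<forall>x. Es x \<inter> Eu x = {0} \<and> (\<forall>w. \<exists>s\<in>Es x. \<exists>u\<in>Eu x. w = s + u))"

definition invariant_subbundle :: "('a::euclidean_space \<Rightarrow> 'a) \<Rightarrow> ('a \<Rightarrow> 'a set) \<Rightarrow> bool" where
  "invariant_subbundle f E \<longleftrightarrow> (\<forall>x. frechet_derivative f (at x) ` E x = E (f x))"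

text \<open>
  Here \<open>f\<close> is meant to be a diffeomorphism of the whole space; \<open>inv f ^^ m\<close> is its iterate \<open>-m\<close>.
\<close>

definition anosov_splitting ::
  "('a::euclidean_space \<Rightarrow> 'a) \<Rightarrow> ('a \<Rightarrow> 'a \<Rightarrow> 'a \<Rightarrow> real) \<Rightarrow> ('a \<Rightarrow> 'a set) \<Rightarrow> ('a \<Rightarrow> 'a set) \<Rightarrow> bool"
  where
  "anosov_splitting f g Es Eu \<longleftrightarrow>
     continuous_splitting Es Eu \<and> invariant_subbundle f Es \<and> invariant_subbundle f Eu \<and>
     (\<exists>C\<ge>1. \<exists>\<theta>. 0 < \<theta> \<and> \<theta> < 1 \<and>
        (\<forall>m x. \<forall>w\<in>Es x.
           rnorm g ((f ^^ m) x) (frechet_derivative (f ^^ m) (at x) w) \<le> C * \<theta> ^ m * rnorm g x w) \<and>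
        (\<forall>m x. \<forall>w\<in>Eu x.
           rnorm g ((inv f ^^ m) x) (frechet_derivative (inv f ^^ m) (at x) w)
             \<le> C * \<theta> ^ m * rnorm g x w))"

definition complete_anosov_metric ::
  "('a::euclidean_space \<Rightarrow> 'a) \<Rightarrow> ('a \<Rightarrow> 'a \<Rightarrow> 'a \<Rightarrow> real) \<Rightarrow> bool" where
  "complete_anosov_metric f g \<longleftrightarrow>
     complete_riemannian_metric g \<and> (\<exists>Es Eu. anosov_splitting f g Es Eu)"

definition index_spectrum :: "('a::euclidean_space \<Rightarrow> 'a) \<Rightarrow> nat set" where
  "index_spectrum f =
     {k. \<exists>g Es Eu. complete_riemannian_metric g \<and> anosov_splitting f g Es Eu \<and>
                   (\<forall>x. dim (Es x) = k)}"

definition affine_map :: "real^'n^'n \<Rightarrow> real^'n \<Rightarrow> real^'n \<Rightarrow> real^'n" where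
  "affine_map A v x = A *v x + v"

definition complex_eigenvalue :: "real^'n^'n \<Rightarrow> complex \<Rightarrow> bool" where
  "complex_eigenvalue A \<mu> \<longleftrightarrow>
     (\<exists>w::complex^'n. w \<noteq> 0 \<and> map_matrix complex_of_real A *v w = \<mu> *s w)"

definition hyperbolic :: "real^'n^'n \<Rightarrow> bool" where
  "hyperbolic A \<longleftrightarrow> \<not> (\<exists>\<mu>. complex_eigenvalue A \<mu> \<and> cmod \<mu> = 1)"

definition gen_eigenspace :: "real^'n^'n \<Rightarrow> complex \<Rightarrow> (complex^'n) set" where
  "gen_eigenspace A \<mu> =
     {w. \<exists>k. ((\<lambda>u. (map_matrix complex_of_real A - mat \<mu>) *v u) ^^ k) w = 0}"

text \<open>
  The real points of the sum of the complex generalized eigenspaces for the eigenvalues of modulus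
  less than 1; \<open>vec.span\<close> is the complex linear span.
\<close>

definition stable_eigenspace :: "real^'n^'n \<Rightarrow> (real^'n) set" where
  "stable_eigenspace A =
     {x. (\<chi> i. complex_of_real (x $ i)) \<in>
           vec.span (\<Union>\<mu>\<in>{\<mu>. complex_eigenvalue A \<mu> \<and> cmod \<mu> < 1}. gen_eigenspace A \<mu>)}"

end

theory Submission
  imports Defs "HOL-Computational_Algebra.Fundamental_Theorem_Algebra"
begin

text \<open>
  If \<open>A\<close> is hyperbolic, \<open>f\<close> has a fixed point, where the Anosov estimates force the stable
  fibre to be \<open>stable_eigenspace A\<close>. If \<open>v \<notin> Im (I - A)\<close>, some functional \<open>l\<close> satisfies
  \<open>l (f x) = l x + 1\<close>. Then no iterate of \<open>f\<close> has a fixed point, so by the contraction mapping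
  theorem neither bundle can be trivial. Conversely, choose a path \<open>Pt\<close> of projections of rank
  \<open>k\<close> with \<open>Pt (t + 4) = A \<circ> Pt t \<circ> A\<^sup>-\<^sup>1\<close>, and let the range and the kernel of \<open>Pt (4 * l x)\<close> be the
  stable and the unstable fibre at \<open>x\<close>, weighted by \<open>exp (- 4 * l x)\<close> and \<open>exp (4 * l x)\<close>. This
  metric is complete as soon as \<open>range (Pt t) \<subseteq> ker l\<close> for \<open>t\<close> near \<open>4 \<int>\<close> and \<open>ker (Pt t) \<subseteq> ker l\<close>
  for \<open>t\<close> near \<open>4 \<int> + 2\<close>, since a curve must then leave through infinitely many levels that are
  expensive to cross. Such a path exists because finitely many subspaces of the same dimension have
  a common complement, which joins any two splittings by affine moves of one factor at a time.
  Finally, metrics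
  of different index are never uniformly equivalent: a vector stable for one and unstable for
  the other would have to shrink and grow.
\<close>

section \<open>Smooth functions and smooth interpolation\<close>

text \<open>Completeness is the obstacle. Along a fixed splitting the stable weight decays as
  \<open>l x\<close> grows, so a curve following a stable direction transversal to
  \<open>ker l\<close> can escape with finite length, and likewise an unstable one for
  \<open>l x\<close> tending to minus infinity. Both bundles cannot lie in \<open>ker l\<close>,
  since together they span; hence the two inclusions are demanded alternately, at different levels.
  The number 4 counts the moves in one period of the path: (E0, F0) to (E1, F0) to (E1, F1) to (E1,
  L F0) to (L E0, L F0), where E0 and F1 lie in \<open>ker l\<close> and E1 is a common complement
  of F0, F1 and L F0. Since only subspaces move, and no path in the linear group is needed, the sign
  of the determinant of A does not matter. The range 1 to n - 1 for k is exactly what lets both E0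
  and F1 fit into the hyperplane \<open>ker l\<close>. Distances are infima over curves, so upper
  bounds come from segments, while lower bounds come from integrating the derivative of a test
  function along every competitor; geodesics never enter.\<close>

lemma Ck_const: "Ck k (\<lambda>x. c)"
  by (induction k arbitrary: c) (auto simp: frechet_derivative_const)

lemma Ck_SucI:
  assumes "\<And>x. (f has_derivative f' x) (at x)" and "\<And>v. Ck k (\<lambda>x. f' x v)"
  shows "Ck (Suc k) f"
proof -
  have "frechet_derivative f (at x) = f' x" for x
    using assms(1) frechet_derivative_at by metis
  then show ?thesis
    using assms by (auto simp: differentiable_def)
qed

lemma Ck_SucD:
  assumes "Ck (Suc k) f"
  shows "(f has_derivative frechet_derivative f (at x)) (at x)"
    and "Ck k (\<lambda>x. frechet_derivative f (at x) v)"
  using assms by (auto simp: frechet_derivative_works)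

lemma Ck_Suc_imp: "Ck (Suc k) f \<Longrightarrow> Ck k f"
proof (induction k arbitrary: f)
  case 0
  then show ?case
    by (auto intro!: continuous_at_imp_continuous_on differentiable_imp_continuous_within)
next
  case (Suc k)
  show ?case
    by (rule Ck_SucI[OF Ck_SucD(1)[OF Suc.prems]], rule Suc.IH, rule Ck_SucD(2)[OF Suc.prems])
qed

lemma Ck_imp_continuous_on: "Ck k f \<Longrightarrow> continuous_on S f"
proof (induction k)
  case 0
  then show ?case by (auto intro: continuous_on_subset)
qed (use Ck_Suc_imp in blast)

lemma Ck_add: "Ck k f \<Longrightarrow> Ck k g \<Longrightarrow> Ck k (\<lambda>x. f x + g x)"
proof (induction k arbitrary: f g)
  case 0
  then show ?case by (auto intro: continuous_intros)
next
  case (Suc k)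
  note Df = Ck_SucD[OF Suc.prems(1)] and Dg = Ck_SucD[OF Suc.prems(2)]
  show ?case
    by (rule Ck_SucI[OF has_derivative_add[OF Df(1) Dg(1)]]) (intro Suc.IH Df Dg)
qed

lemma Ck_mult:
  fixes f g :: "'a::euclidean_space \<Rightarrow> real"
  shows "Ck k f \<Longrightarrow> Ck k g \<Longrightarrow> Ck k (\<lambda>x. f x * g x)"
proof (induction k arbitrary: f g)
  case 0
  then show ?case by (auto intro: continuous_intros)
next
  case (Suc k)
  note Df = Ck_SucD[OF Suc.prems(1)] and Dg = Ck_SucD[OF Suc.prems(2)]
  show ?case
    by (rule Ck_SucI[OF has_derivative_mult[OF Df(1) Dg(1)]])
       (intro Ck_add Suc.IH Df(2) Dg(2) Ck_Suc_imp[OF Suc.prems(1)] Ck_Suc_imp[OF Suc.prems(2)])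
qed

lemma Ck_sum: "(\<And>i. i \<in> I \<Longrightarrow> Ck k (f i)) \<Longrightarrow> Ck k (\<lambda>x. \<Sum>i\<in>I. f i x)"
  by (induction I rule: infinite_finite_induct) (auto simp: Ck_const intro: Ck_add)

lemma Ck_inverse:
  fixes f :: "'a::euclidean_space \<Rightarrow> real"
  assumes nz: "\<And>x. f x \<noteq> 0"
  shows "Ck k f \<Longrightarrow> Ck k (\<lambda>x. inverse (f x))"
proof (induction k)
  case 0
  then show ?case using nz by (auto intro: continuous_intros)
next
  case (Suc k)
  note Df = Ck_SucD[OF Suc.prems]
  have "((\<lambda>x. inverse (f x)) has_derivative
      (\<lambda>v. (- 1) * (inverse (f x) * frechet_derivative f (at x) v * inverse (f x)))) (at x)" for x
    using Deriv.has_derivative_inverse[OF nz Df(1)] by (simp add: mult.commute)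
  then show ?case
    by (rule Ck_SucI) (intro Ck_mult Ck_const Df(2) Suc.IH Ck_Suc_imp[OF Suc.prems])
qed

lemma Ck_real_SucI:
  fixes f :: "real \<Rightarrow> real"
  assumes "\<And>t. (f has_real_derivative f' t) (at t)" and "Ck k f'"
  shows "Ck (Suc k) f"
  by (rule Ck_SucI[OF assms(1)[unfolded has_field_derivative_def]])
     (intro Ck_mult assms(2) Ck_const)

text \<open>The inner map is affine, so its derivative \<open>L\<close> is constant and
  differentiation reproduces a function of the same shape; the induction needs no product
  rule.\<close>

lemma Ck_compose_linear:
  fixes f :: "real \<Rightarrow> real" and L :: "'a::euclidean_space \<Rightarrow> real"
  assumes L: "linear L"
  shows "Ck k f \<Longrightarrow> Ck k (\<lambda>x. f (c + L x))"
proof (induction k arbitrary: f)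
  case 0
  have "continuous_on UNIV L"
    using L by (auto intro: linear_continuous_on linear_conv_bounded_linear[THEN iffD1])
  moreover have "continuous_on (range (\<lambda>x. c + L x)) f"
    using 0 by (auto intro: continuous_on_subset)
  ultimately show ?case
    using continuous_on_compose2[of "range (\<lambda>x. c + L x)" f UNIV "\<lambda>x. c + L x"]
    by (simp add: continuous_on_add)
next
  case (Suc k)
  note Df = Ck_SucD[OF Suc.prems]
  have lin: "linear (frechet_derivative f (at t))" for t
    using Df(1)[of t] has_derivative_linear by blast
  have "((\<lambda>x. c + L x) has_derivative L) (at x)" for x
    by (intro derivative_eq_intros) (auto simp: L linear_imp_has_derivative)
  then have "((\<lambda>x. f (c + L x)) has_derivative (\<lambda>v. frechet_derivative f (at (c + L x)) (L v))) (at x)"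
    for x using Df(1) has_derivative_compose by blast
  then show ?case
    by (rule Ck_SucI) (rule Suc.IH[OF Df(2)])
qed

text \<open>\<open>Ck\<close> speaks of functions on the whole space only, so the local models
  \<open>h\<close> are required to be \<open>Ck k\<close> everywhere and to agree with
  \<open>f\<close> on a neighbourhood.\<close>

lemma Ck_local:
  assumes "\<And>x. \<exists>U h. open U \<and> x \<in> U \<and> (\<forall>y\<in>U. f y = h y) \<and> Ck k h"
  shows "Ck k f"
  using assms
proof (induction k arbitrary: f)
  case 0
  have "isCont f x" for x
  proof -
    obtain U h where U: "open U" "x \<in> U" "\<forall>y\<in>U. f y = h y" and "Ck 0 h"
      using 0[of x] by blast
    then have "isCont h x"
      by (simp add: continuous_on_eq_continuous_at)
    moreover have "eventually (\<lambda>y. h y = f y) (nhds x)"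
      using U by (auto simp: eventually_nhds)
    ultimately show "isCont f x"
      using isCont_cong[of h f x] by simp
  qed
  then show ?case by (simp add: continuous_on_eq_continuous_at)
next
  case (Suc k)
  have *: "(f has_derivative frechet_derivative h (at x)) (at x)"
    if "open U" "x \<in> U" "\<forall>y\<in>U. f y = h y" "Ck (Suc k) h" for U h x
    using has_derivative_transform_within_open[OF Ck_SucD(1)[OF that(4)]] that by metis
  have df: "(f has_derivative frechet_derivative f (at x)) (at x)" for x
  proof -
    obtain U h where "open U" "x \<in> U" "\<forall>y\<in>U. f y = h y" "Ck (Suc k) h"
      using Suc.prems[of x] by blast
    from *[OF this] show ?thesis
      by (metis frechet_derivative_at)
  qed
  show ?case
  proof (rule Ck_SucI[OF df], rule Suc.IH)
    fix v x
    obtain U h where U: "open U" "x \<in> U" "\<forall>y\<in>U. f y = h y" "Ck (Suc k) h"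
      using Suc.prems[of x] by blast
    have "frechet_derivative f (at y) = frechet_derivative h (at y)" if "y \<in> U" for y
      using *[of U y h] U that by (metis frechet_derivative_at)
    then show "\<exists>U h. open U \<and> x \<in> U \<and>
        (\<forall>y\<in>U. frechet_derivative f (at y) v = h y) \<and> Ck k h"
      using U Ck_SucD(2)[OF U(4)] by (intro exI[of _ U] exI[of _ "\<lambda>y. frechet_derivative h (at y) v"]) auto
  qed
qed

lemma Ck_exp: "Ck k (\<lambda>t::real. exp (c * t))"
proof (induction k)
  case 0
  show ?case by (auto intro!: continuous_intros)
next
  case (Suc k)
  have "((\<lambda>t. exp (c * t)) has_real_derivative c * exp (c * t)) (at t)" for t :: real
    by (auto intro!: derivative_eq_intros)
  then show ?case
    by (rule Ck_real_SucI) (intro Ck_mult Ck_const Suc.IH)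
qed

section \<open>A smooth step that is constant near both ends\<close>

definition flat :: "nat \<Rightarrow> real \<Rightarrow> real" where
  "flat m x = (if x > 0 then (1 / x) ^ m * exp (- 1 / x) else 0)"

lemma flat_tendsto_0: "(flat m \<longlongrightarrow> 0) (at 0)"
proof -
  have "((\<lambda>x::real. (inverse x) ^ m / exp (inverse x)) \<longlongrightarrow> 0) (at_right 0)"
    by (rule filterlim_compose[OF tendsto_power_div_exp_0 filterlim_inverse_at_top_right])
  moreover have "eventually (\<lambda>x. inverse x ^ m / exp (inverse x) = flat m x) (at_right 0)"
    unfolding eventually_at_right_field
    by (intro exI[of _ 1]) (auto simp: flat_def exp_minus field_simps)
  ultimately have "(flat m \<longlongrightarrow> 0) (at_right 0)"
    using tendsto_cong by fastforce
  moreover have "eventually (\<lambda>x. 0 = flat m x) (at_left 0)"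
    unfolding eventually_at_left_field by (intro exI[of _ "-1"]) (auto simp: flat_def)
  then have "(flat m \<longlongrightarrow> 0) (at_left 0)"
    using tendsto_cong[of "\<lambda>x. 0" "flat m" "at_left 0" 0] by simp
  ultimately show ?thesis
    by (simp add: filterlim_at_split)
qed

text \<open>Differentiating exp (-1/x) produces powers of 1/x. With these powers included, the
  family \<open>flat\<close> is closed under differentiation, so smoothness follows by an induction
  over all exponents at once.\<close>

lemma flat_has_derivative:
  "(flat m has_real_derivative (flat (m + 2) x + (- of_nat m) * flat (m + 1) x)) (at x)"
proof (cases "x = 0")
  case True
  \<comment> \<open>At 0 the difference quotient is itself a member of the family, whose limit is
    known.\<close>
  have "(\<lambda>h. (flat m (0 + h) - flat m 0) / h) = flat (m + 1)"
    by (auto simp: flat_def fun_eq_iff)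
  then show ?thesis
    using flat_tendsto_0[of "m + 1"] True by (simp add: DERIV_def flat_def)
next
  case False
  show ?thesis
  proof (cases "x > 0")
    case True
    have "((\<lambda>x. inverse x ^ m * exp (- inverse x)) has_real_derivative
        of_nat m * inverse x ^ (m - 1) * (- (inverse x)\<^sup>2) * exp (- inverse x)
        + inverse x ^ m * (exp (- inverse x) * (inverse x)\<^sup>2)) (at x)"
    proof -
      have inv: "((\<lambda>x. inverse x) has_real_derivative - (inverse x)\<^sup>2) (at x)"
        using DERIV_inverse[of x] True by (simp add: numeral_2_eq_2)
      have pow: "((\<lambda>x. inverse x ^ m) has_real_derivative of_nat m * inverse x ^ (m - 1) * (- (inverse x)\<^sup>2)) (at x)"
        using DERIV_power[OF inv, of m] by (simp add: mult_ac)
      have "((\<lambda>x. exp (- inverse x)) has_real_derivative exp (- inverse x) * (inverse x)\<^sup>2) (at x)"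
        using DERIV_fun_exp[OF DERIV_minus[OF inv]] by simp
      from DERIV_mult[OF pow this] show ?thesis
        by (rule DERIV_cong) (simp add: algebra_simps)
    qed
    also have "of_nat m * inverse x ^ (m - 1) * (- (inverse x)\<^sup>2) * exp (- inverse x)
        + inverse x ^ m * (exp (- inverse x) * (inverse x)\<^sup>2)
        = flat (m + 2) x + (- of_nat m) * flat (m + 1) x"
      using True
      by (cases m) (simp_all add: flat_def power2_eq_square divide_inverse algebra_simps power_add)
    finally have "((\<lambda>x. inverse x ^ m * exp (- inverse x)) has_real_derivative
        flat (m + 2) x + (- of_nat m) * flat (m + 1) x) (at x)" .
    then show ?thesis
      by (rule has_field_derivative_transform_within_open[of _ _ _ "{0<..}"])
         (use True in \<open>auto simp: flat_def inverse_eq_divide\<close>)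
  next
    case neg: False
    have "((\<lambda>x. 0) has_real_derivative 0) (at x)" by simp
    then have "(flat m has_real_derivative 0) (at x)"
      by (rule has_field_derivative_transform_within_open[of _ _ _ "{..<0}"])
         (use neg False in \<open>auto simp: flat_def\<close>)
    then show ?thesis using neg by (simp add: flat_def)
  qed
qed

lemma Ck_flat: "Ck k (flat m)"
proof (induction k arbitrary: m)
  case 0
  show ?case
    using DERIV_isCont[OF flat_has_derivative] by (simp add: continuous_at_imp_continuous_on)
next
  case (Suc k)
  show ?case
    by (rule Ck_real_SucI[OF flat_has_derivative]) (intro Ck_add Ck_mult Ck_const Suc.IH)
qed

text \<open>The standard quotient of flat functions, placed so that it rises only between 1/4 and
  3/4. This leaves plateaus of radius 1/4 around the integers when steps are concatenated.\<close>

definition smooth_step :: "real \<Rightarrow> real" where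
  "smooth_step s = flat 0 (s - 1/4) * inverse (flat 0 (s - 1/4) + flat 0 (3/4 - s))"

lemma flat_nonneg: "flat m x \<ge> 0"
  by (simp add: flat_def)

lemma flat_pos: "x > 0 \<Longrightarrow> flat m x > 0"
  by (simp add: flat_def)

lemma smooth_step_denominator_pos: "flat 0 (s - 1/4) + flat 0 (3/4 - s) > 0"
proof (cases "s > 1/4")
  case True
  then show ?thesis by (intro add_pos_nonneg flat_pos flat_nonneg) simp
next
  case False
  then show ?thesis by (intro add_nonneg_pos flat_pos flat_nonneg) simp
qed

lemma Ck_smooth_step: "Ck k smooth_step"
proof -
  have lin: "linear (\<lambda>s::real. s)" "linear (\<lambda>s::real. - s)"
    by (auto intro: linearI)
  have *: "Ck k (\<lambda>s::real. flat 0 (s - 1/4))" "Ck k (\<lambda>s::real. flat 0 (3/4 - s))"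
    using Ck_compose_linear[OF lin(1) Ck_flat[of k 0], of "- (1/4)"]
      Ck_compose_linear[OF lin(2) Ck_flat[of k 0], of "3/4"] by simp_all
  have nz: "flat 0 (s - 1/4) + flat 0 (3/4 - s) \<noteq> 0" for s
    using smooth_step_denominator_pos[of s] by simp
  define D where "D = (\<lambda>s::real. flat 0 (s - 1/4) + flat 0 (3/4 - s))"
  have "Ck k D"
    unfolding D_def by (rule Ck_add[OF *])
  moreover have "D s \<noteq> 0" for s
    unfolding D_def by (rule nz)
  ultimately have "Ck k (\<lambda>s. inverse (D s))"
    by (intro Ck_inverse)
  then have "Ck k (\<lambda>s. flat 0 (s - 1/4) * inverse (D s))"
    by (rule Ck_mult[OF *(1)])
  moreover have "(\<lambda>s. flat 0 (s - 1/4) * inverse (D s)) = smooth_step"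
    by (simp add: fun_eq_iff D_def smooth_step_def)
  ultimately show ?thesis by simp
qed

lemma flat_eq_0: "x \<le> 0 \<Longrightarrow> flat m x = 0"
  by (simp add: flat_def)

lemma smooth_step_0: "s \<le> 1/4 \<Longrightarrow> smooth_step s = 0"
  using flat_eq_0[of "s - 1/4" 0] by (simp add: smooth_step_def)

lemma smooth_step_1:
  assumes "s \<ge> 3/4" shows "smooth_step s = 1"
proof -
  have "flat 0 (3/4 - s) = 0" using assms by (intro flat_eq_0) simp
  moreover have "flat 0 (s - 1/4) > 0" using assms by (intro flat_pos) simp
  ultimately show ?thesis by (simp add: smooth_step_def)
qed

lemma smooth_step_bounds: "0 \<le> smooth_step s" "smooth_step s \<le> 1"
proof -
  have "smooth_step s = flat 0 (s - 1/4) / (flat 0 (s - 1/4) + flat 0 (3/4 - s))"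
    by (simp only: smooth_step_def divide_inverse)
  then show "0 \<le> smooth_step s" "smooth_step s \<le> 1"
    using smooth_step_denominator_pos[of s] flat_nonneg[of 0 "s - 1/4"] flat_nonneg[of 0 "3/4 - s"]
    by (simp_all add: divide_le_eq_1)
qed

text \<open>The barrier function in the completeness proof needs a bounded slope and the exact place
  where the slope can be nonzero. The bound comes from compactness of [0, 1], as the derivative
  vanishes elsewhere.\<close>

lemma smooth_step_derivative:
  obtains \<sigma>' B where "\<And>s. (smooth_step has_real_derivative \<sigma>' s) (at s)"
    "\<And>s. \<bar>\<sigma>' s\<bar> \<le> B" "\<And>s. s \<notin> {1/4..3/4} \<Longrightarrow> \<sigma>' s = 0"
proof -
  define \<sigma>' where "\<sigma>' s = frechet_derivative smooth_step (at s) 1" for s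
  note D = Ck_SucD[OF Ck_smooth_step[of "Suc 0"]]
  have d: "(smooth_step has_real_derivative \<sigma>' s) (at s)" for s
  proof -
    have "frechet_derivative smooth_step (at s) h = \<sigma>' s * h" for h
      using linear_cmul[OF has_derivative_linear[OF D(1)], of s h 1]
      unfolding \<sigma>'_def real_scaleR_def by (simp only: mult_1_left mult_1_right mult.commute)
    then have "frechet_derivative smooth_step (at s) = (\<lambda>h. \<sigma>' s * h)"
      by blast
    then show ?thesis
      using D(1)[of s] by (simp add: has_field_derivative_def)
  qed
  have "continuous_on {0..1} \<sigma>'"
    unfolding \<sigma>'_def by (rule Ck_imp_continuous_on[OF D(2)])
  then have "bounded (\<sigma>' ` {0..1})"
    by (intro compact_imp_bounded compact_continuous_image) auto
  then obtain B where B: "\<forall>s\<in>{0..1}. \<bar>\<sigma>' s\<bar> \<le> B"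
    by (auto simp: bounded_iff)
  have zero: "\<sigma>' s = 0" if "s \<notin> {1/4..3/4}" for s
  proof (cases "s < 1/4")
    case True
    have "((\<lambda>_. 0) has_real_derivative 0) (at s)" by simp
    then have "(smooth_step has_real_derivative 0) (at s)"
      by (rule has_field_derivative_transform_within_open[of _ _ _ "{..<1/4}"])
         (use True in \<open>auto simp: smooth_step_0\<close>)
    then show ?thesis using d DERIV_unique by blast
  next
    case False
    have "((\<lambda>_. 1) has_real_derivative 0) (at s)" by simp
    then have "(smooth_step has_real_derivative 0) (at s)"
      by (rule has_field_derivative_transform_within_open[of _ _ _ "{3/4<..}"])
         (use False that in \<open>auto simp: smooth_step_1\<close>)
    then show ?thesis using d DERIV_unique by blast
  qed
  have "\<bar>\<sigma>' s\<bar> \<le> max B 0" for s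
    using bspec[OF B, of s] zero[of s] by (cases "s \<in> {0..1}") auto
  then show ?thesis using that d zero by blast
qed

section \<open>Smooth interpolation between values at the integers\<close>

definition interp :: "(int \<Rightarrow> 'v::real_vector) \<Rightarrow> real \<Rightarrow> 'v" where
  "interp a t = a \<lfloor>t\<rfloor> + smooth_step (t - \<lfloor>t\<rfloor>) *\<^sub>R (a (\<lfloor>t\<rfloor> + 1) - a \<lfloor>t\<rfloor>)"

text \<open>The flat ends of \<open>smooth_step\<close> keep the formula for [j, j + 1) valid a
  quarter beyond either end. The resulting open intervals overlap, which is what makes the
  interpolation smooth across the integers.\<close>

lemma interp_eq:
  assumes "real_of_int j - 1/4 < t" "t < real_of_int j + 5/4"
  shows "interp a t = a j + smooth_step (t - j) *\<^sub>R (a (j + 1) - a j)"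
proof -
  consider "t < j" | "j \<le> t" "t < j + 1" | "j + 1 \<le> t" by linarith
  then show ?thesis
  proof cases
    case 1
    then have "\<lfloor>t\<rfloor> = j - 1" using assms by linarith
    then show ?thesis using 1 assms by (simp add: interp_def smooth_step_0 smooth_step_1)
  next
    case 2
    then have "\<lfloor>t\<rfloor> = j" by linarith
    then show ?thesis by (simp add: interp_def)
  next
    case 3
    then have "\<lfloor>t\<rfloor> = j + 1" using assms by linarith
    then show ?thesis using 3 assms by (simp add: interp_def smooth_step_0 smooth_step_1)
  qed
qed

lemma interp_plateau:
  assumes "\<bar>t - real_of_int j\<bar> \<le> 1/4"
  shows "interp a t = a j"
proof (cases "t = real_of_int j - 1/4")
  \<comment> \<open>The left end of the plateau is just outside the open interval of
    \<open>interp_eq\<close> for \<open>j\<close>, but inside that for \<open>j - 1\<close>. The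
    closed plateau is wanted because the step can move on the closed interval from 1/4 to
    3/4.\<close>
  case True
  then have "interp a t = a (j - 1) + smooth_step (t - (j - 1)) *\<^sub>R (a (j - 1 + 1) - a (j - 1))"
    by (intro interp_eq) auto
  then show ?thesis using True by (simp add: smooth_step_1)
next
  case False
  then have "interp a t = a j + smooth_step (t - j) *\<^sub>R (a (j + 1) - a j)"
    using assms by (intro interp_eq) linarith+
  then show ?thesis using assms by (simp add: smooth_step_0)
qed

lemma interp_local:
  fixes t :: real
  obtains U where "open U" "t \<in> U"
    "\<And>s. s \<in> U \<Longrightarrow> interp a s = a \<lfloor>t\<rfloor> + smooth_step (s - of_int \<lfloor>t\<rfloor>) *\<^sub>R (a (\<lfloor>t\<rfloor> + 1) - a \<lfloor>t\<rfloor>)"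
proof (rule that[of "{of_int \<lfloor>t\<rfloor> - 1/4 <..< of_int \<lfloor>t\<rfloor> + 5/4}"])
  show "t \<in> {of_int \<lfloor>t\<rfloor> - 1/4 <..< of_int \<lfloor>t\<rfloor> + 5/4}"
    unfolding greaterThanLessThan_iff by linarith
qed (use interp_eq[of "\<lfloor>t\<rfloor>" _ a] in auto)

lemma Ck_interp:
  fixes a :: "int \<Rightarrow> real"
  shows "Ck k (interp a)"
proof (rule Ck_local)
  fix t :: real
  define j where "j = \<lfloor>t\<rfloor>"
  have "Ck k (\<lambda>s::real. smooth_step (s - j))"
    using Ck_compose_linear[of "\<lambda>s. s" k smooth_step "- real_of_int j"] Ck_smooth_step
    by (simp add: linearI)
  then have "Ck k (\<lambda>s::real. a j + smooth_step (s - j) *\<^sub>R (a (j + 1) - a j))"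
    unfolding real_scaleR_def by (intro Ck_add Ck_mult Ck_const)
  moreover obtain U where "open U" "t \<in> U"
    "\<And>s. s \<in> U \<Longrightarrow> interp a s = a j + smooth_step (s - of_int j) *\<^sub>R (a (j + 1) - a j)"
    using interp_local[of t a] unfolding j_def by metis
  ultimately show "\<exists>U h. open U \<and> t \<in> U \<and> (\<forall>y\<in>U. interp a y = h y) \<and> Ck k h"
    by (intro exI[of _ U] exI conjI) auto
qed

lemma interp_has_derivative:
  fixes a :: "int \<Rightarrow> real" and \<sigma>' :: "real \<Rightarrow> real"
  assumes "\<And>s. (smooth_step has_real_derivative \<sigma>' s) (at s)"
  shows "(interp a has_real_derivative \<sigma>' (t - of_int \<lfloor>t\<rfloor>) * (a (\<lfloor>t\<rfloor> + 1) - a \<lfloor>t\<rfloor>)) (at t)"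
proof -
  define j where "j = \<lfloor>t\<rfloor>"
  have "((\<lambda>s. smooth_step (s - j)) has_real_derivative \<sigma>' (t - j) * 1) (at t)"
    by (rule DERIV_chain2[OF assms]) (rule derivative_eq_intros refl | simp)+
  from DERIV_add[OF DERIV_const[of "a j"] DERIV_cmult_right[OF this, of "a (j + 1) - a j"]]
  have D: "((\<lambda>s. a j + smooth_step (s - j) * (a (j + 1) - a j)) has_real_derivative
      \<sigma>' (t - j) * (a (j + 1) - a j)) (at t)" by simp
  obtain U where U: "open U" "t \<in> U"
    "\<And>s. s \<in> U \<Longrightarrow> interp a s = a j + smooth_step (s - of_int j) *\<^sub>R (a (j + 1) - a j)"
    using interp_local[of t a] unfolding j_def by metis
  show ?thesis
    unfolding j_def[symmetric]
    by (rule has_field_derivative_transform_within_open[OF D U(1,2)]) (simp add: U(3))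
qed

lemma interp_shift: "interp a (t + of_int i) = interp (\<lambda>j. a (j + i)) t"
  by (simp add: interp_def algebra_simps)

lemma interp_linear_image: "linear h \<Longrightarrow> h (interp a t) = interp (\<lambda>j. h (a j)) t"
  by (simp add: interp_def linear_add linear_cmul linear_diff)

lemma interp_add: "interp (\<lambda>j. a j + b j) t = interp a t + interp b t"
  by (simp add: interp_def algebra_simps)

lemma interp_scale: "interp (\<lambda>j. c *\<^sub>R a j) t = c *\<^sub>R interp a t"
  by (simp add: interp_def algebra_simps)

lemma interp_convex: "interp a t = (1 - smooth_step (t - \<lfloor>t\<rfloor>)) *\<^sub>R a \<lfloor>t\<rfloor> + smooth_step (t - \<lfloor>t\<rfloor>) *\<^sub>R a (\<lfloor>t\<rfloor> + 1)"
  by (simp add: interp_def algebra_simps)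

section \<open>The Riemannian distance\<close>

lemma linear_basis_expansion:
  fixes f :: "'a::euclidean_space \<Rightarrow> 'b::real_vector"
  assumes "linear f"
  shows "f w = (\<Sum>b\<in>Basis. (w \<bullet> b) *\<^sub>R f b)"
proof -
  have "f w = f (\<Sum>b\<in>Basis. (w \<bullet> b) *\<^sub>R b)"
    by (simp add: euclidean_representation)
  also have "\<dots> = (\<Sum>b\<in>Basis. (w \<bullet> b) *\<^sub>R f b)"
    using assms by (simp add: linear_sum linear_cmul)
  finally show ?thesis .
qed

text \<open>Reduces the regularity of a form with varying arguments to that of its finitely many
  coefficients.\<close>

lemma bilinear_basis_expansion:
  fixes h :: "'a::euclidean_space \<Rightarrow> 'a \<Rightarrow> real"
  assumes "bilinear h"
  shows "h u w = (\<Sum>a\<in>Basis. \<Sum>b\<in>Basis. (u \<bullet> a) * (w \<bullet> b) * h a b)"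
proof -
  have "linear (\<lambda>u. h u w)" and lin: "\<And>u. linear (h u)"
    using assms by (auto simp: bilinear_def)
  then have "h u w = (\<Sum>a\<in>Basis. (u \<bullet> a) *\<^sub>R h a w)"
    using linear_basis_expansion[of "\<lambda>u. h u w" u] by blast
  also have "\<dots> = (\<Sum>a\<in>Basis. (u \<bullet> a) *\<^sub>R (\<Sum>b\<in>Basis. (w \<bullet> b) *\<^sub>R h a b))"
    by (intro sum.cong arg_cong2[where f=scaleR] refl linear_basis_expansion lin)
  also have "\<dots> = (\<Sum>a\<in>Basis. \<Sum>b\<in>Basis. (u \<bullet> a) * (w \<bullet> b) * h a b)"
    by (simp add: sum_distrib_left mult.assoc)
  finally show ?thesis .
qed

context
  fixes g :: "'a::euclidean_space \<Rightarrow> 'a \<Rightarrow> 'a \<Rightarrow> real"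
  assumes g: "riemannian_metric g"
begin

lemma metric_bilinear: "bilinear (g x)"
  using g by (simp add: riemannian_metric_def)

lemma metric_sym: "g x v w = g x w v"
  using g unfolding riemannian_metric_def by blast

lemma metric_pos: "v \<noteq> 0 \<Longrightarrow> g x v v > 0"
  using g by (simp add: riemannian_metric_def)

lemma metric_zero: "g x 0 v = 0" "g x v 0 = 0"
  using bilinear_lzero[OF metric_bilinear] bilinear_rzero[OF metric_bilinear] by blast+

lemma metric_nonneg: "g x v v \<ge> 0"
  using metric_pos[of v x] metric_zero by (cases "v = 0") auto

lemma metric_linear: "linear (g x v)"
  using metric_bilinear by (simp add: bilinear_def)

lemma rnorm_nonneg: "rnorm g x v \<ge> 0"
  by (simp add: rnorm_def metric_nonneg)

lemma rnorm_zero: "rnorm g x 0 = 0"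
  by (simp add: rnorm_def metric_zero)

lemma rnorm_pos: "v \<noteq> 0 \<Longrightarrow> rnorm g x v > 0"
  by (simp add: rnorm_def metric_pos)

lemma rnorm_sq: "(rnorm g x v)\<^sup>2 = g x v v"
  by (simp add: rnorm_def metric_nonneg)

lemma rnorm_scale: "rnorm g x (c *\<^sub>R v) = \<bar>c\<bar> * rnorm g x v"
proof -
  have "g x (c *\<^sub>R v) (c *\<^sub>R v) = c\<^sup>2 * g x v v"
    using metric_bilinear by (simp add: bilinear_lmul bilinear_rmul power2_eq_square)
  then show ?thesis
    by (simp add: rnorm_def real_sqrt_mult)
qed

lemma metric_Cauchy_Schwarz: "\<bar>g x v w\<bar> \<le> rnorm g x v * rnorm g x w"
proof (cases "w = 0")
  case True
  then show ?thesis by (simp add: metric_zero rnorm_zero)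
next
  case False
  let ?c = "g x v w / g x w w"
  have p: "g x w w > 0" using False by (rule metric_pos)
  have "0 \<le> g x (v - ?c *\<^sub>R w) (v - ?c *\<^sub>R w)" by (rule metric_nonneg)
  also have "\<dots> = g x v v - (g x v w)\<^sup>2 / g x w w"
    using metric_bilinear[of x] p metric_sym[of x w v]
    by (simp add: bilinear_lsub bilinear_rsub bilinear_lmul bilinear_rmul field_simps power2_eq_square)
  finally have "(g x v w)\<^sup>2 \<le> (rnorm g x v * rnorm g x w)\<^sup>2"
    using p by (simp add: power_mult_distrib rnorm_sq field_simps)
  then show ?thesis
    using abs_le_square_iff[of "g x v w" "rnorm g x v * rnorm g x w"]
    by (simp add: rnorm_nonneg abs_of_nonneg)
qed

text \<open>\<open>riemannian_metric\<close> provides regularity only for fixed tangent vectors; the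
  expansion in coordinates allows the vectors to vary with the point.\<close>

lemma metric_continuous_on:
  assumes "continuous_on S f" "continuous_on S h" "continuous_on S k"
  shows "continuous_on S (\<lambda>t. g (f t) (h t) (k t))"
proof -
  have "continuous_on UNIV (\<lambda>x. g x a b)" for a b
  proof -
    have "Ck 0 (\<lambda>x. g x a b)"
      using g unfolding riemannian_metric_def smooth_def by blast
    then show ?thesis by simp
  qed
  then have *: "continuous_on S (\<lambda>t. g (f t) a b)" for a b
    using continuous_on_compose2[OF _ assms(1), of UNIV "\<lambda>x. g x a b"] by blast
  have "(\<lambda>t. g (f t) (h t) (k t)) =
      (\<lambda>t. \<Sum>a\<in>Basis. \<Sum>b\<in>Basis. (h t \<bullet> a) * (k t \<bullet> b) * g (f t) a b)"
    by (rule ext) (rule bilinear_basis_expansion[OF metric_bilinear])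
  then show ?thesis
    by (simp only:) (intro continuous_intros assms *)
qed

lemma rnorm_continuous_on:
  assumes "continuous_on S f" "continuous_on S h"
  shows "continuous_on S (\<lambda>t. rnorm g (f t) (h t))"
  unfolding rnorm_def by (intro continuous_on_real_sqrt metric_continuous_on assms)

text \<open>Extrema over the compact unit sphere bundle of \<open>K\<close>, extended to all vectors
  by homogeneity.\<close>

lemma rnorm_compact_bounds:
  assumes "compact K"
  obtains c C where "c > 0" "C > 0"
    "\<And>y w. y \<in> K \<Longrightarrow> c * norm w \<le> rnorm g y w \<and> rnorm g y w \<le> C * norm w"
proof (cases "K = {}")
  case True
  then show ?thesis using that[of 1 1] by simp
next
  case False
  let ?D = "K \<times> sphere (0::'a) 1" and ?f = "\<lambda>p. rnorm g (fst p) (snd p)"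
  have D: "compact ?D" "?D \<noteq> {}"
    using assms False by (auto simp: compact_Times)
  have cont: "continuous_on ?D ?f"
    by (intro rnorm_continuous_on continuous_intros)
  obtain p where p: "p \<in> ?D" "\<forall>q\<in>?D. ?f p \<le> ?f q"
    using continuous_attains_inf[OF D cont] by blast
  obtain P where P: "P \<in> ?D" "\<forall>q\<in>?D. ?f q \<le> ?f P"
    using continuous_attains_sup[OF D cont] by blast
  have pos: "?f p > 0" "?f P > 0" using p(1) P(1) by (auto intro!: rnorm_pos)
  have "?f p * norm w \<le> rnorm g y w \<and> rnorm g y w \<le> ?f P * norm w" if y: "y \<in> K" for y w
  proof (cases "w = 0")
    case True
    then show ?thesis by (simp add: rnorm_zero)
  next
    case False
    define u where "u = (1 / norm w) *\<^sub>R w"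
    have "(y, u) \<in> ?D" using False y by (simp add: u_def)
    then have "?f p \<le> rnorm g y u" "rnorm g y u \<le> ?f P" using p(2) P(2) by fastforce+
    moreover have "rnorm g y w = norm w * rnorm g y u"
      using False by (simp add: u_def rnorm_scale)
    ultimately show ?thesis by (simp add: mult.commute mult_left_mono)
  qed
  then show ?thesis using that[OF pos] by blast
qed

lemma rnorm_nearby:
  obtains \<delta> where "\<delta> > 0"
    "\<And>y w. dist x y < \<delta> \<Longrightarrow> rnorm g x w \<le> 2 * rnorm g y w \<and> rnorm g y w \<le> 2 * rnorm g x w"
proof -
  let ?D = "cball x 1 \<times> sphere (0::'a) 1" and ?f = "\<lambda>p. rnorm g (fst p) (snd p)"
  obtain c C where c: "c > 0" "\<And>y w. y \<in> {x} \<Longrightarrow> c * norm w \<le> rnorm g y w \<and> rnorm g y w \<le> C * norm w"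
    by (rule rnorm_compact_bounds[of "{x}"]) auto
  have "uniformly_continuous_on ?D ?f"
    by (intro compact_uniformly_continuous rnorm_continuous_on continuous_intros compact_Times) auto
  \<comment> \<open>\<open>c\<close> bounds the norm at \<open>x\<close> of unit vectors from below,
    so an additive error below \<open>c / 2\<close> costs at most a factor 2.\<close>
  then obtain d where d: "d > 0"
    "\<And>p q. p \<in> ?D \<Longrightarrow> q \<in> ?D \<Longrightarrow> dist q p < d \<Longrightarrow> dist (?f q) (?f p) < c / 2"
    unfolding uniformly_continuous_on_def using c(1) half_gt_zero by metis
  have "rnorm g x w \<le> 2 * rnorm g y w \<and> rnorm g y w \<le> 2 * rnorm g x w"
    if y: "dist x y < min d 1" for y w
  proof (cases "w = 0")
    case True
    then show ?thesis by (simp add: rnorm_zero)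
  next
    case False
    define u where "u = (1 / norm w) *\<^sub>R w"
    have u: "norm u = 1" using False by (simp add: u_def)
    have "dist (rnorm g y u) (rnorm g x u) < c / 2"
      using d(2)[of "(x, u)" "(y, u)"] u y by (simp add: dist_Pair_Pair dist_commute)
    moreover have "c \<le> rnorm g x u" using c(2)[of x u] u by simp
    ultimately have "rnorm g x u \<le> 2 * rnorm g y u \<and> rnorm g y u \<le> 2 * rnorm g x u"
      using c(1) unfolding dist_real_def by linarith
    moreover have "rnorm g z w = norm w * rnorm g z u" for z
      using False by (simp add: u_def rnorm_scale)
    ultimately show ?thesis
      using False by (simp add: mult.left_commute[of 2])
  qed
  then show ?thesis using that[of "min d 1"] d(1) by simp
qed

section \<open>Lengths of curves and the distance they define\<close>

definition admissible :: "(real \<Rightarrow> 'a) \<Rightarrow> 'a \<Rightarrow> 'a \<Rightarrow> bool" where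
  "admissible \<gamma> x y \<longleftrightarrow> valid_path \<gamma> \<and> pathstart \<gamma> = x \<and> pathfinish \<gamma> = y \<and>
     rspeed g \<gamma> integrable_on {0..1}"

lemma rspeed_nonneg: "rspeed g \<gamma> t \<ge> 0"
  by (simp add: rspeed_def rnorm_nonneg)

lemma rdist_le: "admissible \<gamma> x y \<Longrightarrow> rdist g x y \<le> integral {0..1} (rspeed g \<gamma>)"
  unfolding rdist_def admissible_def
  by (rule cInf_lower) (auto intro!: bdd_belowI[of _ 0] integral_nonneg rspeed_nonneg)

lemma rspeed_linepath: "rspeed g (linepath x y) t = rnorm g (linepath x y t) (y - x)"
proof -
  have "(linepath x y has_vector_derivative (y - x)) (at t)"
    by (rule has_vector_derivative_linepath_within)
  then show ?thesis by (simp add: rspeed_def vector_derivative_at)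
qed

lemma admissible_linepath: "admissible (linepath x y) x y"
proof -
  have "continuous_on {0..1} (rspeed g (linepath x y))"
    unfolding rspeed_linepath[abs_def] by (intro rnorm_continuous_on continuous_intros)
  then show ?thesis
    unfolding admissible_def by (auto intro: integrable_continuous_real)
qed

lemma rdist_greatest:
  assumes "\<And>\<gamma>. admissible \<gamma> x y \<Longrightarrow> B \<le> integral {0..1} (rspeed g \<gamma>)"
  shows "B \<le> rdist g x y"
  unfolding rdist_def
proof (rule cInf_greatest)
  show "{integral {0..1} (rspeed g \<gamma>) | \<gamma>. valid_path \<gamma> \<and> pathstart \<gamma> = x \<and>
      pathfinish \<gamma> = y \<and> rspeed g \<gamma> integrable_on {0..1}} \<noteq> {}"
    using admissible_linepath[of x y] unfolding admissible_def by blast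
qed (use assms in \<open>auto simp: admissible_def\<close>)

lemma rdist_less_obtain:
  assumes "rdist g x y < B"
  obtains \<gamma> where "admissible \<gamma> x y" "integral {0..1} (rspeed g \<gamma>) < B"
  using assms rdist_greatest[of x y B] by fastforce

lemma rdist_nonneg: "rdist g x y \<ge> 0"
  by (rule rdist_greatest) (auto simp: admissible_def intro: integral_nonneg rspeed_nonneg)

lemma rdist_le_segment:
  assumes "\<And>t. t \<in> {0..1} \<Longrightarrow> rnorm g (linepath x y t) (y - x) \<le> B"
  shows "rdist g x y \<le> B"
proof -
  have "rdist g x y \<le> integral {0..1} (rspeed g (linepath x y))"
    by (rule rdist_le[OF admissible_linepath])
  also have "\<dots> \<le> integral {0..1} (\<lambda>t::real. B)"
    using admissible_linepath[of x y] assms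
    by (intro integral_le) (auto simp: admissible_def rspeed_linepath)
  finally show ?thesis by simp
qed

text \<open>Lower bounds for the Riemannian distance all come from Lipschitz test functions.\<close>

lemma rdist_test_function:
  fixes F :: "'a \<Rightarrow> real"
  assumes F: "\<And>z. (F has_derivative F' z) (at z)"
    and bound: "\<And>z u. \<bar>F' z u\<bar> \<le> C * rnorm g z u" and "C > 0"
  shows "\<bar>F x - F y\<bar> \<le> C * rdist g x y"
proof -
  have "\<bar>F x - F y\<bar> / C \<le> rdist g x y"
  proof (rule rdist_greatest)
    fix \<gamma> assume "admissible \<gamma> x y"
    then have \<gamma>: "valid_path \<gamma>" "\<gamma> 0 = x" "\<gamma> 1 = y" "rspeed g \<gamma> integrable_on {0..1}"
      by (auto simp: admissible_def pathstart_def pathfinish_def)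
    obtain S where S: "finite S" "continuous_on {0..1} \<gamma>" "\<gamma> C1_differentiable_on {0..1} - S"
      using \<gamma>(1) by (auto simp: valid_path_def piecewise_C1_differentiable_on_def)
    define D where "D t = (if t \<in> S then 0 else F' (\<gamma> t) (vector_derivative \<gamma> (at t)))" for t
    have "(D has_integral F (\<gamma> 1) - F (\<gamma> 0)) {0..1}"
    proof (rule fundamental_theorem_of_calculus_strong[OF S(1), where f="\<lambda>t. F (\<gamma> t)"])
      fix t assume t: "t \<in> {0..1} - S"
      then have "(\<gamma> has_vector_derivative vector_derivative \<gamma> (at t)) (at t)"
        using S(3) by (auto simp: C1_differentiable_on_eq vector_derivative_works)
      then have "(\<gamma> has_derivative (\<lambda>h. h *\<^sub>R vector_derivative \<gamma> (at t))) (at t)"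
        by (simp add: has_vector_derivative_def)
      from has_derivative_compose[OF this F]
      have "((\<lambda>t. F (\<gamma> t)) has_derivative (\<lambda>h. F' (\<gamma> t) (h *\<^sub>R vector_derivative \<gamma> (at t)))) (at t)" .
      then show "((\<lambda>t. F (\<gamma> t)) has_vector_derivative D t) (at t)"
        using t linear_cmul[OF has_derivative_linear[OF F]]
        by (simp add: has_vector_derivative_def D_def)
    next
      have "continuous_on UNIV F"
        using has_derivative_continuous[OF F] by (simp add: continuous_at_imp_continuous_on)
      then show "continuous_on {0..1} (\<lambda>t. F (\<gamma> t))"
        using continuous_on_compose2[OF _ S(2), of UNIV F] by blast
    qed simp
    moreover have "\<bar>D t\<bar> \<le> C * rspeed g \<gamma> t" for t
      using bound \<open>C > 0\<close> by (simp add: D_def rspeed_def rnorm_nonneg)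
    ultimately have "norm (integral {0..1} D) \<le> integral {0..1} (\<lambda>t. C * rspeed g \<gamma> t)"
      using integrable_cmul[OF \<gamma>(4), of C]
      by (intro integral_norm_bound_integral) (auto simp: has_integral_integrable)
    then have "\<bar>F y - F x\<bar> \<le> C * integral {0..1} (rspeed g \<gamma>)"
      using \<open>(D has_integral _) _\<close> \<gamma> by (simp add: integral_unique)
    then show "\<bar>F x - F y\<bar> / C \<le> integral {0..1} (rspeed g \<gamma>)"
      using \<open>C > 0\<close> by (simp add: divide_le_eq abs_minus_commute mult.commute)
  qed
  then show ?thesis using \<open>C > 0\<close> by (simp add: divide_le_eq mult.commute)
qed

lemma rspeed_reparametrize:
  assumes "\<gamma> differentiable (at (m * t + c))" and "eventually (\<lambda>s. \<delta> s = \<gamma> (m * s + c)) (nhds t)"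
  shows "rspeed g \<delta> t = \<bar>m\<bar> * rspeed g \<gamma> (m * t + c)"
proof -
  have "(\<gamma> has_vector_derivative vector_derivative \<gamma> (at (m * t + c))) (at (m * t + c))"
    using assms(1) by (simp add: vector_derivative_works)
  moreover have "((\<lambda>s. m * s + c) has_vector_derivative m) (at t)"
    by (auto intro!: derivative_eq_intros simp: has_vector_derivative_def)
  ultimately have "((\<lambda>s. \<gamma> (m * s + c)) has_vector_derivative
      m *\<^sub>R vector_derivative \<gamma> (at (m * t + c))) (at t)"
    using vector_diff_chain_at[of "\<lambda>s. m * s + c"] by (simp add: o_def)
  then have "(\<delta> has_vector_derivative m *\<^sub>R vector_derivative \<gamma> (at (m * t + c))) (at t)"
    by (rule has_vector_derivative_cong_ev[THEN iffD2, rotated 2])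
       (use assms(2) eventually_nhds_x_imp_x[OF assms(2)] in auto)
  then have "vector_derivative \<delta> (at t) = m *\<^sub>R vector_derivative \<gamma> (at (m * t + c))"
    by (rule vector_derivative_at)
  then show ?thesis
    unfolding rspeed_def eventually_nhds_x_imp_x[OF assms(2)] by (simp only: rnorm_scale)
qed

text \<open>One affine substitution covers both halves of a joined path (\<open>m = 2\<close>) and
  the reversed path (\<open>m = -1\<close>). The ends \<open>a\<close> and \<open>b\<close> are left
  out of the hypothesis on \<open>\<delta>\<close> because two pieces meet there.\<close>

lemma rspeed_has_integral_reparametrize:
  assumes "valid_path \<gamma>" "(rspeed g \<gamma> has_integral I) {0..1}" "m \<noteq> 0"
    and J: "J = {a..b}" "(\<lambda>s. m * s + c) ` {a..b} = {0..1}"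
    and \<delta>: "\<And>s. s \<in> {a<..<b} \<Longrightarrow> \<delta> s = \<gamma> (m * s + c)"
  shows "(rspeed g \<delta> has_integral I) J"
proof -
  obtain S where S: "finite S" "\<gamma> C1_differentiable_on {0..1} - S"
    using assms(1) by (auto simp: valid_path_def piecewise_C1_differentiable_on_def)
  \<comment> \<open>Parameters to be ignored: the two ends and the preimages of the break points of
    \<open>\<gamma>\<close>.\<close>
  let ?T = "{a, b} \<union> (\<lambda>s. m * s + c) -` S"
  have "inj (\<lambda>s. m * s + c)" using \<open>m \<noteq> 0\<close> by (auto intro: injI)
  then have fin: "finite ?T" using S(1) by (simp add: finite_vimageI)
  have "(\<lambda>y. (1 / m) * y - c / m) ` ((\<lambda>s. m * s + c) ` {a..b}) = {a..b}"
    using \<open>m \<noteq> 0\<close> by (auto simp: image_image field_simps)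
  then have "(\<lambda>y. (1 / m) *\<^sub>R y - (1 / m) *\<^sub>R c) ` {0..1} = {a..b}"
    unfolding J(2) by simp
  then have "((\<lambda>s. rspeed g \<gamma> (m * s + c)) has_integral I /\<^sub>R \<bar>m\<bar>) {a..b}"
    using has_integral_affinity01[OF assms(2) \<open>m \<noteq> 0\<close>, of c] by (simp add: divide_inverse mult.commute)
  then have "((\<lambda>s. \<bar>m\<bar> *\<^sub>R rspeed g \<gamma> (m * s + c)) has_integral \<bar>m\<bar> *\<^sub>R (I /\<^sub>R \<bar>m\<bar>)) {a..b}"
    by (rule has_integral_cmul)
  then have *: "((\<lambda>s. \<bar>m\<bar> * rspeed g \<gamma> (m * s + c)) has_integral I) {a..b}"
    using \<open>m \<noteq> 0\<close> by (simp add: field_simps)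
  have "rspeed g \<delta> s = \<bar>m\<bar> * rspeed g \<gamma> (m * s + c)" if s: "s \<in> {a..b} - ?T" for s
  proof (rule rspeed_reparametrize)
    have "m * s + c \<in> (\<lambda>s. m * s + c) ` {a..b}" using s by blast
    then have "m * s + c \<in> {0..1} - S" unfolding J(2) using s by blast
    then show "\<gamma> differentiable (at (m * s + c))"
      using S(2) by (auto simp: C1_differentiable_on_eq)
    have "eventually (\<lambda>s. s \<in> {a<..<b}) (nhds s)"
      using s by (intro eventually_nhds_in_open) auto
    then show "eventually (\<lambda>s. \<delta> s = \<gamma> (m * s + c)) (nhds s)"
      by eventually_elim (rule \<delta>)
  qed
  then show ?thesis
    unfolding J(1) by (rule has_integral_spike_finite[OF fin _ *])
qed

lemma rdist_triangle: "rdist g x z \<le> rdist g x y + rdist g y z"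
proof (rule field_le_epsilon)
  fix e :: real assume "e > 0"
  obtain p where p: "admissible p x y" "integral {0..1} (rspeed g p) < rdist g x y + e / 2"
    using rdist_less_obtain[of x y "rdist g x y + e / 2"] \<open>e > 0\<close> by auto
  obtain q where q: "admissible q y z" "integral {0..1} (rspeed g q) < rdist g y z + e / 2"
    using rdist_less_obtain[of y z "rdist g y z + e / 2"] \<open>e > 0\<close> by auto
  have vp: "valid_path p" "valid_path q" "pathfinish p = pathstart q"
    using p q by (auto simp: admissible_def)
  let ?P = "integral {0..1} (rspeed g p)" and ?Q = "integral {0..1} (rspeed g q)"
  have ip: "(rspeed g p has_integral ?P) {0..1}" and iq: "(rspeed g q has_integral ?Q) {0..1}"
    using p q by (auto simp: admissible_def intro: integrable_integral)
  have "(rspeed g (p +++ q) has_integral ?P) {0..1/2}"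
  proof (rule rspeed_has_integral_reparametrize[OF vp(1) ip, of 2 _ 0 "1/2" 0])
    show "(\<lambda>s. 2 * s + 0) ` {0..1/2} = {0..1::real}"
      using image_affinity_atLeastAtMost[of 2 0 0 "1/2::real"] by simp
  qed (auto simp: joinpaths_def)
  moreover have "(rspeed g (p +++ q) has_integral ?Q) {1/2..1}"
  proof (rule rspeed_has_integral_reparametrize[OF vp(2) iq, of 2 _ "1/2" 1 "-1"])
    show "(\<lambda>s. 2 * s + - 1) ` {1/2..1} = {0..1::real}"
      using image_affinity_atLeastAtMost[of 2 "-1" "1/2" "1::real"] by simp
  qed (auto simp: joinpaths_def)
  ultimately have int: "(rspeed g (p +++ q) has_integral ?P + ?Q) {0..1}"
    by (rule has_integral_combine[rotated 2]) auto
  then have "admissible (p +++ q) x z"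
    using p q valid_path_join[OF vp] by (auto simp: admissible_def)
  from rdist_le[OF this] have "rdist g x z \<le> ?P + ?Q"
    using int by (simp add: integral_unique)
  then show "rdist g x z \<le> rdist g x y + rdist g y z + e"
    using p q by linarith
qed

lemma rdist_sym_le: "rdist g y x \<le> rdist g x y"
proof (rule rdist_greatest)
  fix \<gamma> assume \<gamma>: "admissible \<gamma> x y"
  let ?I = "integral {0..1} (rspeed g \<gamma>)"
  have "(rspeed g (reversepath \<gamma>) has_integral ?I) {0..1}"
  proof (rule rspeed_has_integral_reparametrize[of \<gamma> _ "-1" _ 0 1 1])
    show "(\<lambda>s. - 1 * s + 1) ` {0..1} = {0..1::real}"
      using image_affinity_atLeastAtMost[of "-1" 1 0 "1::real"] by simp
    show "(rspeed g \<gamma> has_integral ?I) {0..1}" "valid_path \<gamma>"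
      using \<gamma> by (auto simp: admissible_def intro: integrable_integral)
  qed (auto simp: reversepath_def)
  then have "admissible (reversepath \<gamma>) y x" "integral {0..1} (rspeed g (reversepath \<gamma>)) = ?I"
    using \<gamma> by (auto simp: admissible_def valid_path_imp_reverse integral_unique has_integral_integrable)
  then show "rdist g y x \<le> ?I"
    using rdist_le by fastforce
qed

lemma rdist_refl: "rdist g x x = 0"
  using rdist_le_segment[of x x 0] rdist_nonneg[of x x] by (simp add: rnorm_zero)

end

section \<open>Test functions on Riemannian manifolds\<close>

text \<open>Squaring the positive part removes its kink at 1. A differentiable cutoff is enough,
  since \<open>rdist_test_function\<close> asks for nothing more.\<close>

lemma square_cutoff_has_derivative:
  "((\<lambda>s::real. (max 0 (1 - s))\<^sup>2) has_real_derivative - 2 * max 0 (1 - s)) (at s)"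
proof -
  consider "s < 1" | "s > 1" | "s = 1" by linarith
  then show ?thesis
  proof cases
    case 1
    have "((\<lambda>s::real. (1 - s)\<^sup>2) has_real_derivative - 2 * max 0 (1 - s)) (at s)"
      using 1 by (auto intro!: derivative_eq_intros)
    then show ?thesis
      by (rule has_field_derivative_transform_within_open[of _ _ _ "{..<1}"]) (use 1 in auto)
  next
    case 2
    have "((\<lambda>s::real. 0) has_real_derivative - 2 * max 0 (1 - s)) (at s)"
      using 2 by simp
    then show ?thesis
      by (rule has_field_derivative_transform_within_open[of _ _ _ "{1<..}"]) (use 2 in auto)
  next
    case 3
    have "((\<lambda>h::real. ((max 0 (1 - (1 + h)))\<^sup>2 - (max 0 (1 - 1))\<^sup>2) / h) \<longlongrightarrow> 0) (at 0)"
    proof (rule Lim_null_comparison)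
      have "\<bar>((max 0 (1 - (1 + h)))\<^sup>2 - (max 0 (1 - 1))\<^sup>2) / h\<bar> \<le> \<bar>h\<bar>" for h :: real
        by (cases "h \<ge> 0") (auto simp: max_def power2_eq_square)
      then show "eventually (\<lambda>h::real. norm (((max 0 (1 - (1 + h)))\<^sup>2 - (max 0 (1 - 1))\<^sup>2) / h) \<le> \<bar>h\<bar>) (at 0)"
        by simp
      show "((\<lambda>h::real. \<bar>h\<bar>) \<longlongrightarrow> 0) (at 0)"
        by (rule tendsto_eq_intros refl | simp)+
    qed
    then show ?thesis using 3 by (simp add: DERIV_def)
  qed
qed

lemma square_cutoff_bounds:
  "0 \<le> (max 0 (1 - s :: real))\<^sup>2" "s \<ge> 0 \<Longrightarrow> (max 0 (1 - s :: real))\<^sup>2 \<le> 1"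
  by (auto simp: max_def power_le_one)

text \<open>The ball is measured in the inner product frozen at \<open>x\<close>, which makes the
  cutoff explicit. Its slope bound is 2 from the squared cutoff times \<open>2 * r / r^2\<close>
  from the quadratic form, by Cauchy-Schwarz.\<close>

lemma metric_bump:
  fixes g :: "'a::euclidean_space \<Rightarrow> 'a \<Rightarrow> 'a \<Rightarrow> real" and x :: 'a
  assumes g: "riemannian_metric g" and "r > 0"
  defines "\<Phi> \<equiv> \<lambda>z. (max 0 (1 - g x (z - x) (z - x) / r\<^sup>2))\<^sup>2"
  obtains \<Phi>' where "\<And>z. (\<Phi> has_derivative \<Phi>' z) (at z)"
    "\<And>z u. \<bar>\<Phi>' z u\<bar> \<le> 4 / r * rnorm g x u"
    "\<And>z u. rnorm g x (z - x) \<ge> r \<Longrightarrow> \<Phi>' z u = 0"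
proof -
  note bb = bilinear_conv_bounded_bilinear[THEN iffD1, OF metric_bilinear[OF g, of x]]
  define \<Phi>' where "\<Phi>' z u = - 2 * max 0 (1 - g x (z - x) (z - x) / r\<^sup>2) * (2 * g x (z - x) u / r\<^sup>2)" for z u
  have D: "(\<Phi> has_derivative \<Phi>' z) (at z)" for z
  proof -
    have id: "((\<lambda>z. z - x) has_derivative (\<lambda>u. u)) (at z)"
      using has_derivative_diff[OF has_derivative_ident has_derivative_const[of x]] by simp
    have "((\<lambda>z. g x (z - x) (z - x)) has_derivative (\<lambda>u. g x (z - x) u + g x u (z - x))) (at z)"
      by (rule bounded_bilinear.FDERIV[OF bb id id])
    then have "((\<lambda>z. inverse (r\<^sup>2) *\<^sub>R g x (z - x) (z - x)) has_derivative
        (\<lambda>u. inverse (r\<^sup>2) *\<^sub>R (g x (z - x) u + g x u (z - x)))) (at z)"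
      by (rule has_derivative_scaleR_right)
    moreover have "(\<lambda>z. inverse (r\<^sup>2) *\<^sub>R g x (z - x) (z - x)) = (\<lambda>z. g x (z - x) (z - x) / r\<^sup>2)"
      by (simp add: fun_eq_iff field_simps)
    moreover have "(\<lambda>u. inverse (r\<^sup>2) *\<^sub>R (g x (z - x) u + g x u (z - x))) = (\<lambda>u. 2 * g x (z - x) u / r\<^sup>2)"
    proof
      fix u
      show "inverse (r\<^sup>2) *\<^sub>R (g x (z - x) u + g x u (z - x)) = 2 * g x (z - x) u / r\<^sup>2"
        unfolding metric_sym[OF g, of x u "z - x"] by (simp add: field_simps)
    qed
    ultimately have "((\<lambda>z. g x (z - x) (z - x) / r\<^sup>2) has_derivative (\<lambda>u. 2 * g x (z - x) u / r\<^sup>2)) (at z)"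
      by simp
    from has_derivative_compose[OF this square_cutoff_has_derivative[unfolded has_field_derivative_def]]
    show ?thesis unfolding \<Phi>_def \<Phi>'_def[abs_def] by simp
  qed
  have zero: "\<Phi>' z u = 0" if "rnorm g x (z - x) \<ge> r" for z u
  proof -
    have "r\<^sup>2 \<le> g x (z - x) (z - x)"
      using that \<open>r > 0\<close> rnorm_sq[OF g, of x "z - x"] power_mono[of r "rnorm g x (z - x)" 2] by simp
    then show ?thesis using \<open>r > 0\<close> by (simp add: \<Phi>'_def)
  qed
  have "\<bar>\<Phi>' z u\<bar> \<le> 4 / r * rnorm g x u" for z u
  proof (cases "rnorm g x (z - x) \<ge> r")
    case True
    then show ?thesis using zero \<open>r > 0\<close> by (simp add: rnorm_nonneg[OF g])
  next
    case False
    have "\<bar>g x (z - x) u\<bar> \<le> rnorm g x (z - x) * rnorm g x u"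
      by (rule metric_Cauchy_Schwarz[OF g])
    also have "\<dots> \<le> r * rnorm g x u"
      using False by (intro mult_right_mono rnorm_nonneg[OF g]) simp
    finally have 1: "\<bar>2 * g x (z - x) u / r\<^sup>2\<bar> \<le> 2 * (r * rnorm g x u) / r\<^sup>2"
      by (simp add: abs_mult divide_right_mono)
    have 2: "\<bar>- 2 * max 0 (1 - g x (z - x) (z - x) / r\<^sup>2)\<bar> \<le> 2"
      using metric_nonneg[OF g, of x "z - x"] by (auto simp: max_def)
    have "\<bar>\<Phi>' z u\<bar> \<le> 2 * (2 * (r * rnorm g x u) / r\<^sup>2)"
      unfolding \<Phi>'_def abs_mult[of "- 2 * max _ _"] by (intro mult_mono 1 2) auto
    then show ?thesis using \<open>r > 0\<close> by (simp add: power2_eq_square)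
  qed
  then show ?thesis using that D zero by blast
qed

lemma rdist_pos:
  assumes g: "riemannian_metric g" and "x \<noteq> y"
  shows "rdist g x y > 0"
proof -
  obtain \<delta> where \<delta>: "\<delta> > 0" "\<And>z w. dist x z < \<delta> \<Longrightarrow> rnorm g x w \<le> 2 * rnorm g z w \<and> rnorm g z w \<le> 2 * rnorm g x w"
    by (rule rnorm_nearby[OF g, of x]) blast
  obtain c C where c: "c > 0" "\<And>z w. z \<in> {x} \<Longrightarrow> c * norm w \<le> rnorm g z w \<and> rnorm g z w \<le> C * norm w"
    by (rule rnorm_compact_bounds[OF g, of "{x}"]) auto
  \<comment> \<open>The first bound keeps the support of the bump where norms are within a factor 2
    of those at \<open>x\<close>; the second puts \<open>y\<close> outside the support.\<close>
  define r where "r = min (c * \<delta>) (rnorm g x (y - x))"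
  have r: "r > 0" using c \<delta> \<open>x \<noteq> y\<close> by (simp add: r_def rnorm_pos[OF g])
  let ?\<Phi> = "\<lambda>z. (max 0 (1 - g x (z - x) (z - x) / r\<^sup>2))\<^sup>2"
  obtain \<Phi>' where \<Phi>': "\<And>z. (?\<Phi> has_derivative \<Phi>' z) (at z)"
    "\<And>z u. \<bar>\<Phi>' z u\<bar> \<le> 4 / r * rnorm g x u" "\<And>z u. rnorm g x (z - x) \<ge> r \<Longrightarrow> \<Phi>' z u = 0"
    by (rule metric_bump[OF g r]) blast
  have "\<bar>\<Phi>' z u\<bar> \<le> 8 / r * rnorm g z u" for z u
  proof (cases "rnorm g x (z - x) \<ge> r")
    case True
    then show ?thesis using \<Phi>'(3) r by (simp add: rnorm_nonneg[OF g])
  next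
    case False
    then have "c * norm (z - x) < c * \<delta>"
      using c(2)[of x "z - x"] by (auto simp: r_def)
    then have "dist x z < \<delta>" using c(1) by (simp add: dist_norm norm_minus_commute)
    then have "4 / r * rnorm g x u \<le> 4 / r * (2 * rnorm g z u)"
      using \<delta>(2) r by (intro mult_left_mono) auto
    then show ?thesis using \<Phi>'(2)[of z u] by simp
  qed
  then have "\<bar>?\<Phi> x - ?\<Phi> y\<bar> \<le> 8 / r * rdist g x y"
    using r by (intro rdist_test_function[OF g \<Phi>'(1)]) auto
  moreover have "r\<^sup>2 \<le> g x (y - x) (y - x)"
    using r rnorm_sq[OF g, of x "y - x"] power_mono[of r "rnorm g x (y - x)" 2] by (simp add: r_def)
  then have "?\<Phi> y = 0" using r by simp
  moreover have "?\<Phi> x = 1" by (simp add: metric_zero[OF g])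
  ultimately have "1 \<le> 8 / r * rdist g x y" by simp
  then show ?thesis using r rdist_nonneg[OF g, of x y]
    by (metis less_eq_real_def mult_zero_right not_one_le_zero)
qed

lemma rdist_Metric_space:
  assumes "riemannian_metric g"
  shows "Metric_space UNIV (rdist g)"
proof
  show "0 \<le> rdist g x y" for x y by (rule rdist_nonneg[OF assms])
  show "rdist g x y = rdist g y x" for x y
    by (intro antisym rdist_sym_le[OF assms])
  show "(rdist g x y = 0) = (x = y)" for x y
    using rdist_pos[OF assms, of x y] rdist_refl[OF assms] by (cases "x = y") auto
  show "rdist g x z \<le> rdist g x y + rdist g y z" for x y z
    by (rule rdist_triangle[OF assms])
qed

text \<open>The norm can be recovered from the distance up to constants. The upper bound is the
  length of a segment; the lower one comes from a cut-off linear functional with Lipschitz constant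
  \<open>10 * W\<close> that grows by at least \<open>s * W^2 / 4\<close> over the displacement,
  whence the factor 40.\<close>

lemma rdist_infinitesimal:
  assumes g: "riemannian_metric g"
  obtains \<epsilon> where "\<epsilon> > 0"
    "\<And>s. 0 < s \<Longrightarrow> s < \<epsilon> \<Longrightarrow> s * rnorm g x w \<le> 40 * rdist g x (x + s *\<^sub>R w)"
    "\<And>s. 0 < s \<Longrightarrow> s < \<epsilon> \<Longrightarrow> rdist g x (x + s *\<^sub>R w) \<le> 2 * s * rnorm g x w"
proof (cases "w = 0")
  case True
  then show ?thesis
    using that[of 1] by (simp add: rnorm_zero[OF g] rdist_refl[OF g])
next
  case False
  define W where "W = rnorm g x w"
  have W: "W > 0" using False by (simp add: W_def rnorm_pos[OF g])
  obtain \<delta> where \<delta>: "\<delta> > 0" "\<And>z w. dist x z < \<delta> \<Longrightarrow> rnorm g x w \<le> 2 * rnorm g z w \<and> rnorm g z w \<le> 2 * rnorm g x w"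
    by (rule rnorm_nearby[OF g, of x]) blast
  obtain c C where c: "c > 0" "\<And>z w. z \<in> {x} \<Longrightarrow> c * norm w \<le> rnorm g z w \<and> rnorm g z w \<le> C * norm w"
    by (rule rnorm_compact_bounds[OF g, of "{x}"]) auto
  define r where "r = c * \<delta>"
  have r: "r > 0" using c \<delta> by (simp add: r_def)
  let ?\<Phi> = "\<lambda>z. (max 0 (1 - g x (z - x) (z - x) / r\<^sup>2))\<^sup>2"
  obtain \<Phi>' where \<Phi>': "\<And>z. (?\<Phi> has_derivative \<Phi>' z) (at z)"
    "\<And>z u. \<bar>\<Phi>' z u\<bar> \<le> 4 / r * rnorm g x u" "\<And>z u. rnorm g x (z - x) \<ge> r \<Longrightarrow> \<Phi>' z u = 0"
    by (rule metric_bump[OF g r]) blast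
  \<comment> \<open>The functional dual to \<open>w\<close>, cut off near \<open>x\<close>, detects
    displacement along \<open>w\<close>.\<close>
  let ?F = "\<lambda>z. ?\<Phi> z * g x w (z - x)"
  have lin: "(g x w has_derivative g x w) (at z)" for z
    by (rule linear_imp_has_derivative[OF metric_linear[OF g]])
  have "((\<lambda>z. g x w (z - x)) has_derivative g x w) (at z)" for z
    by (rule has_derivative_compose[OF _ lin, of "\<lambda>z. z - x" "\<lambda>u. u"]) (auto intro!: derivative_eq_intros)
  then have F: "(?F has_derivative (\<lambda>u. ?\<Phi> z * g x w u + \<Phi>' z u * g x w (z - x))) (at z)" for z
    using has_derivative_mult[OF \<Phi>'(1)] by blast
  have bound: "\<bar>?\<Phi> z * g x w u + \<Phi>' z u * g x w (z - x)\<bar> \<le> (10 * W) * rnorm g z u" for z u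
  proof (cases "rnorm g x (z - x) \<ge> r")
    case True
    then have "r\<^sup>2 \<le> g x (z - x) (z - x)"
      using r rnorm_sq[OF g, of x "z - x"] power_mono[of r "rnorm g x (z - x)" 2] by simp
    then show ?thesis
      using True \<Phi>'(3) r W by (simp add: rnorm_nonneg[OF g])
  next
    case False
    then have "c * norm (z - x) < c * \<delta>"
      using c(2)[of x "z - x"] by (auto simp: r_def)
    then have "dist x z < \<delta>" using c(1) by (simp add: dist_norm norm_minus_commute)
    then have near: "rnorm g x u \<le> 2 * rnorm g z u" using \<delta>(2) by blast
    have "\<bar>?\<Phi> z * g x w u\<bar> \<le> 1 * (W * rnorm g x u)"
      unfolding abs_mult W_def
      using square_cutoff_bounds[of "g x (z - x) (z - x) / r\<^sup>2"] metric_nonneg[OF g, of x "z - x"]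
      by (intro mult_mono metric_Cauchy_Schwarz[OF g]) auto
    moreover have "\<bar>\<Phi>' z u * g x w (z - x)\<bar> \<le> (4 / r * rnorm g x u) * (W * r)"
      unfolding abs_mult
    proof (intro mult_mono \<Phi>')
      have "\<bar>g x w (z - x)\<bar> \<le> W * rnorm g x (z - x)"
        unfolding W_def by (rule metric_Cauchy_Schwarz[OF g])
      also have "\<dots> \<le> W * r" using False W by simp
      finally show "\<bar>g x w (z - x)\<bar> \<le> W * r" .
    qed (use r in \<open>auto simp: rnorm_nonneg[OF g]\<close>)
    \<comment> \<open>Here 5 is 1 + 4: the bump is at most 1, and its slope \<open>4 / r\<close>
      meets a functional of size at most \<open>W * r\<close>. Passing from the norm at
      \<open>x\<close> to that at \<open>z\<close> doubles it.\<close>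
    ultimately have "\<bar>?\<Phi> z * g x w u + \<Phi>' z u * g x w (z - x)\<bar> \<le> 5 * (W * rnorm g x u)"
      using r by (simp add: field_simps)
    also have "\<dots> \<le> 5 * (W * (2 * rnorm g z u))"
      using near W by (intro mult_left_mono) auto
    finally show ?thesis by simp
  qed
  note test = rdist_test_function[OF g F bound]
  \<comment> \<open>The first bound gives \<open>s * W < r / 2\<close>, so the bump is still at
    least 1/4 at the displaced point; the second keeps the segment in the ball of radius
    \<open>\<delta>\<close>.\<close>
  define \<epsilon> where "\<epsilon> = min (r / (2 * W)) (\<delta> / (norm w))"
  show thesis
  proof (rule that[of \<epsilon>])
    show "\<epsilon> > 0" using r W \<delta> False by (simp add: \<epsilon>_def)
    show "s * rnorm g x w \<le> 40 * rdist g x (x + s *\<^sub>R w)" if s: "0 < s" "s < \<epsilon>" for s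
    proof -
      have sq: "g x (s *\<^sub>R w) (s *\<^sub>R w) = (s * W)\<^sup>2" "g x w w = W\<^sup>2"
        using rnorm_sq[OF g, of x "s *\<^sub>R w"] rnorm_sq[OF g, of x w] s by (simp_all add: rnorm_scale[OF g] W_def)
      have "s * W < r / 2" using s W by (simp add: \<epsilon>_def field_simps)
      then have "(s * W)\<^sup>2 \<le> (r / 2)\<^sup>2" using s W by (intro power_mono) auto
      then have "(s * W)\<^sup>2 / r\<^sup>2 \<le> (r / 2)\<^sup>2 / r\<^sup>2" by (rule divide_right_mono) simp
      moreover have "(r / 2)\<^sup>2 / r\<^sup>2 = 1/4" using r by (simp add: power2_eq_square)
      ultimately have "(s * W)\<^sup>2 / r\<^sup>2 \<le> 1/2" by linarith
      then have "1/2 \<le> max 0 (1 - (s * W)\<^sup>2 / r\<^sup>2)" unfolding le_max_iff_disj by linarith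
      then have "(1/2)\<^sup>2 \<le> (max 0 (1 - (s * W)\<^sup>2 / r\<^sup>2))\<^sup>2" by (rule power_mono) simp
      from mult_right_mono[OF this, of "s * W\<^sup>2"] have low: "(1/2)\<^sup>2 * (s * W\<^sup>2) \<le> (max 0 (1 - (s * W)\<^sup>2 / r\<^sup>2))\<^sup>2 * (s * W\<^sup>2)"
        using s by simp
      have "\<bar>?F x - ?F (x + s *\<^sub>R w)\<bar> \<le> 10 * W * rdist g x (x + s *\<^sub>R w)"
        by (rule test) (use W in auto)
      moreover have "?F (x + s *\<^sub>R w) = (max 0 (1 - (s * W)\<^sup>2 / r\<^sup>2))\<^sup>2 * (s * W\<^sup>2)"
        using sq linear_cmul[OF metric_linear[OF g], of x w s w] by simp
      moreover have "?F x = 0" by (simp add: metric_zero[OF g])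
      moreover have "(1/2)\<^sup>2 * (s * W\<^sup>2) = s * W\<^sup>2 / 4" by (simp add: power2_eq_square)
      ultimately have "s * W\<^sup>2 / 4 \<le> 10 * W * rdist g x (x + s *\<^sub>R w)"
        using low by linarith
      then have "W * (s * W) \<le> W * (40 * rdist g x (x + s *\<^sub>R w))"
        by (simp add: power2_eq_square algebra_simps)
      then show ?thesis using W by (simp add: W_def)
    qed
    show "rdist g x (x + s *\<^sub>R w) \<le> 2 * s * rnorm g x w" if s: "0 < s" "s < \<epsilon>" for s
    proof (rule rdist_le_segment[OF g])
      fix t :: real assume t: "t \<in> {0..1}"
      have "dist x (linepath x (x + s *\<^sub>R w) t) = t * s * norm w"
        using t s by (simp add: linepath_def dist_norm algebra_simps)
      also have "\<dots> \<le> s * norm w" using t s by (simp add: mult_left_le_one_le)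
      also have "\<dots> < \<delta>" using s False by (simp add: \<epsilon>_def field_simps)
      finally show "rnorm g (linepath x (x + s *\<^sub>R w) t) (x + s *\<^sub>R w - x) \<le> 2 * s * rnorm g x w"
        using \<delta>(2) s by (simp add: rnorm_scale[OF g])
    qed
  qed
qed

text \<open>A Lipschitz identity map has a bounded derivative. The factor 80 collects 40 and 2 from
  the two estimates for small displacements.\<close>

lemma rnorm_le_if_rdist_le:
  assumes g: "riemannian_metric g" and h: "riemannian_metric h" and "L > 0"
    and le: "\<And>x y. rdist g x y \<le> L * rdist h x y"
  shows "rnorm g x w \<le> 80 * L * rnorm h x w"
proof -
  obtain a where a: "a > 0" "\<And>s. 0 < s \<Longrightarrow> s < a \<Longrightarrow> s * rnorm g x w \<le> 40 * rdist g x (x + s *\<^sub>R w)"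
    by (rule rdist_infinitesimal[OF g, of x w]) blast
  obtain b where b: "b > 0" "\<And>s. 0 < s \<Longrightarrow> s < b \<Longrightarrow> rdist h x (x + s *\<^sub>R w) \<le> 2 * s * rnorm h x w"
    by (rule rdist_infinitesimal[OF h, of x w]) blast
  define s where "s = min a b / 2"
  have s: "0 < s" "s < a" "s < b" using a b by (auto simp: s_def)
  have "s * rnorm g x w \<le> 40 * (L * (2 * s * rnorm h x w))"
    using a(2)[OF s(1,2)] le[of x "x + s *\<^sub>R w"] b(2)[OF s(1,3)] mult_left_mono[OF b(2)[OF s(1,3)], of L] \<open>L > 0\<close>
    by linarith
  then have "s * rnorm g x w \<le> s * (80 * L * rnorm h x w)" by (simp add: algebra_simps)
  then show ?thesis using s(1) by simp
qed

section \<open>Completeness and affine contractions\<close>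

lemma euclidean_riemannian_metric: "riemannian_metric (\<lambda>x::'a::euclidean_space. \<lambda>v w. v \<bullet> w)"
proof -
  have "bilinear ((\<bullet>) :: 'a \<Rightarrow> 'a \<Rightarrow> real)"
    by (simp add: bilinear_def linear_iff inner_add_left inner_add_right)
  then show ?thesis
    by (auto simp: riemannian_metric_def smooth_def Ck_const inner_commute)
qed

lemma tendsto_rdist_zero:
  assumes g: "riemannian_metric g" and "s \<longlonglongrightarrow> l"
  shows "(\<lambda>n. rdist g (s n) l) \<longlonglongrightarrow> 0"
proof -
  obtain c C where C: "C > 0" "\<And>z w. z \<in> cball l 1 \<Longrightarrow> c * norm w \<le> rnorm g z w \<and> rnorm g z w \<le> C * norm w"
    by (rule rnorm_compact_bounds[OF g, of "cball l 1"]) auto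
  have "eventually (\<lambda>n. dist (s n) l < 1) sequentially"
    using assms(2) by (rule tendstoD) simp
  then have *: "eventually (\<lambda>n. norm (rdist g (s n) l) \<le> C * norm (l - s n)) sequentially"
  proof eventually_elim
    case (elim n)
    have "rdist g (s n) l \<le> C * norm (l - s n)"
    proof (rule rdist_le_segment[OF g])
      fix t :: real assume t: "t \<in> {0..1}"
      have "s n \<in> cball l 1" "l \<in> cball l 1" using elim by (auto simp: dist_commute)
      then have "closed_segment (s n) l \<subseteq> cball l 1"
        by (intro closed_segment_subset convex_cball)
      then have "linepath (s n) l t \<in> cball l 1"
        using linepath_in_path[OF t, of "s n" l] by blast
      then show "rnorm g (linepath (s n) l t) (l - s n) \<le> C * norm (l - s n)"
        using C(2) by blast
    qed
    then show ?case by (simp add: rdist_nonneg[OF g])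
  qed
  have "(\<lambda>n. C * norm (l - s n)) \<longlonglongrightarrow> C * norm (l - l)"
    by (intro tendsto_intros assms(2))
  then have "(\<lambda>n. C * norm (l - s n)) \<longlonglongrightarrow> 0" by simp
  with * show ?thesis by (rule Lim_null_comparison)
qed

text \<open>\<open>H\<close> is 1-Lipschitz for \<open>rdist\<close>, so a Cauchy sequence stays in
  a slab where \<open>H\<close> is bounded. There the metric dominates a multiple of the euclidean
  one, so the sequence is bounded, and a euclidean limit of a subsequence is its limit.\<close>

lemma complete_riemannian_metric_criterion:
  fixes g :: "'a::euclidean_space \<Rightarrow> 'a \<Rightarrow> 'a \<Rightarrow> real" and H :: "'a \<Rightarrow> real"
  assumes g: "riemannian_metric g"
    and H: "\<And>z. (H has_derivative H' z) (at z)"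
    and H_le: "\<And>z u. \<bar>H' z u\<bar> \<le> rnorm g z u"
    and lower: "\<And>T. \<exists>c>0. \<forall>z u. \<bar>H z\<bar> \<le> T \<longrightarrow> c * norm u \<le> rnorm g z u"
  shows "complete_riemannian_metric g"
proof -
  interpret M: Metric_space UNIV "rdist g"
    by (rule rdist_Metric_space[OF g])
  have conv: "\<exists>l. limitin M.mtopology \<sigma> l sequentially" if "M.MCauchy \<sigma>" for \<sigma>
  proof -
    have cauchy: "\<exists>N. \<forall>n n'. N \<le> n \<longrightarrow> N \<le> n' \<longrightarrow> rdist g (\<sigma> n) (\<sigma> n') < \<epsilon>" if "\<epsilon> > 0" for \<epsilon>
      using \<open>M.MCauchy \<sigma>\<close> that unfolding M.MCauchy_def by blast
    obtain N1 where N1: "\<And>n n'. N1 \<le> n \<Longrightarrow> N1 \<le> n' \<Longrightarrow> rdist g (\<sigma> n) (\<sigma> n') < 1"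
      using cauchy[of 1] by auto
    define T where "T = \<bar>H (\<sigma> N1)\<bar> + 1"
    have HT: "\<bar>H (\<sigma> n)\<bar> \<le> T" if "n \<ge> N1" for n
      using rdist_test_function[OF g H, of 1 "\<sigma> n" "\<sigma> N1"] H_le N1[OF that order_refl]
      by (simp add: T_def)
    obtain c where c: "c > 0" "\<And>z u. \<bar>H z\<bar> \<le> T + 1 \<Longrightarrow> c * norm u \<le> rnorm g z u"
      using lower[of "T + 1"] by blast
    \<comment> \<open>The Lipschitz constant of the test function below, from the product rule: 4
      from the cutoff in \<open>H\<close>, and \<open>4 / c\<close> from the euclidean
      cutoff.\<close>
    define C where "C = 4 + 4 / c"
    have "C > 0" using c(1) by (simp add: C_def add_pos_pos)
    then obtain N2 where N2: "N2 \<ge> N1" "\<And>n n'. N2 \<le> n \<Longrightarrow> N2 \<le> n' \<Longrightarrow> rdist g (\<sigma> n) (\<sigma> n') < 1 / C"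
      using cauchy[of "1 / C"] by (metis max.bounded_iff max.cobounded1 zero_less_divide_1_iff)
    define x where "x = \<sigma> N2"
    define a where "a z = H z - H x" for z
    \<comment> \<open>A curve between points of the slab may leave it, and outside there is no lower
      bound on the metric. The factor \<open>?A\<close> vanishes once \<open>H\<close> has changed
      by 1, so the test function ignores such excursions.\<close>
    let ?A = "\<lambda>z. (max 0 (1 - a z * a z))\<^sup>2"
    let ?A' = "\<lambda>z u. - 2 * max 0 (1 - a z * a z) * (a z * H' z u + H' z u * a z)"
    let ?B = "\<lambda>z. (max 0 (1 - (z - x) \<bullet> (z - x) / 1\<^sup>2))\<^sup>2"
    obtain B' where B': "\<And>z. (?B has_derivative B' z) (at z)"
      "\<And>z u. \<bar>B' z u\<bar> \<le> 4 / 1 * rnorm (\<lambda>x. (\<bullet>)) x u"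
      by (rule metric_bump[OF euclidean_riemannian_metric zero_less_one, of x]) blast
    have "(a has_derivative H' z) (at z)" for z
      unfolding a_def using has_derivative_diff[OF H has_derivative_const[of "H x"]] by simp
    then have "((\<lambda>z. a z * a z) has_derivative (\<lambda>u. a z * H' z u + H' z u * a z)) (at z)" for z
      by (intro has_derivative_mult)
    from has_derivative_compose[OF this square_cutoff_has_derivative[unfolded has_field_derivative_def]]
    have A': "(?A has_derivative ?A' z) (at z)" for z .
    have "((\<lambda>z. ?A z * ?B z) has_derivative (\<lambda>u. ?A z * B' z u + ?A' z u * ?B z)) (at z)" for z
      by (rule has_derivative_mult[OF A' B'(1)])
    moreover have "\<bar>?A z * B' z u + ?A' z u * ?B z\<bar> \<le> C * rnorm g z u" for z u
    proof (cases "\<bar>a z\<bar> < 1")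
      case True
      have "\<bar>H z\<bar> \<le> T + 1" using True HT[OF N2(1)] by (simp add: a_def x_def)
      then have "norm u \<le> rnorm g z u / c" using c by (simp add: field_simps)
      moreover have "rnorm (\<lambda>x. (\<bullet>)) x u = norm u" by (simp add: rnorm_def norm_eq_sqrt_inner)
      ultimately have "\<bar>B' z u\<bar> \<le> 4 * (rnorm g z u / c)" using B'(2)[of z u] by simp
      then have 1: "\<bar>?A z * B' z u\<bar> \<le> 1 * (4 * (rnorm g z u / c))"
        unfolding abs_mult by (intro mult_mono) (auto intro!: power_le_one)
      have "\<bar>a z * H' z u + H' z u * a z\<bar> = 2 * (\<bar>a z\<bar> * \<bar>H' z u\<bar>)"
        by (simp add: abs_mult mult.commute flip: mult_2)
      also have "\<dots> \<le> 2 * (1 * rnorm g z u)"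
        using True H_le[of z u] by (intro mult_left_mono mult_mono) auto
      finally have "\<bar>- 2 * max 0 (1 - a z * a z)\<bar> * \<bar>a z * H' z u + H' z u * a z\<bar> \<le> 2 * (2 * (1 * rnorm g z u))"
        by (intro mult_mono) auto
      then have "\<bar>?A' z u\<bar> * \<bar>?B z\<bar> \<le> (2 * (2 * (1 * rnorm g z u))) * 1"
        unfolding abs_mult[symmetric]
        using rnorm_nonneg[OF g, of z u]
        by (subst abs_mult, intro mult_mono) (auto intro!: power_le_one)
      then have "\<bar>?A' z u * ?B z\<bar> \<le> 4 * rnorm g z u" by (simp add: abs_mult)
      with 1 have "\<bar>?A z * B' z u + ?A' z u * ?B z\<bar> \<le> 4 * (rnorm g z u / c) + 4 * rnorm g z u"
        by linarith
      also have "\<dots> = C * rnorm g z u" by (simp add: C_def algebra_simps)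
      finally show ?thesis .
    next
      case False
      then have "1 * 1 \<le> \<bar>a z\<bar> * \<bar>a z\<bar>" by (intro mult_mono) auto
      then have "max 0 (1 - a z * a z) = 0" by (simp flip: abs_mult)
      then show ?thesis using \<open>C > 0\<close> by (simp add: rnorm_nonneg[OF g])
    qed
    ultimately have test: "\<bar>?A y * ?B y - ?A z * ?B z\<bar> \<le> C * rdist g y z" for y z
      using \<open>C > 0\<close> by (intro rdist_test_function[OF g])
    \<comment> \<open>Outside the unit ball the test function is 0, while it is 1 at
      \<open>x\<close>; leaving the ball would cost a distance of at least
      \<open>1 / C\<close>.\<close>
    have bdd: "\<sigma> (N2 + n) \<in> cball x 1" for n
    proof (rule ccontr)
      assume "\<sigma> (N2 + n) \<notin> cball x 1"
      then have "1 < norm (\<sigma> (N2 + n) - x)" by (simp add: dist_norm norm_minus_commute)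
      then have "1\<^sup>2 \<le> (norm (\<sigma> (N2 + n) - x))\<^sup>2" by (intro power_mono) auto
      then have "1 \<le> (\<sigma> (N2 + n) - x) \<bullet> (\<sigma> (N2 + n) - x)" by (simp add: power2_norm_eq_inner)
      then have "?B (\<sigma> (N2 + n)) = 0" by simp
      moreover have "?A x * ?B x = 1" by (simp add: a_def)
      ultimately have "1 \<le> C * rdist g x (\<sigma> (N2 + n))" using test[of x "\<sigma> (N2 + n)"] by simp
      moreover have "C * rdist g x (\<sigma> (N2 + n)) < C * (1 / C)"
        using N2(2)[of N2 "N2 + n"] \<open>C > 0\<close> unfolding x_def by (intro mult_strict_left_mono) auto
      ultimately show False using \<open>C > 0\<close> by simp
    qed
    then obtain l r where r: "strict_mono r" "((\<lambda>n. \<sigma> (N2 + n)) \<circ> r) \<longlonglongrightarrow> l"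
      using compact_cball[of x 1] unfolding compact_def by metis
    have to0: "(\<lambda>n. rdist g (\<sigma> (N2 + r n)) l) \<longlonglongrightarrow> 0"
      using tendsto_rdist_zero[OF g r(2)] by (simp add: o_def)
    have "limitin M.mtopology \<sigma> l sequentially"
      unfolding M.limitin_metric
    proof (intro conjI allI impI)
      fix \<epsilon> :: real assume "\<epsilon> > 0"
      then obtain N where N: "\<And>n n'. N \<le> n \<Longrightarrow> N \<le> n' \<Longrightarrow> rdist g (\<sigma> n) (\<sigma> n') < \<epsilon> / 2"
        using cauchy[of "\<epsilon> / 2"] by auto
      have "eventually (\<lambda>n. rdist g (\<sigma> (N2 + r n)) l < \<epsilon> / 2) sequentially"
        by (rule order_tendstoD(2)[OF to0]) (use \<open>\<epsilon> > 0\<close> in simp)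
      then obtain K where K: "\<And>n. n \<ge> K \<Longrightarrow> rdist g (\<sigma> (N2 + r n)) l < \<epsilon> / 2"
        unfolding eventually_sequentially by blast
      define m where "m = max K N"
      have m: "N \<le> N2 + r m" "rdist g (\<sigma> (N2 + r m)) l < \<epsilon> / 2"
        using seq_suble[OF r(1), of m] K by (auto simp: m_def)
      have "rdist g (\<sigma> n) l < \<epsilon>" if "n \<ge> N" for n
        using rdist_triangle[OF g, of "\<sigma> n" l "\<sigma> (N2 + r m)"] N[OF that m(1)] m(2) by linarith
      then show "eventually (\<lambda>n. \<sigma> n \<in> UNIV \<and> rdist g (\<sigma> n) l < \<epsilon>) sequentially"
        unfolding eventually_sequentially by blast
    qed simp
    then show ?thesis by blast
  qed
  have "M.mcomplete"
    unfolding M.mcomplete_def using conv by blast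
  with g show ?thesis
    by (simp only: complete_riemannian_metric_def)
qed

text \<open>The image of a competing curve has at most \<open>q\<close> times its speed. As
  \<open>rdist\<close> admits only curves of integrable speed, integrability has to be derived for
  the image as well.\<close>

lemma rdist_affine_contraction:
  assumes g: "riemannian_metric g" and L: "linear L"
    and F: "\<And>x. F x = L x + b"
    and le: "\<And>x w. rnorm g (F x) (L w) \<le> q * rnorm g x w" and "q > 0"
  shows "rdist g (F x) (F y) \<le> q * rdist g x y"
proof -
  have "rdist g (F x) (F y) / q \<le> rdist g x y"
  proof (rule rdist_greatest[OF g])
    fix \<gamma> assume \<gamma>: "admissible g \<gamma> x y"
    obtain S where S: "finite S" "continuous_on {0..1} \<gamma>" "\<gamma> C1_differentiable_on {0..1} - S"
      using \<gamma> unfolding admissible_def[OF g] valid_path_def piecewise_C1_differentiable_on_def by blast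
    have bl: "bounded_linear L" using L by (simp add: linear_conv_bounded_linear)
    let ?\<delta> = "\<lambda>t. F (\<gamma> t)"
    have v: "(?\<delta> has_vector_derivative L (vector_derivative \<gamma> (at t))) (at t)" if "t \<in> {0..1} - S" for t
    proof -
      have "(\<gamma> has_vector_derivative vector_derivative \<gamma> (at t)) (at t)"
        using S(3) that by (auto simp: C1_differentiable_on_eq vector_derivative_works)
      from bounded_linear.has_vector_derivative[OF bl this]
      show ?thesis unfolding F by (rule has_vector_derivative_add_const[THEN iffD2])
    qed
    then have vd: "vector_derivative ?\<delta> (at t) = L (vector_derivative \<gamma> (at t))" if "t \<in> {0..1} - S" for t
      using that vector_derivative_at by blast
    have c\<gamma>: "continuous_on ({0..1} - S) (\<lambda>t. vector_derivative \<gamma> (at t))"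
      using S(3) by (simp add: C1_differentiable_on_eq)
    have cF: "continuous_on {0..1} ?\<delta>"
      unfolding F by (rule continuous_on_add[OF linear_continuous_on_compose[OF S(2) L] continuous_on_const])
    have cd: "continuous_on ({0..1} - S) (\<lambda>t. L (vector_derivative \<gamma> (at t)))"
      by (rule linear_continuous_on_compose[OF c\<gamma> L])
    have "?\<delta> C1_differentiable_on {0..1} - S"
      unfolding C1_differentiable_on_def
      by (rule exI[of _ "\<lambda>t. L (vector_derivative \<gamma> (at t))"]) (use v cd in simp)
    then have valid: "valid_path ?\<delta>"
      using S(1) cF unfolding valid_path_def piecewise_C1_differentiable_on_def by blast
    have le': "rspeed g ?\<delta> t \<le> q * rspeed g \<gamma> t" if "t \<in> {0..1} - S" for t
      using vd[OF that] le by (simp add: rspeed_def)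
    have "continuous_on ({0..1} - S) (\<lambda>t. rnorm g (F (\<gamma> t)) (L (vector_derivative \<gamma> (at t))))"
      by (rule rnorm_continuous_on[OF g continuous_on_subset[OF cF] cd]) auto
    then have cont: "continuous_on ({0..1} - S) (rspeed g ?\<delta>)"
      by (rule continuous_on_eq) (use vd in \<open>simp only: rspeed_def\<close>)
    have neg: "negligible S" using S(1) by (rule negligible_finite)
    have int\<gamma>: "rspeed g \<gamma> integrable_on {0..1}" using \<gamma> by (simp add: admissible_def[OF g])
    have sub: "negligible {t \<in> {0..1} - ({0..1} - S). h t \<noteq> 0}" "negligible {t \<in> ({0..1} - S) - {0..1}. h t \<noteq> 0}"
      for h :: "real \<Rightarrow> real"
      by (rule negligible_subset[OF neg], auto)+
    \<comment> \<open>The image speed is continuous off the finite set \<open>S\<close>, hence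
      measurable, and is dominated by an integrable function.\<close>
    have "rspeed g ?\<delta> integrable_on ({0..1} - S)"
    proof (rule measurable_bounded_by_integrable_imp_integrable)
      have "{0..1} - S \<in> sets lebesgue"
        using negligible_imp_sets[OF neg] by (intro sets.Diff) auto
      then show "rspeed g ?\<delta> \<in> borel_measurable (lebesgue_on ({0..1} - S))" "{0..1} - S \<in> sets lebesgue"
        using continuous_imp_measurable_on_sets_lebesgue[OF cont] by auto
      show "(\<lambda>t. q *\<^sub>R rspeed g \<gamma> t) integrable_on ({0..1} - S)"
        by (rule integrable_cmul[OF integrable_spike_set[OF int\<gamma> sub]])
      show "norm (rspeed g ?\<delta> t) \<le> q *\<^sub>R rspeed g \<gamma> t" if "t \<in> {0..1} - S" for t
        using le'[OF that] by (simp add: rspeed_nonneg[OF g])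
    qed
    then have int\<delta>: "rspeed g ?\<delta> integrable_on {0..1}"
      by (rule integrable_spike_set[OF _ sub(2,1)])
    have "rdist g (F x) (F y) \<le> integral {0..1} (rspeed g ?\<delta>)"
    proof (rule rdist_le[OF g])
      show "admissible g ?\<delta> (F x) (F y)"
        using \<gamma> valid int\<delta> by (auto simp: admissible_def[OF g] pathstart_def pathfinish_def)
    qed
    also have "\<dots> = integral {0..1} (\<lambda>t. if t \<in> S then 0 else rspeed g ?\<delta> t)"
      by (rule integral_spike[OF neg]) auto
    also have "\<dots> \<le> integral {0..1} (\<lambda>t. q *\<^sub>R rspeed g \<gamma> t)"
    proof (rule integral_le)
      show "(\<lambda>t. if t \<in> S then 0 else rspeed g ?\<delta> t) integrable_on {0..1}"
        by (rule integrable_spike[OF int\<delta> neg]) auto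
      show "(\<lambda>t. q *\<^sub>R rspeed g \<gamma> t) integrable_on {0..1}"
        by (rule integrable_cmul[OF int\<gamma>])
      show "(if t \<in> S then 0 else rspeed g ?\<delta> t) \<le> q *\<^sub>R rspeed g \<gamma> t" if "t \<in> {0..1}" for t
        using le' that \<open>q > 0\<close> by (auto simp: rspeed_nonneg[OF g])
    qed
    also have "\<dots> = q * integral {0..1} (rspeed g \<gamma>)" by simp
    finally show "rdist g (F x) (F y) / q \<le> integral {0..1} (rspeed g \<gamma>)"
      using \<open>q > 0\<close> by (simp add: divide_le_eq mult.commute)
  qed
  then show ?thesis using \<open>q > 0\<close> by (simp add: divide_le_eq mult.commute)
qed

lemma affine_contraction_fixed_point:
  assumes g: "complete_riemannian_metric g" and L: "linear L"
    and F: "\<And>x. F x = L x + b"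
    and le: "\<And>x w. rnorm g (F x) (L w) \<le> q * rnorm g x w" and q: "0 < q" "q < 1"
  obtains p where "F p = p"
proof -
  have r: "riemannian_metric g" using g by (simp add: complete_riemannian_metric_def)
  interpret M: Metric_space UNIV "rdist g"
    by (rule rdist_Metric_space[OF r])
  have "M.mcomplete" using g by (simp add: complete_riemannian_metric_def)
  then show ?thesis
    using M.Banach_fixedpoint_thm[of F q] rdist_affine_contraction[OF r L F le q(1)] q(2) that by auto
qed

section \<open>Anosov splittings of affine diffeomorphisms\<close>

lemma continuous_subbundle_subspace:
  assumes "continuous_subbundle E" shows "subspace (E x)"
proof -
  obtain U k X where "x \<in> U" "\<forall>y\<in>U. span ((\<lambda>i::nat. X i y) ` {..<k::nat}) = E y"
    using assms unfolding continuous_subbundle_def by meson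
  then show ?thesis by (metis subspace_span)
qed

text \<open>A local frame fixes the dimension on its domain, and the space is connected. This
  permits computing an index at one convenient point.\<close>

lemma continuous_subbundle_dim_constant:
  fixes E :: "'a::euclidean_space \<Rightarrow> 'a set"
  assumes "continuous_subbundle E" shows "dim (E x) = dim (E y)"
proof (rule connected_local_const[of UNIV x y "\<lambda>x. dim (E x)"])
  show "\<forall>a\<in>UNIV. eventually (\<lambda>b. dim (E a) = dim (E b)) (at a)"
  proof
    fix a
    obtain U k X where U: "open U" "a \<in> U"
      "\<forall>y\<in>U. inj_on (\<lambda>i::nat. X i y) {..<k::nat} \<and> independent ((\<lambda>i. X i y) ` {..<k}) \<and>
         span ((\<lambda>i. X i y) ` {..<k}) = E y"
      using assms unfolding continuous_subbundle_def by meson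
    have dim: "dim (E y) = k" if "y \<in> U" for y
      using U(3) that by (metis card_image card_lessThan dim_eq_card_independent dim_span)
    have "eventually (\<lambda>b. b \<in> U) (at a)"
      using U(1,2) by (rule eventually_at_in_open')
    then show "eventually (\<lambda>b. dim (E a) = dim (E b)) (at a)"
      by eventually_elim (simp add: dim U(2))
  qed
qed auto

lemma continuous_splitting_dim:
  fixes Es :: "'a::euclidean_space \<Rightarrow> 'a set"
  assumes "continuous_splitting Es Eu"
  shows "dim (Es x) + dim (Eu x) = DIM('a)"
proof -
  have s: "subspace (Es x)" "subspace (Eu x)"
    using assms continuous_subbundle_subspace by (auto simp: continuous_splitting_def)
  have "{a + b |a b. a \<in> Es x \<and> b \<in> Eu x} = UNIV"
    using assms unfolding continuous_splitting_def by blast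
  moreover have "Es x \<inter> Eu x = {0}"
    using assms by (simp add: continuous_splitting_def)
  ultimately show ?thesis
    using dim_sums_Int[OF s] by (simp add: dim_UNIV)
qed

lemma linear_funpow:
  fixes L :: "'a::real_vector \<Rightarrow> 'a"
  shows "linear L \<Longrightarrow> linear (L ^^ m)"
  by (induction m) (auto intro: linear_compose linear_id)

lemma affine_funpow:
  fixes L :: "'a::real_vector \<Rightarrow> 'a"
  assumes L: "linear L" and f: "\<And>x. f x = L x + b"
  shows "(f ^^ m) x = (L ^^ m) x + (f ^^ m) 0"
  by (induction m) (simp_all add: f linear_add[OF L])

lemma affine_frechet_derivative:
  fixes L :: "'a::euclidean_space \<Rightarrow> 'a"
  assumes "linear L" and "\<And>x. f x = L x + b"
  shows "frechet_derivative f (at x) = L"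
proof -
  have "(f has_derivative L) (at x)"
    using has_derivative_add[OF linear_imp_has_derivative[OF assms(1)] has_derivative_const]
    by (simp add: assms(2)[abs_def])
  then show ?thesis by (rule frechet_derivative_at[symmetric])
qed

locale affine_diffeo =
  fixes L :: "'a::euclidean_space \<Rightarrow> 'a" and b :: 'a and f
  assumes linear_L: "linear L" and bij_L: "bij L" and f: "\<And>x. f x = L x + b"
begin

lemma inv_L: "inv L (L x) = x" "L (inv L x) = x"
  using bij_L by (simp_all add: bij_is_inj bij_is_surj surj_f_inv_f)

lemma linear_inv_L: "linear (inv L)"
  using linear_injective_left_inverse[of L] linear_L bij_L
  by (metis bij_is_inj bij_is_surj inj_linear_imp_inv_linear)

lemma inv_f: "inv f y = inv L y + - inv L b"
proof -
  have "f (inv L y + - inv L b) = y"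
    by (simp add: f linear_diff[OF linear_L] inv_L)
  moreover have "inj f"
    using bij_L by (auto simp: inj_def f bij_def)
  ultimately show ?thesis by (metis inv_f_f)
qed

lemma bij_f: "bij f"
proof (rule bijI)
  show "inj f" using bij_L by (auto simp: inj_def f bij_def)
  have "f (inv L y + - inv L b) = y" for y
    by (simp add: f linear_diff[OF linear_L] inv_L)
  then show "surj f" by (rule surjI)
qed

text \<open>Passing to the inverse exchanges the roles of the two bundles, so facts about
  contraction need proof only for the forward direction.\<close>

lemma affine_diffeo_inv: "affine_diffeo (inv L) (- inv L b) (inv f)"
  by (rule affine_diffeo.intro) (use linear_inv_L inv_f bij_imp_bij_inv[OF bij_L] in auto)

lemma derivative_funpow: "frechet_derivative (f ^^ m) (at x) = L ^^ m"
  by (rule affine_frechet_derivative[OF linear_funpow[OF linear_L] affine_funpow[OF linear_L f]])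

lemma derivative_f: "frechet_derivative f (at x) = L"
  by (rule affine_frechet_derivative[OF linear_L f])

lemma derivative_inv_funpow: "frechet_derivative (inv f ^^ m) (at x) = inv L ^^ m"
  by (rule affine_diffeo.derivative_funpow[OF affine_diffeo_inv])

lemma funpow_inv: "(inv L ^^ m) ((L ^^ m) x) = x" "(inv f ^^ m) ((f ^^ m) x) = x"
  by (induction m arbitrary: x)
     (simp_all add: funpow_swap1 inv_L inv_f_f[OF bij_is_inj[OF bij_f]])

lemma anosov_estimates:
  assumes "anosov_splitting f g Es Eu"
  obtains C \<theta> where "C \<ge> 1" "0 < \<theta>" "\<theta> < 1"
    "\<And>m x w. w \<in> Es x \<Longrightarrow> rnorm g ((f ^^ m) x) ((L ^^ m) w) \<le> C * \<theta> ^ m * rnorm g x w"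
    "\<And>m x w. w \<in> Eu x \<Longrightarrow> rnorm g ((inv f ^^ m) x) ((inv L ^^ m) w) \<le> C * \<theta> ^ m * rnorm g x w"
  using assms unfolding anosov_splitting_def derivative_funpow derivative_inv_funpow by blast

lemma anosov_invariant:
  assumes "anosov_splitting f g Es Eu"
  shows "L ` Es x = Es (f x)" "L ` Eu x = Eu (f x)"
  using assms unfolding anosov_splitting_def invariant_subbundle_def derivative_f by auto

lemma anosov_unstable_funpow:
  assumes "anosov_splitting f g Es Eu" and "w \<in> Eu x"
  shows "(L ^^ m) w \<in> Eu ((f ^^ m) x)"
  by (induction m) (use assms(2) anosov_invariant(2)[OF assms(1)] in auto)

text \<open>The backward estimate, read at the forward image of \<open>x\<close>, becomes a lower
  bound for forward growth.\<close>

lemma anosov_unstable_lower: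
  assumes A: "anosov_splitting f g Es Eu"
    and est: "\<And>m x w. w \<in> Eu x \<Longrightarrow> rnorm g ((inv f ^^ m) x) ((inv L ^^ m) w) \<le> C * \<theta> ^ m * rnorm g x w"
    and w: "w \<in> Eu x"
  shows "rnorm g x w \<le> C * \<theta> ^ m * rnorm g ((f ^^ m) x) ((L ^^ m) w)"
  using est[OF anosov_unstable_funpow[OF A w], of m m] by (simp add: funpow_inv)

text \<open>A high iterate would be a strict contraction of a complete metric space and have a fixed
  point, whereas \<open>l\<close> changes by \<open>l b\<close> at every step.\<close>

lemma translation_no_contraction:
  assumes g: "complete_riemannian_metric g"
    and l: "linear l" "\<And>x. l (L x) = l x" "l b \<noteq> (0::real)"
    and "C \<ge> 1" "0 < \<theta>" "\<theta> < 1"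
    and est: "\<And>m x w. rnorm g ((f ^^ m) x) ((L ^^ m) w) \<le> C * \<theta> ^ m * rnorm g x w"
  shows False
proof -
  obtain n where n: "\<theta> ^ n < 1 / (2 * C)"
    using real_arch_pow_inv[of "1 / (2 * C)" \<theta>] \<open>C \<ge> 1\<close> \<open>\<theta> < 1\<close> by auto
  \<comment> \<open>The exponent \<open>Suc n\<close> ensures that \<open>f\<close> is applied at
    least once: a fixed point of the zeroth iterate would contradict nothing.\<close>
  have "\<theta> ^ Suc n \<le> \<theta> ^ n" using \<open>0 < \<theta>\<close> \<open>\<theta> < 1\<close> by (simp add: mult_le_one mult_left_le_one_le)
  then have "C * \<theta> ^ Suc n \<le> C * \<theta> ^ n" using \<open>C \<ge> 1\<close> by (intro mult_left_mono) auto
  also have "\<dots> \<le> 1/2" using n \<open>C \<ge> 1\<close> by (simp add: field_simps)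
  finally have small: "C * \<theta> ^ Suc n \<le> 1/2" .
  have r: "riemannian_metric g" using g by (simp add: complete_riemannian_metric_def)
  have "rnorm g ((f ^^ Suc n) x) ((L ^^ Suc n) w) \<le> 1/2 * rnorm g x w" for x w
    using est[of "Suc n" x w] mult_right_mono[OF small rnorm_nonneg[OF r, of x w]] by linarith
  then obtain p where p: "(f ^^ Suc n) p = p"
    using affine_contraction_fixed_point[OF g linear_funpow[OF linear_L] affine_funpow[OF linear_L f], of "Suc n" "1/2"]
    by auto
  have "l ((f ^^ m) p) = l p + real m * l b" for m
    by (induction m) (simp_all add: f linear_add[OF l(1)] l(2) algebra_simps)
  from this[of "Suc n"] show False using p l(3) by simp
qed

text \<open>A stable bundle of full dimension would make \<open>f\<close> eventually contracting, an
  unstable one would do so for \<open>inv f\<close>, whose translation part also has nonzero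
  level.\<close>

lemma anosov_index_bounds:
  assumes g: "complete_riemannian_metric g" and A: "anosov_splitting f g Es Eu"
    and l: "linear l" "\<And>x. l (L x) = l x" "l b \<noteq> (0::real)"
  shows "dim (Es x) \<in> {1..DIM('a) - 1}"
proof -
  obtain C \<theta> where C: "C \<ge> 1" "0 < \<theta>" "\<theta> < 1"
    "\<And>m x w. w \<in> Es x \<Longrightarrow> rnorm g ((f ^^ m) x) ((L ^^ m) w) \<le> C * \<theta> ^ m * rnorm g x w"
    "\<And>m x w. w \<in> Eu x \<Longrightarrow> rnorm g ((inv f ^^ m) x) ((inv L ^^ m) w) \<le> C * \<theta> ^ m * rnorm g x w"
    using anosov_estimates[OF A] by metis
  have split: "continuous_splitting Es Eu" using A by (simp add: anosov_splitting_def)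
  have sub: "continuous_subbundle Es" "continuous_subbundle Eu"
    using split by (auto simp: continuous_splitting_def)
  have UNIV: "E y = UNIV" if "continuous_subbundle E" "dim (E x) = DIM('a)" for E :: "'a \<Rightarrow> 'a set" and y
    using continuous_subbundle_subspace[OF that(1), of y] continuous_subbundle_dim_constant[OF that(1), of x y] that(2)
    by (metis dim_eq_full span_eq_iff)
  have "dim (Es x) \<noteq> DIM('a)"
  proof
    assume "dim (Es x) = DIM('a)"
    then have "Es y = UNIV" for y using UNIV[OF sub(1)] by blast
    then show False
      using translation_no_contraction[OF g l C(1-3)] C(4) by blast
  qed
  moreover have "dim (Eu x) \<noteq> DIM('a)"
  proof
    assume "dim (Eu x) = DIM('a)"
    then have E: "Eu y = UNIV" for y using UNIV[OF sub(2)] by blast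
    interpret I: affine_diffeo "inv L" "- inv L b" "inv f" by (rule affine_diffeo_inv)
    have "l (inv L y) = l y" for y using l(2)[of "inv L y"] by (simp add: inv_L)
    moreover from this have "l (- inv L b) \<noteq> 0" using l(1,3) by (simp add: linear_neg)
    ultimately show False
      using I.translation_no_contraction[OF g l(1) _ _ C(1-3)] C(5) E by blast
  qed
  ultimately show ?thesis
    using continuous_splitting_dim[OF split, of x] by auto
qed

text \<open>The dimensions of \<open>Es x\<close> and \<open>Eu' x\<close> add up to more than that
  of the space, so they share a nonzero vector. Along its forward orbit the \<open>g\<close>-norm
  decays while the \<open>h\<close>-norm grows. The one-sided bound on the distances already gives
  the contradiction, so both orders of the two metrics in \<open>uniformly_equivalent\<close> are
  covered.\<close>

lemma anosov_not_uniformly_equivalent: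
  assumes g: "riemannian_metric g" and A: "anosov_splitting f g Es Eu"
    and h: "riemannian_metric h" and A': "anosov_splitting f h Es' Eu'"
    and less: "dim (Es' x) < dim (Es x)" and "L0 > 0"
    and le: "\<And>x y. rdist h x y \<le> L0 * rdist g x y"
  shows False
proof -
  obtain C \<theta> where C: "C \<ge> 1" "0 < \<theta>" "\<theta> < 1"
    "\<And>m x w. w \<in> Es x \<Longrightarrow> rnorm g ((f ^^ m) x) ((L ^^ m) w) \<le> C * \<theta> ^ m * rnorm g x w"
    using anosov_estimates[OF A] by metis
  obtain C' \<theta>' where C': "C' \<ge> 1" "0 < \<theta>'" "\<theta>' < 1"
    "\<And>m x w. w \<in> Eu' x \<Longrightarrow> rnorm h ((inv f ^^ m) x) ((inv L ^^ m) w) \<le> C' * \<theta>' ^ m * rnorm h x w"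
    using anosov_estimates[OF A'] by metis
  have split: "continuous_splitting Es Eu" "continuous_splitting Es' Eu'"
    using A A' by (auto simp: anosov_splitting_def)
  have s: "subspace (Es x)" "subspace (Eu' x)"
    using split continuous_subbundle_subspace by (auto simp: continuous_splitting_def)
  have "dim {a + b |a b. a \<in> Es x \<and> b \<in> Eu' x} \<le> DIM('a)"
    by (rule dim_subset_UNIV)
  then have "dim (Es x \<inter> Eu' x) > 0"
    using dim_sums_Int[OF s] continuous_splitting_dim[OF split(2), of x] less by linarith
  then have "\<not> Es x \<inter> Eu' x \<subseteq> {0}"
    by (metis dim_eq_0 less_irrefl)
  then obtain w where w: "w \<in> Es x" "w \<in> Eu' x" "w \<noteq> 0" by blast
  define K where "K = C' * (80 * L0) * C * rnorm g x w"
  have bound: "rnorm h x w \<le> K * (\<theta>' * \<theta>) ^ m" for m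
  proof -
    have "rnorm h x w \<le> C' * \<theta>' ^ m * rnorm h ((f ^^ m) x) ((L ^^ m) w)"
      by (rule anosov_unstable_lower[OF A' C'(4) w(2)])
    also have "\<dots> \<le> C' * \<theta>' ^ m * (80 * L0 * rnorm g ((f ^^ m) x) ((L ^^ m) w))"
      using C' by (intro mult_left_mono rnorm_le_if_rdist_le[OF h g \<open>L0 > 0\<close> le]) auto
    also have "\<dots> \<le> C' * \<theta>' ^ m * (80 * L0 * (C * \<theta> ^ m * rnorm g x w))"
      using C' C \<open>L0 > 0\<close> w by (intro mult_left_mono) auto
    finally show ?thesis by (simp add: K_def power_mult_distrib algebra_simps)
  qed
  have "\<theta>' * \<theta> < 1 * 1" using C C' by (intro mult_strict_mono) auto
  then have "(\<lambda>m. K * (\<theta>' * \<theta>) ^ m) \<longlonglongrightarrow> K * 0"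
    using C C' by (intro tendsto_intros LIMSEQ_power_zero) auto
  then have "rnorm h x w \<le> K * 0"
    using bound by (intro LIMSEQ_le_const) auto
  then show False using rnorm_pos[OF h w(3), of x] by simp
qed

end

section \<open>Hyperbolic linear maps\<close>

definition poly_act :: "(complex^'n \<Rightarrow> complex^'n) \<Rightarrow> complex poly \<Rightarrow> complex^'n \<Rightarrow> complex^'n" where
  "poly_act T p w = (\<Sum>i\<le>degree p. coeff p i *s (T ^^ i) w)"

locale clinear_map =
  fixes T :: "complex^'n \<Rightarrow> complex^'n"
  assumes add: "T (u + w) = T u + T w" and scale: "T (c *s w) = c *s T w"
begin

lemma zero: "T 0 = 0"
  using scale[of 0 0] by simp

lemma diff: "T (u - w) = T u - T w"
  using add[of "u - w" w] by simp

lemma funpow_plus: "(T ^^ i) (u + w) = (T ^^ i) u + (T ^^ i) w"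
  by (induction i) (simp_all add: add)

lemma funpow_scale: "(T ^^ i) (c *s w) = c *s (T ^^ i) w"
  by (induction i) (simp_all add: scale)

lemma poly_act_altdef:
  assumes "degree p \<le> N"
  shows "poly_act T p w = (\<Sum>i\<le>N. coeff p i *s (T ^^ i) w)"
  unfolding poly_act_def
  by (rule sum.mono_neutral_left) (use assms in \<open>auto simp: coeff_eq_0\<close>)

text \<open>Here \<open>poly_act T p w\<close> is p(T) w. Applying the linear factor first is what
  lets roots be peeled off one by one.\<close>

lemma poly_act_linear_factor:
  "poly_act T ([:-\<mu>, 1:] * q) w = poly_act T q (T w - \<mu> *s w)"
proof -
  define N where "N = degree q"
  have "degree ([:-\<mu>, 1:] * q) \<le> Suc N"
    using degree_mult_le[of "[:-\<mu>, 1:]" q] by (simp add: N_def)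
  then have "poly_act T ([:-\<mu>, 1:] * q) w = (\<Sum>i\<le>Suc N. coeff ([:-\<mu>, 1:] * q) i *s (T ^^ i) w)"
    by (rule poly_act_altdef)
  also have "\<dots> = (\<Sum>i\<le>Suc N. coeff (pCons 0 q) i *s (T ^^ i) w) - (\<Sum>i\<le>Suc N. \<mu> *s (coeff q i *s (T ^^ i) w))"
    unfolding sum_subtractf[symmetric]
    by (intro sum.cong refl) (simp add: vector_sub_rdistrib vector_smult_assoc algebra_simps vec.scale_left_diff_distrib)
  also have "(\<Sum>i\<le>Suc N. coeff (pCons 0 q) i *s (T ^^ i) w) = (\<Sum>i\<le>N. coeff q i *s (T ^^ i) (T w))"
    by (simp add: sum.atMost_Suc_shift funpow_swap1 del: sum.atMost_Suc)
  also have "(\<Sum>i\<le>Suc N. \<mu> *s (coeff q i *s (T ^^ i) w)) = (\<Sum>i\<le>N. \<mu> *s (coeff q i *s (T ^^ i) w))"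
    by (simp add: N_def coeff_eq_0)
  also have "(\<Sum>i\<le>N. coeff q i *s (T ^^ i) (T w)) - \<dots> = (\<Sum>i\<le>N. coeff q i *s (T ^^ i) (T w - \<mu> *s w))"
    unfolding sum_subtractf[symmetric]
  proof (intro sum.cong refl)
    fix i
    have "(T ^^ i) (T w - \<mu> *s w) = (T ^^ i) (T w) - \<mu> *s (T ^^ i) w"
      using funpow_plus[of i "T w - \<mu> *s w" "\<mu> *s w"] by (simp add: funpow_scale algebra_simps)
    then show "coeff q i *s (T ^^ i) (T w) - \<mu> *s (coeff q i *s (T ^^ i) w) = coeff q i *s (T ^^ i) (T w - \<mu> *s w)"
      by (simp add: vec.scale_right_diff_distrib mult.commute)
  qed
  finally show ?thesis by (simp add: poly_act_def N_def)
qed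

text \<open>The vectors \<open>(T ^^ i) w\<close> for \<open>i \<le> d\<close> are one more than the
  real dimension, so a dependence exists; its real coefficients are good enough.\<close>

lemma annihilating_polynomial: "\<exists>p. p \<noteq> 0 \<and> poly_act T p w = 0"
proof -
  define d where "d = DIM(complex^'n)"
  have "\<exists>a. (\<exists>i\<le>d. a i \<noteq> 0) \<and> (\<Sum>i\<le>d. a i *s (T ^^ i) w) = 0"
  proof (cases "inj_on (\<lambda>i. (T ^^ i) w) {..d}")
    case True
    let ?S = "(\<lambda>i. (T ^^ i) w) ` {..d}"
    have "card ?S = Suc d" using card_image[OF True] by simp
    then have "dependent ?S"
      using dependent_biggerset[of ?S] by (simp add: d_def)
    then obtain u where u: "\<exists>v\<in>?S. u v \<noteq> 0" "(\<Sum>v\<in>?S. u v *\<^sub>R v) = 0"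
      using dependent_finite[of ?S] by auto
    have sc: "r *\<^sub>R z = complex_of_real r *s z" for r and z :: "complex^'n"
      by (simp add: vec_eq_iff) (simp add: scaleR_conv_of_real)
    have "(\<Sum>i\<le>d. complex_of_real (u ((T ^^ i) w)) *s (T ^^ i) w) = 0"
      using u(2) unfolding sum.reindex[OF True] o_def sc .
    moreover have "\<exists>i\<le>d. complex_of_real (u ((T ^^ i) w)) \<noteq> 0" using u(1) by auto
    ultimately show ?thesis
      by (intro exI[of _ "\<lambda>i. complex_of_real (u ((T ^^ i) w))"] conjI)
  next
    \<comment> \<open>Dependence is a property of sets and does not see repetitions. If two iterates
      coincide, X^i - X^j annihilates \<open>w\<close>.\<close>
    case False
    then obtain i j where ij: "i \<le> d" "j \<le> d" "i \<noteq> j" "(T ^^ i) w = (T ^^ j) w"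
      unfolding inj_on_def by auto
    define a where "a k = (if k = i then 1 else if k = j then -1 else (0::complex))" for k
    have "(\<Sum>k\<le>d. a k *s (T ^^ k) w) = (\<Sum>k\<in>{i, j}. a k *s (T ^^ k) w)"
      by (rule sum.mono_neutral_right) (use ij in \<open>auto simp: a_def\<close>)
    also have "\<dots> = 0" using ij by (simp add: a_def)
    finally show ?thesis using ij by (intro exI[of _ a]) (auto simp: a_def)
  qed
  then obtain a i where a: "i \<le> d" "a i \<noteq> 0" "(\<Sum>i\<le>d. a i *s (T ^^ i) w) = 0" by blast
  define p where "p = (\<Sum>i\<le>d. monom (a i) i)"
  have cf: "coeff p k = (if k \<le> d then a k else 0)" for k
    by (simp add: p_def coeff_sum if_distrib[of coeff] cong: if_cong)
  have "degree p \<le> d" by (rule degree_le) (simp add: cf)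
  then have "poly_act T p w = 0"
    using a(3) by (simp add: poly_act_altdef cf)
  moreover have "p \<noteq> 0" using cf[of i] a by auto
  ultimately show ?thesis by blast
qed

definition gen :: "complex \<Rightarrow> (complex^'n) set" where
  "gen \<mu> = {w. \<exists>k. ((\<lambda>u. T u - \<mu> *s u) ^^ k) w = 0}"

lemma gen_step: "T w - \<mu> *s w \<in> gen \<mu> \<Longrightarrow> w \<in> gen \<mu>"
proof -
  assume "T w - \<mu> *s w \<in> gen \<mu>"
  then obtain k where "((\<lambda>u. T u - \<mu> *s u) ^^ k) (T w - \<mu> *s w) = 0"
    unfolding gen_def by blast
  then have "((\<lambda>u. T u - \<mu> *s u) ^^ Suc k) w = 0"
    unfolding funpow_Suc_right by simp
  then show ?thesis unfolding gen_def by blast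
qed

lemma gen_scale: "w \<in> gen \<mu> \<Longrightarrow> c *s w \<in> gen \<mu>"
proof -
  have "((\<lambda>u. T u - \<mu> *s u) ^^ k) (c *s w) = c *s ((\<lambda>u. T u - \<mu> *s u) ^^ k) w" for k
    by (induction k) (simp_all add: scale vec.scale_right_diff_distrib mult.commute)
  then show "w \<in> gen \<mu> \<Longrightarrow> c *s w \<in> gen \<mu>"
    unfolding gen_def by (auto intro: exI)
qed

lemma gen_add: "u \<in> gen \<mu> \<Longrightarrow> w \<in> gen \<mu> \<Longrightarrow> u + w \<in> gen \<mu>"
proof -
  let ?N = "\<lambda>u. T u - \<mu> *s u"
  assume "u \<in> gen \<mu>" "w \<in> gen \<mu>"
  then obtain k l where kl: "(?N ^^ k) u = 0" "(?N ^^ l) w = 0" unfolding gen_def by blast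
  have add': "(?N ^^ k) (u + w) = (?N ^^ k) u + (?N ^^ k) w" for k u w
    by (induction k) (simp_all add: add vec.scale_right_distrib)
  have z: "(?N ^^ j) 0 = 0" for j by (induction j) (simp_all add: zero)
  have "(?N ^^ (l + k)) u = 0" "(?N ^^ (k + l)) w = 0"
    unfolding Nat.funpow_add by (simp_all add: kl z)
  then have "(?N ^^ (k + l)) (u + w) = 0" by (simp add: add' add.commute[of k l])
  then show ?thesis unfolding gen_def by blast
qed


text \<open>On \<open>gen \<nu>\<close> the map T - \<mu> is a nilpotent map plus the nonzero scalar
  \<nu> - \<mu>, hence invertible. The induction on nilpotency solves for
  \<open>t = T u - \<nu> *s u\<close> first and corrects \<open>u\<close> by that solution.\<close>

lemma gen_solve:
  assumes W: "\<And>u w. u \<in> W \<Longrightarrow> w \<in> W \<Longrightarrow> u - w \<in> W" "\<And>c w. w \<in> W \<Longrightarrow> c *s w \<in> W"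
    "\<And>w. w \<in> W \<Longrightarrow> T w \<in> W"
    and "\<nu> \<noteq> \<mu>" "u \<in> W" "((\<lambda>u. T u - \<nu> *s u) ^^ k) u = 0"
  shows "\<exists>u'\<in>gen \<nu> \<inter> W. T u' - \<mu> *s u' = u"
  using assms(5,6)
proof (induction k arbitrary: u)
  case 0
  then have "u = 0" by simp
  moreover have "0 \<in> gen \<nu>" unfolding gen_def by (auto intro: exI[of _ 0])
  ultimately show ?case using 0 by (intro bexI[of _ 0]) (auto simp: zero)
next
  case (Suc k)
  define t where "t = T u - \<nu> *s u"
  have "t \<in> W" "((\<lambda>u. T u - \<nu> *s u) ^^ k) t = 0"
    using Suc.prems W unfolding t_def funpow_Suc_right by auto
  then obtain t' where t': "t' \<in> gen \<nu>" "t' \<in> W" "T t' - \<mu> *s t' = t"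
    using Suc.IH by blast
  define u' where "u' = (1 / (\<nu> - \<mu>)) *s (u - t')"
  have "u \<in> gen \<nu>" using Suc.prems unfolding gen_def by blast
  moreover have "(-1) *s t' \<in> gen \<nu>" by (rule gen_scale[OF t'(1)])
  ultimately have "u + (-1) *s t' \<in> gen \<nu>" by (rule gen_add)
  then have "u' \<in> gen \<nu>" unfolding u'_def by (intro gen_scale) simp
  moreover have "u' \<in> W" using Suc.prems t' W unfolding u'_def by blast
  moreover have "T u' - \<mu> *s u' = u"
  proof -
    have "T (u - t') - \<mu> *s (u - t') = (T u - \<mu> *s u) - (T t' - \<mu> *s t')"
      by (simp add: diff vec.scale_right_diff_distrib)
    also have "\<dots> = (\<nu> - \<mu>) *s u"
      by (simp add: t' t_def vec.scale_left_diff_distrib)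
    finally have e: "T (u - t') - \<mu> *s (u - t') = (\<nu> - \<mu>) *s u" .
    have "T u' - \<mu> *s u' = (1 / (\<nu> - \<mu>)) *s (T (u - t') - \<mu> *s (u - t'))"
      unfolding u'_def scale by (simp add: vec.scale_right_diff_distrib mult.commute)
    moreover have "1 / (\<nu> - \<mu>) * (\<nu> - \<mu>) = 1" using \<open>\<nu> \<noteq> \<mu>\<close> by simp
    ultimately show ?thesis unfolding e vector_smult_assoc by (simp only: vec.scale_one)
  qed
  ultimately show ?case by blast
qed

text \<open>Peeling off one linear factor of an annihilating polynomial at a time: on the component in
  \<open>gen \<nu>\<close> with \<open>\<nu> \<noteq> \<mu>\<close> the map \<open>T - \<mu>\<close> can be inverted, and a preimage of the component in
  \<open>gen \<mu>\<close> lies in \<open>gen \<mu>\<close> again.\<close>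

lemma invariant_subspace_gen_span:
  assumes W: "\<And>u w. u \<in> W \<Longrightarrow> w \<in> W \<Longrightarrow> u - w \<in> W" "\<And>c w. w \<in> W \<Longrightarrow> c *s w \<in> W"
    "\<And>w. w \<in> W \<Longrightarrow> T w \<in> W" and "w \<in> W"
  shows "w \<in> vec.span (\<Union>\<nu>. gen \<nu> \<inter> W)"
proof -
  let ?S = "vec.span (\<Union>\<nu>. gen \<nu> \<inter> W)"
  have W0: "0 \<in> W" using W(1)[OF \<open>w \<in> W\<close> \<open>w \<in> W\<close>] by simp
  have Wadd: "u + z \<in> W" if "u \<in> W" "z \<in> W" for u z
    using W(1)[OF that(1) W(1)[OF W0 that(2)]] by simp
  have SW: "u \<in> W" if "u \<in> ?S" for u
    using that by (induction rule: vec.span_induct_alt) (auto intro: W0 Wadd W(2))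
  \<comment> \<open>Modulo \<open>gen \<mu>\<close>, every vector of \<open>?S\<close> has a
    preimage in \<open>?S\<close> under T - \<mu>. Intersecting with \<open>W\<close> throughout
    ensures that later only eigenvalues of the restriction to \<open>W\<close> occur.\<close>
  have split: "\<exists>u'\<in>?S. \<exists>z\<in>gen \<mu> \<inter> W. (T u' - \<mu> *s u') + z = u" if "u \<in> ?S" for u \<mu>
    using that
  proof (induction rule: vec.span_induct_alt)
    case base
    have "0 \<in> gen \<mu>" unfolding gen_def by (auto intro: exI[of _ 0])
    then show ?case using W0 by (intro bexI[of _ 0]) (auto simp: zero vec.span_zero)
  next
    case (step c x y)
    then obtain \<nu> where x: "x \<in> gen \<nu>" "x \<in> W" by blast
    obtain y' z where y: "y' \<in> ?S" "z \<in> gen \<mu>" "z \<in> W" "(T y' - \<mu> *s y') + z = y"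
      using step by blast
    show ?case
    proof (cases "\<nu> = \<mu>")
      case True
      have "c *s x + z \<in> gen \<mu> \<inter> W"
        using x y True by (auto intro: gen_add gen_scale Wadd W(2))
      moreover have "(T y' - \<mu> *s y') + (c *s x + z) = c *s x + y"
        by (simp add: y(4)[symmetric])
      ultimately show ?thesis using y(1) by blast
    next
      case False
      obtain k where "((\<lambda>u. T u - \<nu> *s u) ^^ k) x = 0" using x unfolding gen_def by blast
      from gen_solve[OF W False x(2) this] obtain x'
        where x': "x' \<in> gen \<nu> \<inter> W" "T x' - \<mu> *s x' = x" by blast
      have "x' \<in> ?S" using x' by (intro vec.span_base) blast
      then have "c *s x' + y' \<in> ?S" using y(1) by (intro vec.span_add vec.span_scale)
      moreover have "(T (c *s x' + y') - \<mu> *s (c *s x' + y')) + z = c *s (T x' - \<mu> *s x') + ((T y' - \<mu> *s y') + z)"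
        by (simp add: add scale vec.scale_right_distrib vec.scale_right_diff_distrib mult.commute)
      ultimately show ?thesis using y x' by (metis IntI)
    qed
  qed
  have main: "u \<in> ?S" if "p \<noteq> 0" "poly_act T p u = 0" "u \<in> W" "degree p = n" for p u n
    using that
  proof (induction n arbitrary: p u)
    case 0
    have "coeff p 0 \<noteq> 0" using leading_coeff_0_iff[of p] 0 by simp
    moreover have "coeff p 0 *s u = 0" using 0 by (simp add: poly_act_def)
    ultimately have "u = 0" by simp
    then show ?case by (simp add: vec.span_zero)
  next
    case (Suc n)
    have "\<not> constant (poly p)" using Suc.prems by (simp add: constant_degree)
    then obtain \<mu> where "poly p \<mu> = 0" using fundamental_theorem_of_algebra by blast
    then obtain q where q: "p = [:-\<mu>, 1:] * q" by (auto simp: poly_eq_0_iff_dvd dvd_def)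
    have "q \<noteq> 0" using q Suc.prems by auto
    have dq: "degree q = n" using Suc.prems(4) \<open>q \<noteq> 0\<close> degree_mult_eq[of "[:-\<mu>, 1:]" q]
      unfolding q by simp
    have "T u - \<mu> *s u \<in> W" using Suc.prems W by blast
    then have "T u - \<mu> *s u \<in> ?S"
      using Suc.IH[OF \<open>q \<noteq> 0\<close> _ _ dq] Suc.prems(2) unfolding q poly_act_linear_factor by blast
    from split[OF this, of \<mu>] obtain u' z
      where u': "u' \<in> ?S" "z \<in> gen \<mu>" "z \<in> W" "(T u' - \<mu> *s u') + z = T u - \<mu> *s u" by blast
    have "T (u - u') - \<mu> *s (u - u') = z"
      using u'(4) by (simp add: diff vec.scale_right_diff_distrib algebra_simps)
    then have "u - u' \<in> gen \<mu>" using u'(2) gen_step by metis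
    moreover have "u - u' \<in> W" using W(1)[OF Suc.prems(3) SW[OF u'(1)]] .
    ultimately have "u - u' \<in> ?S" by (intro vec.span_base) blast
    from vec.span_add[OF this u'(1)] show ?case by simp
  qed
  then show ?thesis using annihilating_polynomial[of w] \<open>w \<in> W\<close> by blast
qed

text \<open>The last nonzero vector in the chain of images of \<open>w\<close> under T - \<mu> is an
  eigenvector, and the chain stays in \<open>W\<close>.\<close>

lemma gen_eigenvector:
  assumes W: "\<And>u w. u \<in> W \<Longrightarrow> w \<in> W \<Longrightarrow> u - w \<in> W" "\<And>c w. w \<in> W \<Longrightarrow> c *s w \<in> W"
    "\<And>w. w \<in> W \<Longrightarrow> T w \<in> W" and "w \<in> W" "w \<in> gen \<mu>" "w \<noteq> 0"
  shows "\<exists>u\<in>W. u \<noteq> 0 \<and> T u = \<mu> *s u"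
proof -
  obtain k where "((\<lambda>u. T u - \<mu> *s u) ^^ k) w = 0" using assms(5) unfolding gen_def by blast
  then show ?thesis
    using assms(4,6)
  proof (induction k arbitrary: w)
    case (Suc k)
    show ?case
    proof (cases "T w - \<mu> *s w = 0")
      case True
      then show ?thesis using Suc.prems by auto
    next
      case False
      then show ?thesis
        using Suc.IH[of "T w - \<mu> *s w"] Suc.prems W unfolding funpow_Suc_right by auto
    qed
  qed simp
qed

text \<open>Induction on nilpotency: the norms \<open>a m\<close> satisfy
  \<open>a (Suc m) \<le> cmod \<mu> * a m + e m\<close>, where \<open>e\<close> belongs to a vector
  with a shorter chain and tends to 0.\<close>

lemma gen_tendsto_0:
  assumes "cmod \<mu> < 1" "w \<in> gen \<mu>"
  shows "(\<lambda>m. (T ^^ m) w) \<longlonglongrightarrow> 0"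
proof -
  obtain k where "((\<lambda>u. T u - \<mu> *s u) ^^ k) w = 0" using assms(2) unfolding gen_def by blast
  then show ?thesis
  proof (induction k arbitrary: w)
    case 0
    have "(T ^^ m) 0 = 0" for m by (induction m) (simp_all add: zero)
    then show ?case using 0 by simp
  next
    case (Suc k)
    define u where "u = T w - \<mu> *s w"
    define a where "a m = norm ((T ^^ m) w)" for m
    define e where "e m = norm ((T ^^ m) u)" for m
    have "e \<longlonglongrightarrow> 0"
      using Suc.IH[of u] Suc.prems tendsto_norm_zero unfolding e_def u_def funpow_Suc_right by auto
    have sc: "norm (\<mu> *s z) = cmod \<mu> * norm z" for z :: "complex^'n"
      by (simp add: norm_vec_def norm_mult L2_set_right_distrib)
    have rec: "a (Suc m) \<le> cmod \<mu> * a m + e m" for m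
    proof -
      have "T w = \<mu> *s w + u" by (simp add: u_def)
      then have "(T ^^ Suc m) w = \<mu> *s (T ^^ m) w + (T ^^ m) u"
        by (simp add: funpow_swap1 funpow_plus funpow_scale)
      then show ?thesis
        unfolding a_def e_def by (metis norm_triangle_ineq sc)
    qed
    have "a \<longlonglongrightarrow> 0"
    proof (rule LIMSEQ_I)
      fix r :: real assume "r > 0"
      define q where "q = cmod \<mu>"
      have q: "0 \<le> q" "q < 1" using assms by (auto simp: q_def)
      \<comment> \<open>With this \<open>d\<close>, the value \<open>r / 2\<close> is the fixed
        point of the recursion s to q s + d.\<close>
      define d where "d = r * (1 - q) / 2"
      have "d > 0" using q \<open>r > 0\<close> by (simp add: d_def)
      then obtain M where M: "\<And>m. m \<ge> M \<Longrightarrow> e m < d"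
        using LIMSEQ_D[OF \<open>e \<longlonglongrightarrow> 0\<close>, of d] by (auto simp: e_def)
      have bd: "a (M + j) \<le> q ^ j * a M + r / 2" for j
      proof (induction j)
        case 0
        then show ?case using \<open>r > 0\<close> by simp
      next
        case (Suc j)
        have "a (M + Suc j) \<le> q * a (M + j) + e (M + j)" using rec[of "M + j"] by (simp add: q_def)
        also have "\<dots> \<le> q * (q ^ j * a M + r / 2) + d"
          using mult_left_mono[OF Suc q(1)] M[of "M + j"] by simp
        also have "\<dots> = q ^ Suc j * a M + r / 2" by (simp add: d_def algebra_simps field_simps)
        finally show ?case .
      qed
      have "(\<lambda>j. q ^ j * a M) \<longlonglongrightarrow> 0 * a M"
        using q by (intro tendsto_mult LIMSEQ_power_zero tendsto_const) auto
      then have "eventually (\<lambda>j. q ^ j * a M < r / 2) sequentially"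
        by (rule order_tendstoD(2)) (use \<open>r > 0\<close> in simp)
      then obtain J where J: "\<And>j. j \<ge> J \<Longrightarrow> q ^ j * a M < r / 2"
        unfolding eventually_sequentially by blast
      have "norm (a m - 0) < r" if "m \<ge> M + J" for m
      proof -
        have "m - M \<ge> J" "M + (m - M) = m" using that by auto
        then have "a m < r" using bd[of "m - M"] J[of "m - M"] by simp
        then show ?thesis by (simp add: a_def)
      qed
      then show "\<exists>no. \<forall>n\<ge>no. norm (a n - 0) < r" by blast
    qed
    then show ?case unfolding a_def by (rule tendsto_norm_zero_cancel)
  qed
qed

lemma gen_span_tendsto_0:
  assumes "w \<in> vec.span (\<Union>\<mu>\<in>{\<mu>. P \<mu> \<and> cmod \<mu> < 1}. gen \<mu>)"
  shows "(\<lambda>m. (T ^^ m) w) \<longlonglongrightarrow> 0"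
  using assms
proof (induction rule: vec.span_induct_alt)
  case base
  have "(T ^^ m) 0 = 0" for m by (induction m) (simp_all add: zero)
  then show ?case by simp
next
  case (step c x y)
  then have "(\<lambda>m. (T ^^ m) x) \<longlonglongrightarrow> 0" using gen_tendsto_0 by blast
  then have "(\<lambda>m. norm c * norm ((T ^^ m) x)) \<longlonglongrightarrow> norm c * 0"
    by (intro tendsto_mult tendsto_const tendsto_norm_zero)
  moreover have "norm (c *s z) = cmod c * norm z" for z :: "complex^'n"
    by (simp add: norm_vec_def norm_mult L2_set_right_distrib)
  ultimately have "(\<lambda>m. c *s (T ^^ m) x) \<longlonglongrightarrow> 0"
    by (intro tendsto_norm_zero_cancel[of "\<lambda>m. c *s (T ^^ m) x"]) simp
  from tendsto_add[OF this step(2)] show ?case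
    by (simp add: funpow_plus funpow_scale)
qed

end


section \<open>Real matrices and their complexification\<close>

lemma clinear_map_matrix: "clinear_map ((*v) (M :: complex^'n^'n))"
  by unfold_locales (simp_all add: matrix_vector_right_distrib vector_scalar_commute)

lemma mat_mult_vector: "mat c *v (w :: 'a::comm_ring_1^'n) = c *s w"
  by (simp add: matrix_vector_mult_def mat_def vec_eq_iff if_distrib[of "\<lambda>x. x * _"] cong: if_cong)

definition of_real_vec :: "real^'n \<Rightarrow> complex^'n" where
  "of_real_vec x = (\<chi> i. complex_of_real (x $ i))"

definition Re_vec :: "complex^'n \<Rightarrow> real^'n" where "Re_vec w = (\<chi> i. Re (w $ i))"
definition Im_vec :: "complex^'n \<Rightarrow> real^'n" where "Im_vec w = (\<chi> i. Im (w $ i))"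

abbreviation cmat :: "real^'n^'n \<Rightarrow> complex^'n^'n" where
  "cmat A \<equiv> map_matrix complex_of_real A"

lemma cmat_of_real_vec: "cmat A *v of_real_vec x = of_real_vec (A *v x)"
  by (simp add: of_real_vec_def matrix_vector_mult_def map_matrix_def vec_eq_iff)

lemma cmat_of_real_vec_funpow: "((*v) (cmat A) ^^ m) (of_real_vec x) = of_real_vec (((*v) A ^^ m) x)"
  by (induction m) (simp_all add: cmat_of_real_vec)

lemma Re_Im_cmat: "Re_vec (cmat A *v w) = A *v Re_vec w" "Im_vec (cmat A *v w) = A *v Im_vec w"
  by (simp_all add: Re_vec_def Im_vec_def matrix_vector_mult_def map_matrix_def vec_eq_iff)

lemma Re_Im_cmat_funpow:
  "Re_vec (((*v) (cmat A) ^^ m) w) = ((*v) A ^^ m) (Re_vec w)"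
  "Im_vec (((*v) (cmat A) ^^ m) w) = ((*v) A ^^ m) (Im_vec w)"
  by (induction m) (simp_all add: Re_Im_cmat)

lemma gen_eigenspace_eq: "gen_eigenspace A \<mu> = clinear_map.gen ((*v) (cmat A)) \<mu>"
proof -
  have "(\<lambda>u. (cmat A - mat \<mu>) *v u) = (\<lambda>u. cmat A *v u - \<mu> *s u)"
    by (rule ext) (simp add: matrix_vector_mult_diff_rdistrib mat_mult_vector)
  then show ?thesis
    unfolding gen_eigenspace_def clinear_map.gen_def[OF clinear_map_matrix] by simp
qed

lemma stable_eigenspace_eq:
  "stable_eigenspace A = {x. of_real_vec x \<in> vec.span (\<Union>\<mu>\<in>{\<mu>. complex_eigenvalue A \<mu> \<and> cmod \<mu> < 1}.
     clinear_map.gen ((*v) (cmat A)) \<mu>)}"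
  unfolding stable_eigenspace_def gen_eigenspace_eq of_real_vec_def ..

lemma subspace_stable_eigenspace:
  fixes A :: "real^'n^'n"
  shows "subspace (stable_eigenspace A)"
proof -
  have "of_real_vec (0::real^'n) = 0" "of_real_vec (x + y) = of_real_vec x + of_real_vec y"
    "of_real_vec (r *\<^sub>R x) = complex_of_real r *s of_real_vec x" for x y :: "real^'n" and r
    by (simp_all add: of_real_vec_def vec_eq_iff)
  then show ?thesis
    unfolding stable_eigenspace_eq by (auto intro!: subspaceI vec.span_add vec.span_scale simp: vec.span_zero)
qed

lemma stable_eigenspace_tendsto_0:
  assumes "x \<in> stable_eigenspace A"
  shows "(\<lambda>m. ((*v) A ^^ m) x) \<longlonglongrightarrow> 0"
proof (rule vec_tendstoI)
  fix i
  have "(\<lambda>m. ((*v) (cmat A) ^^ m) (of_real_vec x)) \<longlonglongrightarrow> 0"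
    by (rule clinear_map.gen_span_tendsto_0[OF clinear_map_matrix])
       (use assms in \<open>simp only: stable_eigenspace_eq mem_Collect_eq\<close>)
  then have "(\<lambda>m. of_real_vec (((*v) A ^^ m) x)) \<longlonglongrightarrow> 0"
    by (simp only: cmat_of_real_vec_funpow)
  from tendsto_Re[OF tendsto_vec_nth[OF this, of i]]
  show "(\<lambda>m. ((*v) A ^^ m) x $ i) \<longlonglongrightarrow> 0 $ i"
    by (simp add: of_real_vec_def)
qed

text \<open>The complexification of \<open>E\<close> is spanned by its generalized eigenvectors.
  Each eigenvalue that occurs has an eigenvector there, which decays under iteration, so its modulus
  is below 1.\<close>

lemma contracting_subspace_stable_eigenspace:
  assumes E: "subspace E" "\<And>x. x \<in> E \<Longrightarrow> A *v x \<in> E"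
    and lim: "\<And>x. x \<in> E \<Longrightarrow> (\<lambda>m. ((*v) A ^^ m) x) \<longlonglongrightarrow> 0"
  shows "E \<subseteq> stable_eigenspace A"
proof
  fix x assume "x \<in> E"
  interpret M: clinear_map "(*v) (cmat A)" by (rule clinear_map_matrix)
  \<comment> \<open>The complexification E + iE.\<close>
  define W where "W = {w. Re_vec w \<in> E \<and> Im_vec w \<in> E}"
  have diff: "u - w \<in> W" if "u \<in> W" "w \<in> W" for u w
  proof -
    have "Re_vec (u - w) = Re_vec u - Re_vec w" "Im_vec (u - w) = Im_vec u - Im_vec w"
      by (simp_all add: Re_vec_def Im_vec_def vec_eq_iff)
    then show ?thesis using that subspace_diff[OF E(1)] by (simp add: W_def)
  qed
  have scale: "c *s w \<in> W" if "w \<in> W" for c w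
  proof -
    have "Re_vec (c *s w) = Re c *\<^sub>R Re_vec w - Im c *\<^sub>R Im_vec w"
      "Im_vec (c *s w) = Re c *\<^sub>R Im_vec w + Im c *\<^sub>R Re_vec w"
      by (simp_all add: Re_vec_def Im_vec_def vec_eq_iff)
    then show ?thesis
      using that subspace_diff[OF E(1)] subspace_add[OF E(1)] subspace_mul[OF E(1)] by (simp add: W_def)
  qed
  have inv: "cmat A *v w \<in> W" if "w \<in> W" for w
    using that E(2) by (simp add: W_def Re_Im_cmat)
  have stable: "cmod \<mu> < 1" if u: "u \<in> W" "u \<noteq> 0" "cmat A *v u = \<mu> *s u" for u \<mu>
  proof (rule ccontr)
    assume "\<not> cmod \<mu> < 1"
    \<comment> \<open>A nonzero coordinate is multiplied by \<mu> at every step, so it cannot tend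
      to 0 when the modulus is at least 1.\<close>
    obtain i where i: "u $ i \<noteq> 0" using u(2) by (auto simp: vec_eq_iff)
    have pow: "((*v) (cmat A) ^^ m) u = \<mu> ^ m *s u" for m
      by (induction m) (simp_all add: M.scale u(3) mult.commute)
    have comp: "complex_of_real (((*v) A ^^ m) (Re_vec u) $ i) + \<i> * complex_of_real (((*v) A ^^ m) (Im_vec u) $ i)
        = \<mu> ^ m * u $ i" for m
    proof -
      have "(\<mu> ^ m *s u) $ i = \<mu> ^ m * u $ i" by simp
      moreover have "w $ i = complex_of_real (Re_vec w $ i) + \<i> * complex_of_real (Im_vec w $ i)" for w
        by (simp add: Re_vec_def Im_vec_def complex_eq)
      ultimately show ?thesis by (metis pow Re_Im_cmat_funpow)
    qed
    have "(\<lambda>m. complex_of_real (((*v) A ^^ m) (Re_vec u) $ i) + \<i> * complex_of_real (((*v) A ^^ m) (Im_vec u) $ i))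
        \<longlonglongrightarrow> complex_of_real (0 $ i) + \<i> * complex_of_real (0 $ i)"
      by (intro tendsto_intros lim) (use u(1) in \<open>auto simp: W_def\<close>)
    then have "(\<lambda>m. cmod (\<mu> ^ m * u $ i)) \<longlonglongrightarrow> 0"
      unfolding comp using tendsto_norm_zero by fastforce
    moreover have "cmod (u $ i) \<le> cmod (\<mu> ^ m * u $ i)" for m
      using \<open>\<not> cmod \<mu> < 1\<close> by (simp add: norm_mult norm_power mult_le_cancel_right1 one_le_power)
    ultimately have "cmod (u $ i) \<le> 0" using LIMSEQ_le_const by blast
    then show False using i by simp
  qed
  have "of_real_vec x \<in> W"
    using \<open>x \<in> E\<close> subspace_0[OF E(1)]
    by (simp add: W_def Re_vec_def Im_vec_def of_real_vec_def zero_vec_def[symmetric])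
  then have "of_real_vec x \<in> vec.span (\<Union>\<nu>. M.gen \<nu> \<inter> W)"
    by (intro M.invariant_subspace_gen_span diff scale inv)
  also have "\<dots> \<subseteq> vec.span (\<Union>\<mu>\<in>{\<mu>. complex_eigenvalue A \<mu> \<and> cmod \<mu> < 1}. M.gen \<mu>)"
  proof (rule vec.span_minimal)
    show "(\<Union>\<nu>. M.gen \<nu> \<inter> W) \<subseteq> vec.span (\<Union>\<mu>\<in>{\<mu>. complex_eigenvalue A \<mu> \<and> cmod \<mu> < 1}. M.gen \<mu>)"
    proof
      fix w assume "w \<in> (\<Union>\<nu>. M.gen \<nu> \<inter> W)"
      then obtain \<nu> where w: "w \<in> M.gen \<nu>" "w \<in> W" by blast
      show "w \<in> vec.span (\<Union>\<mu>\<in>{\<mu>. complex_eigenvalue A \<mu> \<and> cmod \<mu> < 1}. M.gen \<mu>)"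
      proof (cases "w = 0")
        case True
        then show ?thesis by (simp add: vec.span_zero)
      next
        case False
        then obtain u where "u \<in> W" "u \<noteq> 0" "cmat A *v u = \<nu> *s u"
          using M.gen_eigenvector[OF diff scale inv w(2,1)] by blast
        then have "complex_eigenvalue A \<nu> \<and> cmod \<nu> < 1"
          using stable unfolding complex_eigenvalue_def by blast
        then show ?thesis using w(1) by (intro vec.span_base) blast
      qed
    qed
  qed (rule vec.subspace_span)
  finally show "x \<in> stable_eigenspace A" by (simp add: stable_eigenspace_eq)
qed

section \<open>The index in the hyperbolic case\<close>

lemma affine_diffeo_affine_map:
  fixes A :: "real^'n^'n"
  assumes "invertible A"
  shows "affine_diffeo ((*v) A) v (affine_map A v)"
proof
  show "bij ((*v) A)" using assms by (simp add: invertible_eq_bij)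
qed (simp_all add: affine_map_def matrix_vector_right_distrib matrix_vector_mult_scaleR)

text \<open>The eigenvalue 1 is excluded, so I - A is injective, hence surjective, and (I - A) p = v
  can be solved.\<close>

lemma hyperbolic_fixed_point:
  fixes A :: "real^'n^'n"
  assumes "hyperbolic A"
  obtains p where "affine_map A v p = p"
proof -
  have "x = 0" if "(mat 1 - A) *v x = 0" for x :: "real^'n"
  proof (rule ccontr)
    assume "x \<noteq> 0"
    have "A *v x = x" using that by (simp add: matrix_vector_mult_diff_rdistrib)
    then have "cmat A *v of_real_vec x = 1 *s of_real_vec x"
      by (simp add: cmat_of_real_vec)
    moreover have "of_real_vec x \<noteq> 0" using \<open>x \<noteq> 0\<close> by (simp add: of_real_vec_def vec_eq_iff)
    ultimately have "complex_eigenvalue A 1" unfolding complex_eigenvalue_def by blast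
    then show False using assms unfolding hyperbolic_def by auto
  qed
  then have "inj ((*v) (mat 1 - A))"
    by (metis inj_matrix_vector_mult matrix_left_invertible_ker invertible_left_inverse)
  then have "surj ((*v) (mat 1 - A))"
    using linear_injective_imp_surjective matrix_vector_mul_linear by blast
  then obtain p where "(mat 1 - A) *v p = v" by (metis surjD)
  then have "affine_map A v p = p"
    by (auto simp: affine_map_def matrix_vector_mult_diff_rdistrib)
  then show ?thesis by (rule that)
qed

text \<open>At a fixed point all norms live in one tangent space, where \<open>g\<close> is
  comparable to the euclidean norm. The inclusion
  \<open>Es p \<subseteq> stable_eigenspace A\<close> bounds the index from above; from below it
  suffices that \<open>Eu p\<close> meets \<open>stable_eigenspace A\<close> trivially, by counting
  dimensions.\<close>

lemma hyperbolic_anosov_index: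
  fixes A :: "real^'n^'n"
  assumes "invertible A" "hyperbolic A" and g: "riemannian_metric g"
    and A: "anosov_splitting (affine_map A v) g Es Eu"
  shows "dim (Es x) = dim (stable_eigenspace A)"
proof -
  interpret affine_diffeo "(*v) A" v "affine_map A v"
    by (rule affine_diffeo_affine_map[OF assms(1)])
  obtain p where p: "affine_map A v p = p" by (rule hyperbolic_fixed_point[OF assms(2)])
  have pm: "(affine_map A v ^^ m) p = p" for m by (induction m) (simp_all add: p)
  obtain C \<theta> where C: "C \<ge> 1" "0 < \<theta>" "\<theta> < 1"
    "\<And>m x w. w \<in> Es x \<Longrightarrow> rnorm g ((affine_map A v ^^ m) x) (((*v) A ^^ m) w) \<le> C * \<theta> ^ m * rnorm g x w"
    "\<And>m x w. w \<in> Eu x \<Longrightarrow> rnorm g ((inv (affine_map A v) ^^ m) x) ((inv ((*v) A) ^^ m) w) \<le> C * \<theta> ^ m * rnorm g x w"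
    using anosov_estimates[OF A] by metis
  have split: "continuous_splitting Es Eu" using A by (simp add: anosov_splitting_def)
  have sub: "subspace (Es p)" "subspace (Eu p)"
    using split continuous_subbundle_subspace by (auto simp: continuous_splitting_def)
  obtain c K where c: "c > 0" "K > 0" "\<And>y w. y \<in> {p} \<Longrightarrow> c * norm w \<le> rnorm g y w \<and> rnorm g y w \<le> K * norm w"
    by (rule rnorm_compact_bounds[OF g, of "{p}"]) auto
  have pow: "(\<lambda>m. C * \<theta> ^ m * r) \<longlonglongrightarrow> C * 0 * r" for r
    using C by (intro tendsto_intros LIMSEQ_power_zero) auto
  have "Es p \<subseteq> stable_eigenspace A"
  proof (rule contracting_subspace_stable_eigenspace[OF sub(1)])
    show "A *v x \<in> Es p" if "x \<in> Es p" for x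
      using anosov_invariant(1)[OF A, of p] that unfolding p by blast
    show "(\<lambda>m. ((*v) A ^^ m) w) \<longlonglongrightarrow> 0" if w: "w \<in> Es p" for w
    proof (rule Lim_null_comparison)
      have "norm (((*v) A ^^ m) w) \<le> (C * \<theta> ^ m * rnorm g p w) / c" for m
      proof -
        have "c * norm (((*v) A ^^ m) w) \<le> C * \<theta> ^ m * rnorm g p w"
          using c(3)[of p "((*v) A ^^ m) w"] C(4)[OF w, of m] unfolding pm by simp
        then show ?thesis using c(1) by (simp add: field_simps)
      qed
      then show "eventually (\<lambda>m. norm (((*v) A ^^ m) w) \<le> (C * \<theta> ^ m * rnorm g p w) / c) sequentially"
        by simp
      show "(\<lambda>m. (C * \<theta> ^ m * rnorm g p w) / c) \<longlonglongrightarrow> 0"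
        using tendsto_divide[OF pow[of "rnorm g p w"] tendsto_const[of c]] c(1) by simp
    qed
  qed
  then have "dim (Es p) \<le> dim (stable_eigenspace A)" by (rule dim_subset)
  moreover have "stable_eigenspace A \<inter> Eu p \<subseteq> {0}"
  proof
    fix w assume "w \<in> stable_eigenspace A \<inter> Eu p"
    then have w: "w \<in> stable_eigenspace A" "w \<in> Eu p" by auto
    have "rnorm g p w \<le> C * \<theta> ^ m * (K * norm (((*v) A ^^ m) w))" for m
    proof -
      have "rnorm g p w \<le> C * \<theta> ^ m * rnorm g p (((*v) A ^^ m) w)"
        using anosov_unstable_lower[OF A C(5) w(2), of m] unfolding pm .
      also have "\<dots> \<le> C * \<theta> ^ m * (K * norm (((*v) A ^^ m) w))"
        using C c(3)[of p] by (intro mult_left_mono) auto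
      finally show ?thesis .
    qed
    moreover have "(\<lambda>m. \<theta> ^ m) \<longlonglongrightarrow> 0"
      using C by (intro LIMSEQ_power_zero) simp
    then have "(\<lambda>m. C * \<theta> ^ m * (K * norm (((*v) A ^^ m) w))) \<longlonglongrightarrow> C * 0 * (K * norm (0::real^'n))"
      by (intro tendsto_mult tendsto_const tendsto_norm stable_eigenspace_tendsto_0 w)
    ultimately have "rnorm g p w \<le> C * 0 * (K * norm (0::real^'n))"
      using LIMSEQ_le_const by blast
    then show "w \<in> {0}" using rnorm_pos[OF g, of w p] by (cases "w = 0") auto
  qed
  then have "dim (stable_eigenspace A \<inter> Eu p) = 0" by simp
  then have "dim (stable_eigenspace A) + dim (Eu p) \<le> DIM(real^'n)"
    using dim_sums_Int[OF subspace_stable_eigenspace sub(2), of A]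
      dim_subset_UNIV[of "{x + y |x y. x \<in> stable_eigenspace A \<and> y \<in> Eu p}"] by linarith
  ultimately have "dim (Es p) = dim (stable_eigenspace A)"
    using continuous_splitting_dim[OF split, of p] by linarith
  moreover have "dim (Es x) = dim (Es p)"
    using split by (intro continuous_subbundle_dim_constant) (simp add: continuous_splitting_def)
  ultimately show ?thesis by simp
qed

section \<open>Complements and continuous families of projections\<close>

text \<open>Finitely many proper subspaces have measure zero and do not cover the space. A vector
  \<open>w\<close> outside all of them is added to each, the induction hypothesis gives a common
  complement \<open>E\<close> of the enlarged subspaces, and \<open>w\<close> is then moved over to
  \<open>E\<close>.\<close>

lemma common_complement:
  fixes F :: "'a::euclidean_space set set"
  assumes "finite F" "F \<noteq> {}" "\<And>V. V \<in> F \<Longrightarrow> subspace V \<and> dim V + k = DIM('a)"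
  obtains E where "subspace E" "dim E = k" "\<And>V. V \<in> F \<Longrightarrow> E \<inter> V = {0}"
proof -
  have "\<exists>E. subspace E \<and> dim E = k \<and> (\<forall>V\<in>F. E \<inter> V = {0})"
    using assms
  proof (induction k arbitrary: F)
    case 0
    then show ?case
      by (intro exI[of _ "{0}"]) (auto simp: subspace_0)
  next
    case (Suc k)
    have "dim V < DIM('a)" if "V \<in> F" for V
      using Suc.prems(3)[OF that] by linarith
    then have "negligible (\<Union>F)"
      using Suc.prems(1) by (intro negligible_Union negligible_lowdim)
    then have "\<Union>F \<noteq> UNIV" using non_negligible_UNIV by metis
    then obtain w where w: "w \<notin> \<Union>F" by blast
    let ?G = "(\<lambda>V. span (insert w V)) ` F"
    have "subspace W \<and> dim W + k = DIM('a)" if W: "W \<in> ?G" for W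
    proof -
      obtain V where V: "V \<in> F" "W = span (insert w V)" using W by blast
      have "span V = V" by (rule span_eq_iff[THEN iffD2]) (use Suc.prems(3) V in blast)
      then have "w \<notin> span V" using w V by blast
      then have "dim W = Suc (dim V)" using V by (simp add: dim_insert)
      then show ?thesis using Suc.prems(3)[OF V(1)] V by simp
    qed
    then have "\<exists>E. subspace E \<and> dim E = k \<and> (\<forall>W\<in>?G. E \<inter> W = {0})"
      using Suc.prems(1,2) by (intro Suc.IH) auto
    then obtain E where E: "subspace E" "dim E = k" "\<And>V. V \<in> F \<Longrightarrow> E \<inter> span (insert w V) = {0}"
      by blast
    \<comment> \<open>A member of \<open>F\<close> is what shows that \<open>w\<close> is nonzero
      and not in \<open>E\<close>.\<close>
    obtain V0 where "V0 \<in> F" using Suc.prems by blast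
    have "w \<noteq> 0" using w \<open>V0 \<in> F\<close> Suc.prems(3) subspace_0 by blast
    have "w \<in> span (insert w V0)" by (simp add: span_base)
    have sE: "span E = E" by (rule span_eq_iff[THEN iffD2, OF E(1)])
    have "w \<notin> span E"
      unfolding sE using E(3)[OF \<open>V0 \<in> F\<close>] \<open>w \<noteq> 0\<close> \<open>w \<in> span (insert w V0)\<close> by blast
    then have d: "dim (span (insert w E)) = Suc k" using E(2) by (simp add: dim_insert)
    have "span (insert w E) \<inter> V = {0}" if V: "V \<in> F" for V
    proof
      have sV: "subspace V" using Suc.prems V by blast
      show "span (insert w E) \<inter> V \<subseteq> {0}"
      proof
        fix x assume x: "x \<in> span (insert w E) \<inter> V"
        then obtain a where "x - a *\<^sub>R w \<in> span E" by (auto simp: span_insert)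
        then have "x - a *\<^sub>R w \<in> E" unfolding sE .
        moreover have "x - a *\<^sub>R w \<in> span (insert w V)"
          by (rule span_diff[OF span_base span_scale[OF span_base]]) (use x in blast)+
        ultimately have "x - a *\<^sub>R w \<in> {0}" using E(3)[OF V] by blast
        then have xa: "x = a *\<^sub>R w" by simp
        have "a = 0"
        proof (rule ccontr)
          assume "a \<noteq> 0"
          then have "w = (1 / a) *\<^sub>R x" using xa by simp
          then show False using x w V subspace_mul[OF sV] by blast
        qed
        then show "x \<in> {0}" using xa by simp
      qed
      show "{0} \<subseteq> span (insert w E) \<inter> V" using sV by (simp add: span_zero subspace_0)
    qed
    then show ?case using d by (intro exI[of _ "span (insert w E)"]) auto
  qed
  then show ?thesis using that by blast
qed

lemma complementary_decomposition:
  fixes E F :: "'a::euclidean_space set"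
  assumes "subspace E" "subspace F" "E \<inter> F = {0}" "dim E + dim F = DIM('a)"
  shows "\<exists>e\<in>E. w - e \<in> F"
proof -
  have "dim {x + y |x y. x \<in> E \<and> y \<in> F} = DIM('a)"
    using dim_sums_Int[OF assms(1,2)] assms(3,4) by simp
  then have "{x + y |x y. x \<in> E \<and> y \<in> F} = UNIV"
    using dim_eq_full[of "{x + y |x y. x \<in> E \<and> y \<in> F}"]
      span_eq_iff[THEN iffD2, OF subspace_sums[OF assms(1,2)]] by simp
  then obtain x y where "x \<in> E" "y \<in> F" "w = x + y" by blast
  then show ?thesis by (intro bexI[of _ x]) auto
qed

section \<open>Projections and the bundles formed by their ranges\<close>

definition projection_along :: "'a::euclidean_space set \<Rightarrow> 'a set \<Rightarrow> 'a \<Rightarrow> 'a" where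
  "projection_along E F w = (THE e. e \<in> E \<and> w - e \<in> F)"

locale complementary =
  fixes E F :: "'a::euclidean_space set"
  assumes E: "subspace E" and F: "subspace F" and trivial: "E \<inter> F = {0}"
    and dims: "dim E + dim F = DIM('a)"
begin

lemma projection_along_eqI:
  assumes "e \<in> E" "w - e \<in> F" shows "projection_along E F w = e"
  unfolding projection_along_def
proof (rule the_equality)
  fix e' assume e': "e' \<in> E \<and> w - e' \<in> F"
  then have "e' - e \<in> E" using subspace_diff[OF E _ assms(1)] by blast
  moreover have "(w - e) - (w - e') \<in> F" using e' subspace_diff[OF F assms(2)] by blast
  then have "e' - e \<in> F" by simp
  ultimately have "e' - e \<in> {0}" using trivial by blast
  then show "e' = e" by simp
qed (use assms in auto)

lemma projection_along: "projection_along E F w \<in> E" "w - projection_along E F w \<in> F"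
proof -
  obtain e where "e \<in> E" "w - e \<in> F" using complementary_decomposition[OF E F trivial dims] by blast
  then show "projection_along E F w \<in> E" "w - projection_along E F w \<in> F"
    using projection_along_eqI by auto
qed

lemma projection_along_in: "w \<in> E \<Longrightarrow> projection_along E F w = w"
  by (rule projection_along_eqI) (auto simp: subspace_0[OF F])

lemma projection_along_kernel: "w \<in> F \<Longrightarrow> projection_along E F w = 0"
  by (rule projection_along_eqI) (auto simp: subspace_0[OF E])

lemma linear_projection_along: "linear (projection_along E F)"
proof (rule linearI)
  show "projection_along E F (x + y) = projection_along E F x + projection_along E F y" for x y
  proof (rule projection_along_eqI)
    show "projection_along E F x + projection_along E F y \<in> E"
      by (intro subspace_add[OF E] projection_along)
    have "(x - projection_along E F x) + (y - projection_along E F y) \<in> F"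
      by (intro subspace_add[OF F] projection_along)
    then show "x + y - (projection_along E F x + projection_along E F y) \<in> F"
      by (simp add: algebra_simps)
  qed
  show "projection_along E F (c *\<^sub>R x) = c *\<^sub>R projection_along E F x" for c x
  proof (rule projection_along_eqI)
    show "c *\<^sub>R projection_along E F x \<in> E"
      by (intro subspace_mul[OF E] projection_along)
    have "c *\<^sub>R (x - projection_along E F x) \<in> F"
      by (intro subspace_mul[OF F] projection_along)
    then show "c *\<^sub>R x - c *\<^sub>R projection_along E F x \<in> F"
      by (simp add: algebra_simps)
  qed
qed

end

text \<open>For a fixed projection \<open>P x0\<close> the operator \<open>P x \<circ> P x0 + (1 - P x) \<circ> (1 - P x0)\<close> intertwines
  \<open>P x0\<close> with \<open>P x\<close> and is close to the identity for \<open>x\<close> near \<open>x0\<close>.\<close>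

lemma continuous_subbundle_range:
  fixes P :: "'a::euclidean_space \<Rightarrow> 'a \<Rightarrow> 'a"
  assumes lin: "\<And>x. linear (P x)" and idem: "\<And>x w. P x (P x w) = P x w"
    and cont: "\<And>w. continuous_on UNIV (\<lambda>x. P x w)"
  shows "continuous_subbundle (\<lambda>x. range (P x))"
  unfolding continuous_subbundle_def
proof
  fix x0
  define T where "T x w = P x (P x0 w) + (w - P x0 w) - P x (w - P x0 w)" for x w
  have linT: "linear (T x)" for x
    unfolding T_def[abs_def]
    by (intro linear_compose_add linear_compose_sub linear_compose[OF _ lin, unfolded o_def] lin linear_id[unfolded id_def])
  have Tx0: "T x0 w = w" for w
    by (simp add: T_def idem linear_diff[OF lin])
  have contT: "continuous_on UNIV (\<lambda>x. T x w)" for w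
    unfolding T_def by (intro continuous_intros cont)
  \<comment> \<open>A continuous bound for the operator norm of \<open>T x\<close> minus the
    identity; below 1 it forces \<open>T x\<close> to be injective.\<close>
  define \<phi> where "\<phi> x = (\<Sum>b\<in>Basis. norm (T x b - b))" for x
  have "continuous_on UNIV \<phi>"
    unfolding \<phi>_def by (intro continuous_intros contT)
  then have "open (\<phi> -` {..<1})"
    by (intro open_vimage) auto
  have "\<phi> x0 = 0" by (simp add: \<phi>_def Tx0)
  have injT: "inj (T x)" if "\<phi> x < 1" for x
    unfolding linear_injective_0[OF linT]
  proof (intro allI impI)
    fix w assume "T x w = 0"
    have "norm (T x w - w) \<le> \<phi> x * norm w"
    proof -
      have "linear (\<lambda>w. T x w - w)"
        by (intro linear_compose_sub linT linear_id[unfolded id_def])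
      then have "T x w - w = (\<Sum>b\<in>Basis. (w \<bullet> b) *\<^sub>R (T x b - b))"
        by (rule linear_basis_expansion)
      also have "norm \<dots> \<le> (\<Sum>b\<in>Basis. norm w * norm (T x b - b))"
        by (rule sum_norm_le) (auto intro!: mult_right_mono Basis_le_norm)
      finally show ?thesis by (simp add: \<phi>_def sum_distrib_left mult.commute)
    qed
    then have "norm w \<le> \<phi> x * norm w" using \<open>T x w = 0\<close> by simp
    then show "w = 0" using that by (metis mult_le_cancel_right1 norm_le_zero_iff not_less)
  qed
  have TP: "T x (P x0 w) = P x (P x0 w)" for x w
    by (simp add: T_def idem linear_0[OF lin])
  have comm: "P x (T x w) = P x (P x0 w)" for x w
    by (simp add: T_def linear_add[OF lin] linear_diff[OF lin] idem)
  \<comment> \<open>The local frame is the image under \<open>T y\<close> of a fixed basis of the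
    range at \<open>x0\<close>.\<close>
  obtain B where B: "B \<subseteq> range (P x0)" "independent B" "span B = range (P x0)" "card B = dim (range (P x0))"
    using basis_exists[of "range (P x0)"] linear_subspace_image[OF lin subspace_UNIV]
    by (metis span_minimal subset_antisym)
  have "finite B" using B(2) by (rule independent_imp_finite)
  then obtain b where b: "bij_betw b {..<card B} B"
    using ex_bij_betw_nat_finite[of B] by (auto simp: atLeast0LessThan)
  have bB: "b ` {..<card B} = B" using b by (simp add: bij_betw_def)
  show "\<exists>U k. \<exists>X::nat \<Rightarrow> 'a \<Rightarrow> 'a. open U \<and> x0 \<in> U \<and> (\<forall>i<k. continuous_on U (X i)) \<and>
      (\<forall>y\<in>U. inj_on (\<lambda>i. X i y) {..<k} \<and> independent ((\<lambda>i. X i y) ` {..<k}) \<and>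
        span ((\<lambda>i. X i y) ` {..<k}) = range (P y))"
  proof (intro exI[of _ "\<phi> -` {..<1}"] exI[of _ "card B"] exI[of _ "\<lambda>i y. T y (b i)"] conjI ballI allI impI)
    show "open (\<phi> -` {..<1})" by fact
    show "x0 \<in> \<phi> -` {..<1}" using \<open>\<phi> x0 = 0\<close> by simp
    show "continuous_on (\<phi> -` {..<1}) (\<lambda>y. T y (b i))" for i
      by (rule continuous_on_subset[OF contT]) simp
    fix y assume "y \<in> \<phi> -` {..<1}"
    then have inj: "inj (T y)" using injT by simp
    have im: "(\<lambda>i. T y (b i)) ` {..<card B} = T y ` B" using bB by (auto simp: image_image[symmetric])
    show "inj_on (\<lambda>i. T y (b i)) {..<card B}"
      using comp_inj_on[OF bij_betw_imp_inj_on[OF b], of "T y"] inj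
      by (simp add: o_def inj_on_subset)
    show "independent ((\<lambda>i. T y (b i)) ` {..<card B})"
      unfolding im by (rule linear_independent_injective_image[OF linT B(2)]) (rule inj_on_subset[OF inj subset_UNIV])
    have "span (T y ` B) = T y ` range (P x0)"
      using linear_span_image[OF linT, of y B] B(3) by simp
    also have "\<dots> = range (P y)"
    proof
      show "T y ` range (P x0) \<subseteq> range (P y)" by (auto simp: TP)
      show "range (P y) \<subseteq> T y ` range (P x0)"
      proof
        fix z assume "z \<in> range (P y)"
        then have z: "P y z = z" by (auto simp: idem)
        obtain w where "T y w = z"
          using linear_injective_imp_surjective[OF linT inj] by (metis surjD)
        then have "T y (P x0 w) = z" using comm[of y w] TP[of y w] z by simp
        then show "z \<in> T y ` range (P x0)" by blast
      qed
    qed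
    finally show "span ((\<lambda>i. T y (b i)) ` {..<card B}) = range (P y)" unfolding im .
  qed
qed

section \<open>Anosov metrics from periodic families of projections\<close>

context affine_diffeo
begin

definition Lpow :: "int \<Rightarrow> 'a \<Rightarrow> 'a" where
  "Lpow m = (if 0 \<le> m then L ^^ nat m else inv L ^^ nat (- m))"

lemma Lpow_0 [simp]: "Lpow 0 w = w"
  by (simp add: Lpow_def)

lemma Lpow_Suc: "Lpow (m + 1) w = L (Lpow m w)"
proof (cases "0 \<le> m")
  case True
  then have "nat (m + 1) = Suc (nat m)" by simp
  then show ?thesis using True by (simp add: Lpow_def)
next
  case False
  define k where "k = nat (- (m + 1))"
  have k: "nat (- m) = Suc k" using False by (simp add: k_def)
  have "Lpow (m + 1) w = (inv L ^^ k) w"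
    using False by (cases "m + 1 = 0") (auto simp: Lpow_def k_def)
  moreover have "Lpow m w = inv L ((inv L ^^ k) w)"
    using False k by (simp add: Lpow_def)
  ultimately show ?thesis by (simp add: inv_L)
qed

lemma Lpow_L: "Lpow m (L w) = L (Lpow m w)"
proof (cases "0 \<le> m")
  case True
  then show ?thesis by (simp add: Lpow_def funpow_swap1)
next
  case False
  have "(inv L ^^ k) (L w) = L ((inv L ^^ k) w)" for k
    by (induction k) (simp_all add: inv_L)
  then show ?thesis using False by (simp add: Lpow_def)
qed

lemma Lpow_diff_1: "Lpow (m - 1) (L w) = Lpow m w"
  using Lpow_Suc[of "m - 1" w] by (simp add: Lpow_L)

lemma Lpow_inverse: "Lpow m (Lpow (- m) w) = w"
proof (induction m rule: int_induct[where k=0])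
  case (step1 i)
  have "Lpow (i + 1) (Lpow (- (i + 1)) w) = Lpow i (Lpow (- (i + 1) + 1) w)"
    unfolding Lpow_Suc Lpow_L ..
  then show ?case using step1 by simp
next
  case (step2 i)
  have "Lpow (i - 1) (Lpow (- (i - 1)) w) = Lpow (i - 1) (Lpow (- i + 1) w)" by simp
  also have "\<dots> = Lpow i (Lpow (- i) w)" unfolding Lpow_Suc by (rule Lpow_diff_1)
  finally show ?case using step2 by simp
qed simp

lemma linear_Lpow: "linear (Lpow m)"
  by (simp add: Lpow_def linear_funpow linear_L linear_inv_L)

lemma Lpow_eq_0: "Lpow m w = 0 \<longleftrightarrow> w = 0"
  using Lpow_inverse[of "- m" w] linear_0[OF linear_Lpow] by force

lemma Lpow_invariant:
  assumes "\<And>x. h (L x) = h x" shows "h (Lpow m w) = h w"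
proof (induction m rule: int_induct[where k=0])
  case (step1 i)
  then show ?case by (simp add: Lpow_Suc assms)
next
  case (step2 i)
  have "h (Lpow (i - 1) w) = h (L (Lpow (i - 1) w))" by (simp add: assms)
  also have "\<dots> = h (Lpow i w)" using Lpow_Suc[of "i - 1" w] by simp
  finally show ?case using step2 by simp
qed simp

end

text \<open>One application of \<open>f\<close> corresponds to four steps of \<open>j\<close>. For
  projections P and Q, the condition in \<open>consecutive_P\<close> says that (P - Q)^2 = 0, which
  makes all their affine combinations idempotent. The last two assumptions put the range of
  \<open>P (4 * m)\<close> and the kernel of \<open>P (4 * m + 2)\<close> into
  \<open>ker l\<close>.\<close>

locale translation_splitting = affine_diffeo L b f for L :: "'a::euclidean_space \<Rightarrow> 'a" and b f +
  fixes l :: "'a \<Rightarrow> real" and P :: "int \<Rightarrow> 'a \<Rightarrow> 'a"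
  assumes linear_l: "linear l" and l_L: "l (L x) = l x" and l_b: "l b = 1"
    and linear_P: "linear (P j)" and idem_P: "P j (P j w) = P j w"
    and consecutive_P: "P j (P (j + 1) w) + P (j + 1) (P j w) = P j w + P (j + 1) w"
    and equivariant_P: "P (j + 4) (L w) = L (P j w)"
    and stable_level: "l (P (4 * m) w) = 0" and unstable_level: "l (P (4 * m + 2) w) = l w"
begin

definition Pt :: "real \<Rightarrow> 'a \<Rightarrow> 'a" where "Pt t w = interp (\<lambda>j. P j w) t"

text \<open>The euclidean inner product transported by L^m, where m numbers the block of four steps.
  It makes \<open>L\<close> an isometry from step \<open>j\<close> to step
  \<open>j + 4\<close>.\<close>

definition q :: "int \<Rightarrow> 'a \<Rightarrow> 'a \<Rightarrow> real" where
  "q j v w = Lpow (- (j div 4)) v \<bullet> Lpow (- (j div 4)) w"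

definition qt :: "real \<Rightarrow> 'a \<Rightarrow> 'a \<Rightarrow> real" where "qt t v w = interp (\<lambda>j. q j v w) t"

text \<open>The exponents are doubled because \<open>G\<close> is a squared length. The parameter
  \<open>t\<close> advances by 4 under \<open>f\<close>, so norms change by exp (-4) and exp
  4.\<close>

definition G :: "real \<Rightarrow> 'a \<Rightarrow> 'a \<Rightarrow> real" where
  "G t v w = exp (- 2 * t) * qt t (Pt t v) (Pt t w) + exp (2 * t) * qt t (v - Pt t v) (w - Pt t w)"

definition metric :: "'a \<Rightarrow> 'a \<Rightarrow> 'a \<Rightarrow> real" where "metric x = G (4 * l x)"

definition Es :: "'a \<Rightarrow> 'a set" where "Es x = range (Pt (4 * l x))"
definition Eu :: "'a \<Rightarrow> 'a set" where "Eu x = range (\<lambda>w. w - Pt (4 * l x) w)"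

lemma linear_Pt: "linear (Pt t)"
  by (rule linearI) (simp_all add: Pt_def linear_add[OF linear_P] linear_cmul[OF linear_P] interp_add interp_scale)

text \<open>Squaring (1 - s) P + s Q gives the cross term s (1 - s) (P Q + Q P), which
  \<open>consecutive_P\<close> turns into s (1 - s) (P + Q).\<close>

lemma idem_Pt: "Pt t (Pt t w) = Pt t w"
proof -
  define s where "s = smooth_step (t - \<lfloor>t\<rfloor>)"
  define j where "j = \<lfloor>t\<rfloor>"
  have e: "Pt t w = (1 - s) *\<^sub>R P j w + s *\<^sub>R P (j + 1) w" for w
    by (simp add: Pt_def interp_convex s_def j_def)
  have "Pt t (Pt t w) = (1 - s) *\<^sub>R ((1 - s) *\<^sub>R P j w + s *\<^sub>R P j (P (j + 1) w))
      + s *\<^sub>R ((1 - s) *\<^sub>R P (j + 1) (P j w) + s *\<^sub>R P (j + 1) w)"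
    unfolding e linear_add[OF linear_P] linear_cmul[OF linear_P] idem_P ..
  also have "\<dots> = ((1 - s) * (1 - s)) *\<^sub>R P j w + (s * s) *\<^sub>R P (j + 1) w
      + ((1 - s) * s) *\<^sub>R (P j (P (j + 1) w) + P (j + 1) (P j w))"
    by (simp only: scaleR_add_right scaleR_scaleR mult.commute[of s "1 - s"] add_ac)
  also have "\<dots> = ((1 - s) * (1 - s) + (1 - s) * s) *\<^sub>R P j w + (s * s + (1 - s) * s) *\<^sub>R P (j + 1) w"
    unfolding consecutive_P by (simp only: scaleR_add_left scaleR_add_right add_ac)
  also have "(1 - s) * (1 - s) + (1 - s) * s = 1 - s" by (simp add: algebra_simps)
  also have "s * s + (1 - s) * s = s" by (simp add: algebra_simps)
  finally show ?thesis by (simp add: e)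
qed

lemma Pt_equivariant: "Pt (t + 4) (L w) = L (Pt t w)"
proof -
  have "Pt (t + 4) (L w) = interp (\<lambda>j. P (j + 4) (L w)) t"
    using interp_shift[of "\<lambda>j. P j (L w)" t 4] by (simp add: Pt_def)
  also have "\<dots> = L (Pt t w)"
    by (simp add: equivariant_P Pt_def interp_linear_image[OF linear_L])
  finally show ?thesis .
qed

lemma bilinear_q: "bilinear (q j)"
  unfolding bilinear_def q_def
  by (intro conjI allI linearI)
     (simp_all add: linear_add[OF linear_Lpow] linear_cmul[OF linear_Lpow] inner_add_left inner_add_right)

lemma q_pos: "v \<noteq> 0 \<Longrightarrow> q j v v > 0"
  by (simp add: q_def Lpow_eq_0)

lemma qt_equivariant: "qt (t + 4) (L v) (L w) = qt t v w"
proof -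
  have "qt (t + 4) (L v) (L w) = interp (\<lambda>j. q (j + 4) (L v) (L w)) t"
    using interp_shift[of "\<lambda>j. q j (L v) (L w)" t 4] by (simp add: qt_def)
  also have "(\<lambda>j. q (j + 4) (L v) (L w)) = (\<lambda>j. q j v w)"
  proof
    fix j :: int
    have "- ((j + 4) div 4) = - (j div 4) - 1" by simp
    then show "q (j + 4) (L v) (L w) = q j v w" by (simp only: q_def Lpow_diff_1)
  qed
  finally show ?thesis by (simp add: qt_def)
qed

lemma bilinear_qt: "bilinear (qt t)"
proof -
  have "interp (\<lambda>j. r * a j) t = r * interp a t" for r and a :: "int \<Rightarrow> real"
    using interp_scale[of r a t] by simp
  then show ?thesis
    unfolding bilinear_def qt_def
    by (intro conjI allI linearI)
       (simp_all add: bilinear_ladd[OF bilinear_q] bilinear_radd[OF bilinear_q] bilinear_lmul[OF bilinear_q]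
         bilinear_rmul[OF bilinear_q] interp_add)
qed

lemma qt_sym: "qt t v w = qt t w v"
  by (simp add: qt_def q_def inner_commute)

lemma qt_pos: assumes "v \<noteq> 0" shows "qt t v v > 0"
proof -
  define s where "s = smooth_step (t - \<lfloor>t\<rfloor>)"
  have s: "0 \<le> s" "s \<le> 1" by (auto simp: s_def smooth_step_bounds)
  have "qt t v v = (1 - s) * q \<lfloor>t\<rfloor> v v + s * q (\<lfloor>t\<rfloor> + 1) v v"
    by (simp add: qt_def interp_convex s_def)
  moreover have "\<dots> > 0"
  proof (cases "s = 0")
    case False
    then have "s * q (\<lfloor>t\<rfloor> + 1) v v > 0" using s q_pos[OF assms] by simp
    moreover have "(1 - s) * q \<lfloor>t\<rfloor> v v \<ge> 0" using s q_pos[OF assms, of "\<lfloor>t\<rfloor>"] by (intro mult_nonneg_nonneg) auto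
    ultimately show ?thesis by simp
  qed (use q_pos[OF assms] in simp)
  ultimately show ?thesis by simp
qed

lemma qt_nonneg: "qt t v v \<ge> 0"
  using qt_pos[of v t] bilinear_lzero[OF bilinear_qt] by (cases "v = 0") (auto simp: less_imp_le)

lemma linear_complement: "linear (\<lambda>w. w - Pt t w)"
  by (rule linearI) (simp_all add: linear_add[OF linear_Pt] linear_cmul[OF linear_Pt] algebra_simps)

lemma bilinear_G: "bilinear (G t)"
  unfolding bilinear_def G_def
  by (intro conjI allI linearI)
     (simp_all add: linear_add[OF linear_Pt] linear_cmul[OF linear_Pt] bilinear_ladd[OF bilinear_qt]
       bilinear_radd[OF bilinear_qt] bilinear_lmul[OF bilinear_qt] bilinear_rmul[OF bilinear_qt]
       bilinear_lsub[OF bilinear_qt] bilinear_rsub[OF bilinear_qt] algebra_simps)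

lemma G_lower:
  "exp (- 2 * t) * qt t (Pt t w) (Pt t w) \<le> G t w w"
  "exp (2 * t) * qt t (w - Pt t w) (w - Pt t w) \<le> G t w w"
  by (simp_all add: G_def qt_nonneg)

lemma G_pos: assumes "w \<noteq> 0" shows "G t w w > 0"
proof (cases "Pt t w = 0")
  case True
  then have "qt t (w - Pt t w) (w - Pt t w) > 0" using assms by (intro qt_pos) simp
  then have "exp (2 * t) * qt t (w - Pt t w) (w - Pt t w) > 0" by simp
  then show ?thesis using G_lower(2)[of t w] by linarith
next
  case False
  then have "qt t (Pt t w) (Pt t w) > 0" by (rule qt_pos)
  then have "exp (- 2 * t) * qt t (Pt t w) (Pt t w) > 0" by simp
  then show ?thesis using G_lower(1)[of t w] by linarith
qed

lemma Ck_Pt_inner: "Ck k (\<lambda>t. Pt t w \<bullet> c)"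
proof -
  have "linear (\<lambda>x. x \<bullet> c)" by (rule linearI) (simp_all add: inner_add_left)
  then have "(\<lambda>t. Pt t w \<bullet> c) = interp (\<lambda>j. P j w \<bullet> c)"
    unfolding Pt_def using interp_linear_image by blast
  then show ?thesis using Ck_interp by simp
qed

lemma Ck_qt: "Ck k (\<lambda>t. qt t v w)"
  unfolding qt_def using Ck_interp[of k "\<lambda>j. q j v w"] by simp

lemma Ck_G: "Ck k (\<lambda>t. G t v w)"
proof -
  \<comment> \<open>In \<open>G\<close> the arguments of \<open>qt t\<close> depend on
    \<open>t\<close> as well; the expansion leaves sums and products of scalar functions of
    \<open>t\<close>.\<close>
  have e: "qt t x y = (\<Sum>a\<in>Basis. \<Sum>c\<in>Basis. (x \<bullet> a) * (y \<bullet> c) * qt t a c)" for t x y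
    by (rule bilinear_basis_expansion[OF bilinear_qt])
  have c: "Ck k (\<lambda>t. (v - Pt t v) \<bullet> a)" for v a
    using Ck_add[OF Ck_const[of k "v \<bullet> a"] Ck_mult[OF Ck_const[of k "-1"] Ck_Pt_inner[of k v a]]]
    by (simp add: inner_diff_left)
  show ?thesis
    unfolding G_def e[of _ "Pt _ _"] e[of _ "_ - Pt _ _"]
    by (intro Ck_add Ck_mult Ck_sum Ck_exp Ck_Pt_inner Ck_qt c)
qed

lemma metric_riemannian: "riemannian_metric metric"
  unfolding riemannian_metric_def
proof (intro conjI allI impI)
  show "bilinear (metric x)" for x by (simp add: metric_def bilinear_G)
  show "metric x v w = metric x w v" for x v w
    by (simp add: metric_def G_def qt_sym[of _ "Pt _ v"] qt_sym[of _ "v - _"])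
  show "metric x v v > 0" if "v \<noteq> 0" for x v using G_pos[OF that] by (simp add: metric_def)
  show "smooth (\<lambda>x. metric x v w)" for v w
    unfolding smooth_def
  proof
    fix k
    have "linear (\<lambda>x. 4 * l x)"
      by (rule linearI) (simp_all add: linear_add[OF linear_l] linear_cmul[OF linear_l])
    from Ck_compose_linear[OF this Ck_G, of k 0 v w]
    show "Ck k (\<lambda>x. metric x v w)" by (simp add: metric_def)
  qed
qed

lemma G_stable: "G (t + 4) (L w) (L w) = exp (- 8) * G t w w" if "Pt t w = w"
proof -
  have "Pt (t + 4) (L w) = L w" by (simp add: Pt_equivariant that)
  moreover have "exp (- 2 * (t + 4)) = exp (- 8) * exp (- 2 * t)" by (simp flip: exp_add)
  ultimately show ?thesis
    by (simp add: G_def that qt_equivariant bilinear_lzero[OF bilinear_qt] mult.assoc del: mult_minus_left)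
qed

lemma G_unstable: "G (t + 4) (L w) (L w) = exp 8 * G t w w" if "Pt t w = 0"
proof -
  have "Pt (t + 4) (L w) = 0" by (simp add: Pt_equivariant that linear_0[OF linear_L])
  moreover have "exp (2 * (t + 4)) = exp 8 * exp (2 * t)" by (simp flip: exp_add)
  ultimately show ?thesis
    by (simp add: G_def that qt_equivariant bilinear_lzero[OF bilinear_qt] mult.assoc)
qed

lemma level_f: "4 * l (f x) = 4 * l x + 4"
  by (simp add: f linear_add[OF linear_l] l_L l_b)

lemma Es_iff: "w \<in> Es x \<longleftrightarrow> Pt (4 * l x) w = w"
  unfolding Es_def by (metis idem_Pt rangeE rangeI)

lemma Eu_iff: "w \<in> Eu x \<longleftrightarrow> Pt (4 * l x) w = 0"
proof
  assume "w \<in> Eu x"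
  then obtain u where "w = u - Pt (4 * l x) u" unfolding Eu_def by blast
  then show "Pt (4 * l x) w = 0" by (simp only: linear_diff[OF linear_Pt] idem_Pt diff_self)
next
  assume "Pt (4 * l x) w = 0"
  then have "w = w - Pt (4 * l x) w" by simp
  then show "w \<in> Eu x" unfolding Eu_def by (rule range_eqI)
qed

lemma continuous_Pt: "continuous_on UNIV (\<lambda>x. Pt (4 * l x) w)"
proof -
  have l: "continuous_on UNIV l"
    using linear_l by (simp add: linear_continuous_on linear_conv_bounded_linear)
  have "continuous_on UNIV (\<lambda>x. (Pt (4 * l x) w \<bullet> c) *\<^sub>R c)" for c
    by (intro continuous_intros continuous_on_compose2[OF Ck_imp_continuous_on[OF Ck_Pt_inner], of UNIV] l) auto
  then have "continuous_on UNIV (\<lambda>x. \<Sum>c\<in>Basis. (Pt (4 * l x) w \<bullet> c) *\<^sub>R c)"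
    by (intro continuous_on_sum)
  then show ?thesis by (simp add: euclidean_representation)
qed

lemma splitting: "continuous_splitting Es Eu"
  unfolding continuous_splitting_def
proof (intro conjI allI)
  show "continuous_subbundle Es"
    unfolding Es_def[abs_def]
    by (rule continuous_subbundle_range) (auto simp: linear_Pt idem_Pt continuous_Pt)
  show "continuous_subbundle Eu"
    unfolding Eu_def[abs_def]
    by (rule continuous_subbundle_range)
       (auto simp: linear_complement linear_diff[OF linear_Pt] idem_Pt intro!: continuous_intros continuous_Pt)
  show "Es x \<inter> Eu x = {0}" for x
    by (auto simp: Es_iff Eu_iff linear_0[OF linear_Pt])
  show "\<exists>s\<in>Es x. \<exists>u\<in>Eu x. w = s + u" for x w
    by (rule bexI[of _ "Pt (4 * l x) w"], rule bexI[of _ "w - Pt (4 * l x) w"]) (auto simp: Es_def Eu_def)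
qed

lemma L_image:
  assumes "\<And>w. L w \<in> E' \<longleftrightarrow> w \<in> E" shows "L ` E = E'"
proof
  show "E' \<subseteq> L ` E"
    using assms inv_L(2) by (metis image_eqI subsetI)
qed (use assms in auto)

lemma L_Es: "L w \<in> Es (f x) \<longleftrightarrow> w \<in> Es x"
  unfolding Es_iff level_f Pt_equivariant using bij_L by (simp add: bij_def inj_eq)

lemma L_Eu: "L w \<in> Eu (f x) \<longleftrightarrow> w \<in> Eu x"
  unfolding Eu_iff level_f Pt_equivariant
  using inj_eq[OF bij_is_inj[OF bij_L], of _ 0] linear_0[OF linear_L] by simp

text \<open>Equivariance turns the estimates into equalities, with constant 1 and rate exp
  (-4).\<close>

lemma anosov: "anosov_splitting f metric Es Eu"
proof -
  have e: "sqrt (exp (- 8)) = exp (- 4)" "sqrt (exp 8) = exp (4::real)"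
    by (rule real_sqrt_unique; simp add: power2_eq_square flip: exp_add)+
  have one: "rnorm metric (f x) (L w) = exp (- 4) * rnorm metric x w" if "w \<in> Es x" for x w
    using that G_stable[of "4 * l x" w] unfolding Es_iff
    by (simp add: rnorm_def metric_def level_f real_sqrt_mult e)
  have "rnorm metric ((f ^^ m) x) ((L ^^ m) w) = exp (- 4) ^ m * rnorm metric x w \<and> (L ^^ m) w \<in> Es ((f ^^ m) x)"
    if "w \<in> Es x" for m x w
    by (induction m) (use that one in \<open>auto simp: L_Es\<close>)
  then have s: "rnorm metric ((f ^^ m) x) ((L ^^ m) w) \<le> 1 * exp (- 4) ^ m * rnorm metric x w" if "w \<in> Es x" for m x w
    using that by simp
  \<comment> \<open>Writing the point as \<open>f y\<close> and the vector as \<open>L z\<close>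
    reduces the backward step to the expansion at \<open>y\<close>.\<close>
  have two: "rnorm metric (inv f x) (inv L w) = exp (- 4) * rnorm metric x w \<and> inv L w \<in> Eu (inv f x)"
    if "w \<in> Eu x" for x w
  proof -
    define y z where "y = inv f x" and "z = inv L w"
    have x: "x = f y" and w: "w = L z"
      using bij_f by (simp_all add: y_def z_def inv_L bij_is_surj surj_f_inv_f)
    have z: "z \<in> Eu y" using that unfolding x w L_Eu .
    then have "rnorm metric x w = exp 4 * rnorm metric y z"
      using G_unstable[of "4 * l y" z] unfolding x w Eu_iff
      by (simp add: rnorm_def metric_def level_f real_sqrt_mult e)
    then have "exp (- 4) * rnorm metric x w = (exp (- 4) * exp 4) * rnorm metric y z" by simp
    then show ?thesis using z by (simp add: y_def z_def flip: exp_add)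
  qed
  have "rnorm metric ((inv f ^^ m) x) ((inv L ^^ m) w) = exp (- 4) ^ m * rnorm metric x w \<and> (inv L ^^ m) w \<in> Eu ((inv f ^^ m) x)"
    if "w \<in> Eu x" for m x w
    by (induction m) (use that two in auto)
  then have u: "rnorm metric ((inv f ^^ m) x) ((inv L ^^ m) w) \<le> 1 * exp (- 4) ^ m * rnorm metric x w" if "w \<in> Eu x" for m x w
    using that by simp
  have i: "invariant_subbundle f Es" "invariant_subbundle f Eu"
    unfolding invariant_subbundle_def derivative_f by (intro allI L_image L_Es L_Eu)+
  have "exp (- 4) < (1::real)" by simp
  with s u show ?thesis
    unfolding anosov_splitting_def derivative_funpow derivative_inv_funpow
    by (intro conjI splitting i exI[of _ 1] exI[of _ "exp (- 4)"] allI ballI) auto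
qed

end

section \<open>Completeness of the constructed metric\<close>

text \<open>The height \<open>barrier\<close> increases only at the parameters \<open>4 * m\<close> (\<open>m \<ge> 1\<close>) and \<open>4 * m + 2\<close>
  (\<open>m \<le> -1\<close>). There \<open>Pt\<close> is constant and crossing the level is expensive, since it requires the
  unstable direction at positive levels and the stable direction at negative levels.\<close>

definition barrier :: "int \<Rightarrow> real" where
  "barrier j = of_int (if 1 \<le> j then (j - 1) div 4 else (j + 1) div 4)"

lemma div_4_step:
  fixes i :: int
  shows "\<bar>(i + 1) div 4 - i div 4\<bar> \<le> 1" "(i + 1) div 4 - i div 4 \<noteq> 0 \<Longrightarrow> i + 1 = 4 * ((i + 1) div 4)"
  by presburger+

text \<open>On either side of 0 the barrier is a shifted quotient by 4; the step from 0 to 1, where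
  the two formulas meet, contributes nothing.\<close>

lemma barrier_difference:
  obtains "1 \<le> j" "barrier (j + 1) - barrier j = of_int ((j - 1 + 1) div 4 - (j - 1) div 4)"
  | "j = 0" "barrier (j + 1) - barrier j = 0"
  | "j \<le> -1" "barrier (j + 1) - barrier j = of_int ((j + 1 + 1) div 4 - (j + 1) div 4)"
proof -
  consider "1 \<le> j" | "j = 0" | "j \<le> -1" by linarith
  then show ?thesis
  proof cases
    case 1
    then show ?thesis by (intro that(1)) (auto simp: barrier_def)
  next
    case 2
    then show ?thesis by (intro that(2)) (auto simp: barrier_def)
  next
    case 3
    then show ?thesis by (intro that(3)) (auto simp: barrier_def)
  qed
qed

lemma barrier_jump: "\<bar>barrier (j + 1) - barrier j\<bar> \<le> 1"
proof (rule barrier_difference[of j])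
  assume "barrier (j + 1) - barrier j = of_int ((j - 1 + 1) div 4 - (j - 1) div 4)"
  then show ?thesis using div_4_step(1)[of "j - 1"] by linarith
next
  assume "barrier (j + 1) - barrier j = of_int ((j + 1 + 1) div 4 - (j + 1) div 4)"
  then show ?thesis using div_4_step(1)[of "j + 1"] by linarith
qed simp

lemma barrier_jump_cases:
  assumes "barrier (j + 1) - barrier j \<noteq> 0"
  obtains m where "j = 4 * m" "m \<ge> 1" | m where "j = 4 * m + 2" "m \<le> -1"
proof (rule barrier_difference[of j])
  assume j: "1 \<le> j" "barrier (j + 1) - barrier j = of_int ((j - 1 + 1) div 4 - (j - 1) div 4)"
  then have "(j - 1 + 1) div 4 - (j - 1) div 4 \<noteq> 0" using assms by auto
  from div_4_step(2)[OF this] obtain i where "j - 1 + 1 = 4 * i" by blast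
  with j(1) show ?thesis by (intro that(1)[of i]) presburger+
next
  assume j: "j \<le> -1" "barrier (j + 1) - barrier j = of_int ((j + 1 + 1) div 4 - (j + 1) div 4)"
  then have "(j + 1 + 1) div 4 - (j + 1) div 4 \<noteq> 0" using assms by auto
  from div_4_step(2)[OF this] obtain i where "j + 1 + 1 = 4 * i" by blast
  with j(1) show ?thesis by (intro that(2)[of "i - 1"]) presburger+
qed (use assms in simp)

text \<open>The barrier grows with average slope 1/4 in both directions, up to a bounded error.
  Hence a bound on the barrier confines the level to a bounded interval.\<close>

lemma interp_barrier_proper:
  assumes "\<bar>interp barrier s\<bar> \<le> N" shows "\<bar>s\<bar> \<le> 4 * N + 8"
proof -
  define j where "j = \<lfloor>s\<rfloor>"
  define c where "c = smooth_step (s - j)"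
  have c: "0 \<le> c" "c \<le> 1" by (auto simp: c_def smooth_step_bounds)
  have i: "interp barrier s = (1 - c) * barrier j + c * barrier (j + 1)"
    by (simp add: interp_convex c_def j_def)
  have js: "real_of_int j \<le> s" "s < real_of_int j + 1" unfolding j_def by linarith+
  consider "s \<ge> 1" | "s < 0" | "0 \<le> s" "s < 1" by linarith
  then show ?thesis
  proof cases
    case 1
    then have j1: "j \<ge> 1" unfolding j_def by linarith
    have "4 * ((j - 1) div 4) \<ge> j - 4" "4 * ((j + 1 - 1) div 4) \<ge> j - 4" by presburger+
    then have "real_of_int (4 * ((j - 1) div 4)) \<ge> real_of_int (j - 4)"
      "real_of_int (4 * ((j + 1 - 1) div 4)) \<ge> real_of_int (j - 4)" by (simp_all only: of_int_le_iff)
    then have "- barrier j \<le> - ((s - 5) / 4)" "- barrier (j + 1) \<le> - ((s - 5) / 4)"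
      using j1 js unfolding barrier_def by auto
    then have "(1 - c) * - barrier j + c * - barrier (j + 1) \<le> - ((s - 5) / 4)"
      by (rule convex_bound_le) (use c in auto)
    then have "interp barrier s \<ge> (s - 5) / 4"
      unfolding i mult_minus_right by linarith
    then show ?thesis using assms 1 by (simp add: abs_le_iff)
  next
    case 2
    then have j1: "j \<le> -1" unfolding j_def by linarith
    have "4 * ((j + 1) div 4) \<le> j + 2" "4 * ((j + 1 + 1) div 4) \<le> j + 2" by presburger+
    then have "real_of_int (4 * ((j + 1) div 4)) \<le> real_of_int (j + 2)"
      "real_of_int (4 * ((j + 1 + 1) div 4)) \<le> real_of_int (j + 2)" by (simp_all only: of_int_le_iff)
    then have "barrier j \<le> (s + 2) / 4" "barrier (j + 1) \<le> (s + 2) / 4"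
      using j1 js unfolding barrier_def by auto
    then have "interp barrier s \<le> (s + 2) / 4"
      unfolding i by (rule convex_bound_le) (use c in auto)
    then show ?thesis using assms 2 by (simp add: abs_le_iff)
  next
    case 3
    then show ?thesis using assms by simp
  qed
qed

context translation_splitting
begin

text \<open>Because \<open>l\<close> is invariant under \<open>L\<close>, transporting the inner
  product by powers of \<open>L\<close> preserves the constant: one \<open>\<Lambda>\<close> serves
  for all \<open>j\<close>.\<close>

lemma level_le_q:
  assumes "\<And>y. \<bar>l y\<bar> \<le> \<Lambda> * norm y"
  shows "(l y)\<^sup>2 \<le> \<Lambda>\<^sup>2 * q j y y"
proof -
  define z where "z = Lpow (- (j div 4)) y"
  have "\<bar>l y\<bar> \<le> \<Lambda> * norm z"
    using assms[of z] by (simp add: z_def Lpow_invariant[of l, OF l_L])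
  then have "\<bar>l y\<bar>\<^sup>2 \<le> (\<Lambda> * norm z)\<^sup>2" by (rule power_mono) simp
  then show ?thesis
    by (simp add: power_mult_distrib power2_norm_eq_inner q_def z_def)
qed

text \<open>At a jump with positive \<open>j\<close> the stable component lies in
  \<open>ker l\<close>, so \<open>l\<close> sees only the unstable one, whose weight is at least 1
  as \<open>t \<ge> 0\<close>. At a jump with negative \<open>j\<close> the roles are
  exchanged.\<close>

lemma level_le_metric:
  assumes \<Lambda>: "\<And>y. \<bar>l y\<bar> \<le> \<Lambda> * norm y" "\<Lambda> > 0"
    and t: "\<bar>t - of_int j\<bar> \<le> 1/4" and jump: "barrier (j + 1) - barrier j \<noteq> 0"
  shows "\<bar>l u\<bar> \<le> \<Lambda> * sqrt (G t u u)"
proof -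
  have P: "Pt t u = P j u" unfolding Pt_def by (rule interp_plateau[OF t])
  have Q: "qt t y y = q j y y" for y unfolding qt_def by (rule interp_plateau[OF t])
  have nn: "q j y y \<ge> 0" for y by (simp add: q_def)
  from jump have "(l u)\<^sup>2 \<le> \<Lambda>\<^sup>2 * G t u u"
  proof (cases rule: barrier_jump_cases)
    case (1 m)
    then have "real_of_int j \<ge> 4" by simp
    then have "t \<ge> 0" using abs_le_D2[OF t] by linarith
    then have "1 * q j (u - P j u) (u - P j u) \<le> exp (2 * t) * q j (u - P j u) (u - P j u)"
      by (intro mult_right_mono nn) simp
    also have "\<dots> \<le> G t u u" using G_lower(2)[of t u] unfolding P Q .
    finally have "\<Lambda>\<^sup>2 * q j (u - P j u) (u - P j u) \<le> \<Lambda>\<^sup>2 * G t u u" by (simp add: mult_left_mono)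
    moreover have "l (u - P j u) = l u"
      using stable_level[of m u] 1 by (simp add: linear_diff[OF linear_l])
    ultimately show ?thesis using level_le_q[OF \<Lambda>(1), of "u - P j u" j] by simp
  next
    case (2 m)
    then have "real_of_int j \<le> -2" by simp
    then have "t \<le> 0" using abs_le_D1[OF t] by linarith
    then have "1 * q j (P j u) (P j u) \<le> exp (- 2 * t) * q j (P j u) (P j u)"
      by (intro mult_right_mono nn) simp
    also have "\<dots> \<le> G t u u" using G_lower(1)[of t u] unfolding P Q .
    finally have "\<Lambda>\<^sup>2 * q j (P j u) (P j u) \<le> \<Lambda>\<^sup>2 * G t u u" by (simp add: mult_left_mono)
    moreover have "l (P j u) = l u" using unstable_level[of m u] 2 by simp
    ultimately show ?thesis using level_le_q[OF \<Lambda>(1), of "P j u" j] by simp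
  qed
  then have "sqrt ((l u)\<^sup>2) \<le> sqrt (\<Lambda>\<^sup>2 * G t u u)" by (rule real_sqrt_le_mono)
  then show ?thesis using \<Lambda>(2) by (simp add: real_sqrt_mult)
qed

lemma metric_complete: "complete_riemannian_metric metric"
proof -
  obtain \<sigma>' B where \<sigma>: "\<And>s. (smooth_step has_real_derivative \<sigma>' s) (at s)"
    "\<And>s. \<bar>\<sigma>' s\<bar> \<le> B" "\<And>s. s \<notin> {1/4..3/4} \<Longrightarrow> \<sigma>' s = 0"
    by (rule smooth_step_derivative) blast
  obtain \<Lambda> where \<Lambda>: "\<Lambda> > 0" "\<And>y. norm (l y) \<le> \<Lambda> * norm y"
    using linear_bounded_pos[OF linear_l] by blast
  define D where "D = \<bar>B\<bar> + 1"
  have D: "D > 0" "\<And>s. \<bar>\<sigma>' s\<bar> \<le> D"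
    using \<sigma>(2) by (auto simp: D_def intro: order_trans[OF \<sigma>(2)])
  \<comment> \<open>The interpolated barrier has slope at most \<open>D\<close>, the level enters
    with factor 4, and \<open>l\<close> is bounded by \<open>\<Lambda>\<close> times the norm;
    \<open>\<eta>\<close> cancels all three.\<close>
  define \<eta> where "\<eta> = 1 / (4 * D * \<Lambda>)"
  have \<eta>: "\<eta> > 0" using D \<Lambda> by (simp add: \<eta>_def)
  define \<beta> where "\<beta> s = \<sigma>' (s - of_int \<lfloor>s\<rfloor>) * (barrier (\<lfloor>s\<rfloor> + 1) - barrier \<lfloor>s\<rfloor>)" for s :: real
  \<comment> \<open>The shift by 1/2 moves the transition from \<open>barrier j\<close> to
    \<open>barrier (j + 1)\<close> to parameters within 1/4 of \<open>j\<close>, which is the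
    plateau where \<open>Pt\<close> and \<open>qt\<close> are constant.\<close>
  define H where "H x = \<eta> * interp barrier (1/2 + 4 * l x)" for x
  define H' where "H' x u = \<eta> * (\<beta> (1/2 + 4 * l x) * (4 * l u))" for x u
  have l4: "((\<lambda>x. 1/2 + 4 * l x) has_derivative (\<lambda>u. 4 * l u)) (at x)" for x
  proof -
    have "((\<lambda>x. 4 * l x) has_derivative (\<lambda>u. 4 * l u)) (at x)"
      by (intro has_derivative_mult_right linear_imp_has_derivative linear_l)
    from has_derivative_add[OF has_derivative_const[of "1/2"] this] show ?thesis by simp
  qed
  have dH: "(H has_derivative H' x) (at x)" for x
  proof -
    have "(interp barrier has_derivative (\<lambda>h. \<beta> (1/2 + 4 * l x) * h)) (at (1/2 + 4 * l x))"
      using interp_has_derivative[OF \<sigma>(1), of barrier "1/2 + 4 * l x"]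
      unfolding has_field_derivative_def \<beta>_def .
    from has_derivative_scaleR_right[OF has_derivative_compose[OF l4 this], of \<eta>]
    show ?thesis by (simp add: H_def[abs_def] H'_def[abs_def])
  qed
  have bound: "\<bar>H' x u\<bar> \<le> rnorm metric x u" for x u
  proof -
    define t where "t = 4 * l x"
    define j where "j = \<lfloor>1/2 + t\<rfloor>"
    show ?thesis
    proof (cases "\<beta> (1/2 + t) = 0")
      case True
      then show ?thesis by (simp add: H'_def t_def rnorm_nonneg[OF metric_riemannian])
    next
      case False
      then have "\<sigma>' (1/2 + t - of_int j) \<noteq> 0" and jump: "barrier (j + 1) - barrier j \<noteq> 0"
        by (auto simp: \<beta>_def j_def)
      then have "1/2 + t - of_int j \<in> {1/4..3/4}" using \<sigma>(3) by blast
      then have "\<bar>t - of_int j\<bar> \<le> 1/4" unfolding abs_le_iff atLeastAtMost_iff by linarith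
      from level_le_metric[OF _ \<Lambda>(1) this jump, of u] \<Lambda>(2)
      have lu: "\<bar>l u\<bar> \<le> \<Lambda> * rnorm metric x u"
        by (simp add: rnorm_def metric_def t_def)
      have "\<bar>\<beta> (1/2 + t)\<bar> \<le> D * 1"
        unfolding \<beta>_def abs_mult by (intro mult_mono D barrier_jump) (use D in auto)
      then have "\<bar>\<beta> (1/2 + t)\<bar> * (4 * \<bar>l u\<bar>) \<le> D * (4 * (\<Lambda> * rnorm metric x u))"
        using lu D(1) by (intro mult_mono) auto
      then have "\<bar>H' x u\<bar> \<le> \<eta> * (D * (4 * (\<Lambda> * rnorm metric x u)))"
        using \<eta> by (simp add: H'_def t_def abs_mult)
      also have "\<dots> = rnorm metric x u" using D \<Lambda> by (simp add: \<eta>_def)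
      finally show ?thesis .
    qed
  qed
  have lower: "\<exists>c>0. \<forall>x u. \<bar>H x\<bar> \<le> T \<longrightarrow> c * norm u \<le> rnorm metric x u" for T
  proof -
    \<comment> \<open>The metric depends on \<open>x\<close> only through \<open>l x\<close>, so the
      unbounded slab is represented by the compact segment of points \<open>s *\<^sub>R b\<close>
      with \<open>s\<close> between \<open>-M\<close> and \<open>M\<close>.\<close>
    define M where "M = 4 * (T / \<eta>) + 9"
    have "continuous_on {-M..M} (\<lambda>s. s *\<^sub>R b)" by (intro continuous_intros)
    then have "compact ((\<lambda>s. s *\<^sub>R b) ` {-M..M})"
      by (intro compact_continuous_image) auto
    then obtain c C where c: "c > 0"
      "\<And>y w. y \<in> (\<lambda>s. s *\<^sub>R b) ` {-M..M} \<Longrightarrow> c * norm w \<le> rnorm metric y w \<and> rnorm metric y w \<le> C * norm w"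
      by (rule rnorm_compact_bounds[OF metric_riemannian]) blast
    have "c * norm u \<le> rnorm metric x u" if "\<bar>H x\<bar> \<le> T" for x u
    proof -
      have "\<bar>interp barrier (1/2 + 4 * l x)\<bar> \<le> T / \<eta>"
        using that \<eta> by (simp add: H_def abs_mult field_simps)
      from interp_barrier_proper[OF this] have "\<bar>l x\<bar> \<le> M"
        by (simp add: M_def abs_le_iff)
      then have "l x *\<^sub>R b \<in> (\<lambda>s. s *\<^sub>R b) ` {-M..M}" by (intro imageI) (simp add: abs_le_iff)
      moreover have "metric (l x *\<^sub>R b) = metric x"
        by (simp add: metric_def linear_cmul[OF linear_l] l_b)
      ultimately show ?thesis using c(2)[of "l x *\<^sub>R b" u] by (simp add: rnorm_def)
    qed
    then show ?thesis using c(1) by blast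
  qed
  show ?thesis
    by (rule complete_riemannian_metric_criterion[OF metric_riemannian dH bound lower])
qed

end

section \<open>A periodic family of projections from four splittings\<close>

lemma projections_same_range:
  assumes "complementary E F" "complementary E F'"
  shows "projection_along E F (projection_along E F' w) + projection_along E F' (projection_along E F w)
    = projection_along E F w + projection_along E F' w"
  using complementary.projection_along_in[OF assms(1) complementary.projection_along(1)[OF assms(2)]]
    complementary.projection_along_in[OF assms(2) complementary.projection_along(1)[OF assms(1)]]
  by simp

text \<open>For a common kernel P Q = P and Q P = Q, since \<open>w - Q w\<close> is killed by P;
  for a common range the products are Q and P. Either way the sum is P + Q, as
  \<open>consecutive_P\<close> demands.\<close>

lemma projections_same_kernel:
  assumes "complementary E F" "complementary E' F"
  shows "projection_along E F (projection_along E' F w) + projection_along E' F (projection_along E F w)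
    = projection_along E F w + projection_along E' F w"
proof -
  have "projection_along E F (projection_along E' F w) = projection_along E F w"
    if "complementary E F" "complementary E' F" for E E'
    using complementary.projection_along_kernel[OF that(1) complementary.projection_along(2)[OF that(2)], of w]
    by (simp add: linear_diff[OF complementary.linear_projection_along[OF that(1)]])
  then show ?thesis using assms by simp
qed

context affine_diffeo
begin

lemma projection_along_image:
  assumes "complementary E F" "complementary (L ` E) (L ` F)"
  shows "projection_along (L ` E) (L ` F) (L w) = L (projection_along E F w)"
proof (rule complementary.projection_along_eqI[OF assms(2)])
  show "L (projection_along E F w) \<in> L ` E"
    using complementary.projection_along(1)[OF assms(1)] by blast
  have "L w - L (projection_along E F w) = L (w - projection_along E F w)"
    by (simp add: linear_diff[OF linear_L])
  then show "L w - L (projection_along E F w) \<in> L ` F"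
    using complementary.projection_along(2)[OF assms(1)] by simp
qed

lemma translation_splitting_from_period:
  assumes l: "linear l" "\<And>x. l (L x) = l x" "l b = (1::real)"
    and E0F0: "complementary E0 F0" and E1F0: "complementary E1 F0"
    and E1F1: "complementary E1 F1" and E1LF0: "complementary E1 (L ` F0)"
    and LE0: "complementary (L ` E0) (L ` F0)"
    and E0: "\<And>x. x \<in> E0 \<Longrightarrow> l x = 0" and F1: "\<And>x. x \<in> F1 \<Longrightarrow> l x = 0"
  defines "R \<equiv> \<lambda>r::int. if r = 0 then projection_along E0 F0 else if r = 1 then projection_along E1 F0
      else if r = 2 then projection_along E1 F1 else projection_along E1 (L ` F0)"
  shows "translation_splitting L b f l (\<lambda>j w. Lpow (j div 4) (R (j mod 4) (Lpow (- (j div 4)) w)))"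
proof -
  have linR: "linear (R r)" for r
    unfolding R_def using assms complementary.linear_projection_along by auto
  have idemR: "R r (R r w) = R r w" for r w
  proof -
    have "projection_along E F (projection_along E F w) = projection_along E F w"
      if "complementary E F" for E F
      using complementary.projection_along_in[OF that complementary.projection_along(1)[OF that]] .
    then show ?thesis
      unfolding R_def using E0F0 E1F0 E1F1 E1LF0 by (simp del: split_paired_All)
  qed
  have inv: "Lpow (- m) (Lpow m w) = w" for m w using Lpow_inverse[of "- m" w] by simp
  have R3: "projection_along E1 (L ` F0) (projection_along (L ` E0) (L ` F0) w)
      + projection_along (L ` E0) (L ` F0) (projection_along E1 (L ` F0) w)
      = projection_along E1 (L ` F0) w + projection_along (L ` E0) (L ` F0) w" for w
    by (rule projections_same_kernel[OF E1LF0 LE0])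
  show ?thesis
  proof (intro translation_splitting.intro translation_splitting_axioms.intro)
    show "affine_diffeo L b f" by (rule affine_diffeo_axioms)
    show "linear l" by (rule l(1))
    show "l (L x) = l x" for x by (rule l(2))
    show "l b = 1" by (rule l(3))
    fix j :: int and w
    define m where "m = j div 4"
    let ?P = "\<lambda>j w. Lpow (j div 4) (R (j mod 4) (Lpow (- (j div 4)) w))"
    show "linear (?P j)"
      using linear_compose[OF linear_compose[OF linear_Lpow linR] linear_Lpow] by (simp add: o_def)
    show "?P j (?P j w) = ?P j w" by (simp add: inv idemR)
    show "?P (j + 4) (L w) = L (?P j w)"
    proof -
      have "- ((j + 4) div 4) = - m - 1" "(j + 4) div 4 = m + 1" by (simp_all add: m_def)
      then show ?thesis by (simp only: Lpow_diff_1 Lpow_Suc m_def mod_add_self2)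
    qed
    show "?P j (?P (j + 1) w) + ?P (j + 1) (?P j w) = ?P j w + ?P (j + 1) w"
    proof (cases "j mod 4 = 3")
      case False
      then have d: "(j + 1) div 4 = m" "(j + 1) mod 4 = j mod 4 + 1" and r: "j mod 4 = 0 \<or> j mod 4 = 1 \<or> j mod 4 = 2"
        unfolding m_def by presburger+
      have "R (j mod 4) (R (j mod 4 + 1) y) + R (j mod 4 + 1) (R (j mod 4) y) = R (j mod 4) y + R (j mod 4 + 1) y" for y
        using r projections_same_kernel[OF E0F0 E1F0] projections_same_range[OF E1F0 E1F1] projections_same_range[OF E1F1 E1LF0]
        by (auto simp: R_def)
      then show ?thesis
        unfolding d m_def[symmetric] inv by (simp flip: linear_add[OF linear_Lpow])
    next
      \<comment> \<open>Here the next step opens a new period. Conjugating by one more power of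
        \<open>L\<close> turns its projection into the one onto \<open>L\<close>
        E0\<open>along\<close>L \<open>F0\<close>.\<close>
      case True
      have d: "(j + 1) div 4 = m + 1" "(j + 1) mod 4 = 0" using True unfolding m_def by presburger+
      have P1: "?P (j + 1) w = Lpow m (projection_along (L ` E0) (L ` F0) (Lpow (- m) w))" for w
      proof -
        define y where "y = Lpow (- (m + 1)) w"
        have "L y = Lpow (- m) w" using Lpow_Suc[of "- (m + 1)" w] by (simp add: y_def)
        then show ?thesis
          unfolding d y_def[symmetric]
          by (simp add: R_def Lpow_Suc projection_along_image[OF E0F0 LE0, symmetric] flip: Lpow_L)
      qed
      have P0: "?P j w = Lpow m (projection_along E1 (L ` F0) (Lpow (- m) w))" for w
        unfolding m_def[symmetric] True by (simp add: R_def)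
      show ?thesis
        unfolding P0 P1 inv linear_add[OF linear_Lpow, symmetric] R3 ..
    qed
  next
    fix m :: int and w
    have "(4 * m) div 4 = m" "(4 * m) mod 4 = 0" "(4 * m + 2) div 4 = m" "(4 * m + 2) mod 4 = 2"
      by presburger+
    note d = this
    show "l (Lpow (4 * m div 4) (R (4 * m mod 4) (Lpow (- (4 * m div 4)) w))) = 0"
      unfolding d Lpow_invariant[of l, OF l(2)] R_def
      using E0 complementary.projection_along(1)[OF E0F0] by simp
    define y where "y = Lpow (- m) w"
    have "l (y - projection_along E1 F1 y) = 0" using F1 complementary.projection_along(2)[OF E1F1] by blast
    then have "l (projection_along E1 F1 y) = l y" by (simp add: linear_diff[OF l(1)])
    moreover have "l y = l w" unfolding y_def by (rule Lpow_invariant[of l, OF l(2)])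
    ultimately show "l (Lpow ((4 * m + 2) div 4) (R ((4 * m + 2) mod 4) (Lpow (- ((4 * m + 2) div 4)) w))) = l w"
      unfolding d Lpow_invariant[of l, OF l(2)] R_def y_def by simp
  qed
qed

text \<open>Both \<open>k\<close> and \<open>n - k\<close> are at most the dimension n - 1 of the
  kernel of the functional, so it contains \<open>E0\<close> of dimension k and \<open>F1\<close> of
  dimension n - k; the other subspaces are complements.\<close>

lemma exists_anosov_metric:
  assumes a: "\<And>x. a \<bullet> L x = a \<bullet> x" "a \<bullet> b = 1" and k: "1 \<le> k" "k \<le> DIM('a) - 1"
  shows "\<exists>g Es Eu. complete_riemannian_metric g \<and> anosov_splitting f g Es Eu \<and>
    (\<forall>x. dim (Es x) = k \<and> dim (Eu x) = DIM('a) - k)"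
proof -
  define n where "n = DIM('a)"
  have kn: "1 \<le> k" "k < n" using k by (auto simp: n_def)
  let ?K = "{x. a \<bullet> x = 0}"
  have "a \<noteq> 0" using a(2) by auto
  then have dimK: "dim ?K = n - 1" unfolding n_def by (rule dim_hyperplane)
  have spanK: "span ?K = ?K" by (rule span_eq_iff[THEN iffD2, OF subspace_hyperplane])
  have "k \<le> dim ?K" "n - k \<le> dim ?K" unfolding dimK using kn by auto
  then obtain E0 F1 where E0: "subspace E0" "E0 \<subseteq> ?K" "dim E0 = k"
    and F1: "subspace F1" "F1 \<subseteq> ?K" "dim F1 = n - k"
    using choose_subspace_of_subspace[of k ?K] choose_subspace_of_subspace[of "n - k" ?K]
    unfolding spanK by metis
  have "\<exists>F0. subspace F0 \<and> dim F0 = n - k \<and> F0 \<inter> E0 = {0}"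
    by (rule common_complement[of "{E0}" "n - k"], simp, simp) (use E0 kn in \<open>simp add: n_def\<close>, blast)
  then obtain F0 where F0: "subspace F0" "dim F0 = n - k" "F0 \<inter> E0 = {0}" by blast
  have image: "subspace (L ` V)" "dim (L ` V) = dim V" if "subspace V" for V
    by (rule linear_subspace_image[OF linear_L that])
       (rule dim_image_eq[OF linear_L inj_on_subset[OF bij_is_inj[OF bij_L] subset_UNIV]])
  have F: "subspace V \<and> dim V + k = DIM('a)" if "V \<in> {F0, F1, L ` F0}" for V
  proof -
    from that consider "V = F0" | "V = F1" | "V = L ` F0" by blast
    then have "subspace V" "dim V = n - k"
      by (cases; simp only: F0 F1 image[OF F0(1)])+
    then show ?thesis using kn by (simp add: n_def)
  qed
  obtain E1 where E1: "subspace E1" "dim E1 = k" "E1 \<inter> F0 = {0}" "E1 \<inter> F1 = {0}" "E1 \<inter> L ` F0 = {0}"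
  proof (rule common_complement[of "{F0, F1, L ` F0}" k])
    show "subspace V \<and> dim V + k = DIM('a)" if "V \<in> {F0, F1, L ` F0}" for V by (rule F[OF that])
    fix E assume "subspace E" "dim E = k" "\<And>V. V \<in> {F0, F1, L ` F0} \<Longrightarrow> E \<inter> V = {0}"
    then show thesis using that[of E] by simp
  qed simp_all
  have "L ` E0 \<inter> L ` F0 = L ` (E0 \<inter> F0)" using bij_L by (simp add: bij_def image_Int)
  also have "\<dots> = {0}" using F0 by (simp add: Int_commute linear_0[OF linear_L])
  finally have LE0: "L ` E0 \<inter> L ` F0 = {0}" .
  define R where "R = (\<lambda>r::int. if r = 0 then projection_along E0 F0 else if r = 1 then projection_along E1 F0
      else if r = 2 then projection_along E1 F1 else projection_along E1 (L ` F0))"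
  define P where "P = (\<lambda>j w. Lpow (j div 4) (R (j mod 4) (Lpow (- (j div 4)) w)))"
  have E0F0: "complementary E0 F0"
    by (rule complementary.intro) (use E0 F0 kn in \<open>simp_all add: n_def Int_commute\<close>)
  have "linear ((\<bullet>) a)" by (rule linearI) (simp_all add: inner_add_right)
  then interpret S: translation_splitting L b f "(\<bullet>) a" P
    unfolding P_def R_def
  proof (rule translation_splitting_from_period[OF _ a E0F0])
    show "complementary E1 F0" "complementary E1 F1" "complementary E1 (L ` F0)"
      by (rule complementary.intro; use E1 F0(1,2) F1(1,3) image[OF F0(1)] kn in \<open>simp add: n_def\<close>)+
    show "complementary (L ` E0) (L ` F0)"
      by (rule complementary.intro)
         (use E0(3) F0(2) image[OF F0(1)] image[OF E0(1)] kn LE0 in \<open>simp_all add: n_def\<close>)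
  qed (use E0 F1 in auto)
  \<comment> \<open>The index is read off at the origin, whose level 0 lies on the plateau of the
    first splitting.\<close>
  have "S.Pt 0 w = projection_along E0 F0 w" for w
  proof -
    have "S.Pt 0 w = P 0 w" unfolding S.Pt_def by (rule interp_plateau) simp
    then show ?thesis by (simp add: P_def R_def)
  qed
  then have "S.Es 0 = range (projection_along E0 F0)" by (simp add: S.Es_def)
  also have "\<dots> = E0"
    using complementary.projection_along(1)[OF E0F0] complementary.projection_along_in[OF E0F0]
    by (metis image_subset_iff rangeI subsetI subset_antisym)
  finally have "dim (S.Es 0) = k" using E0 by simp
  then have "dim (S.Es x) = k" for x
    using continuous_subbundle_dim_constant[of S.Es x 0] S.splitting by (simp add: continuous_splitting_def)
  then show ?thesis
    using S.metric_complete S.anosov continuous_splitting_dim[OF S.splitting]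
    by (metis add_diff_cancel_left')
qed

end

text \<open>The component \<open>z\<close> of \<open>v\<close> orthogonal to Im (I - A) is nonzero
  and annihilates that image, so z pairs equally with x and A x. As z . v = z . z, it can be
  normalized.\<close>

lemma invariant_functional:
  fixes A :: "real^'n^'n"
  assumes "v \<notin> range (\<lambda>x. (mat 1 - A) *v x)"
  obtains a where "\<And>x. a \<bullet> (A *v x) = a \<bullet> x" "a \<bullet> v = 1"
proof -
  let ?S = "range (\<lambda>x. (mat 1 - A) *v x)"
  have "subspace ?S"
    by (rule linear_subspace_image[OF matrix_vector_mul_linear subspace_UNIV])
  then have span: "span ?S = ?S" by (rule span_eq_iff[THEN iffD2])
  obtain y z where yz: "y \<in> span ?S" "\<And>w. w \<in> span ?S \<Longrightarrow> orthogonal z w" "v = y + z"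
    using orthogonal_subspace_decomp_exists[of ?S v] by metis
  have "z \<noteq> 0" using yz assms unfolding span by auto
  have zv: "z \<bullet> v = z \<bullet> z" using yz(2)[OF yz(1)] by (simp add: yz(3) inner_add_right orthogonal_def)
  have "z \<bullet> (A *v x) = z \<bullet> x" for x
    using yz(2)[of "(mat 1 - A) *v x"] unfolding span
    by (simp add: orthogonal_def matrix_vector_mult_diff_rdistrib inner_diff_right)
  then show ?thesis
    using that[of "(1 / (z \<bullet> z)) *\<^sub>R z"] zv \<open>z \<noteq> 0\<close> by simp
qed

theorem theorem4p2:
  fixes A :: "real^'n^'n" and v :: "real^'n"
  assumes "CARD('n) \<ge> 2"
    and "invertible A"
    and "\<exists>g. complete_anosov_metric (affine_map A v) g"
  shows "(hyperbolic A \<longrightarrow>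
            index_spectrum (affine_map A v) = {dim (stable_eigenspace A)}) \<and>
         (\<not> hyperbolic A \<and> v \<notin> range (\<lambda>x. (mat 1 - A) *v x) \<longrightarrow>
            index_spectrum (affine_map A v) = {1..CARD('n) - 1} \<and>
            (\<exists>(g :: nat \<Rightarrow> real^'n \<Rightarrow> real^'n \<Rightarrow> real^'n \<Rightarrow> real)
               (Es :: nat \<Rightarrow> real^'n \<Rightarrow> (real^'n) set) (Eu :: nat \<Rightarrow> real^'n \<Rightarrow> (real^'n) set).
               (\<forall>k\<in>{1..CARD('n) - 1}.
                  complete_riemannian_metric (g k) \<and>
                  anosov_splitting (affine_map A v) (g k) (Es k) (Eu k) \<and>
                  (\<forall>x. dim (Es k x) = k \<and> dim (Eu k x) = CARD('n) - k)) \<and>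
               (\<forall>k\<in>{1..CARD('n) - 1}. \<forall>j\<in>{1..CARD('n) - 1}.
                  k \<noteq> j \<longrightarrow> \<not> uniformly_equivalent (g k) (g j))))"
proof (intro conjI impI)
  interpret affine_diffeo "(*v) A" v "affine_map A v"
    by (rule affine_diffeo_affine_map[OF assms(2)])
  show "index_spectrum (affine_map A v) = {dim (stable_eigenspace A)}" if hyp: "hyperbolic A"
  proof
    have index: "dim (Es x) = dim (stable_eigenspace A)"
      if "complete_riemannian_metric g" "anosov_splitting (affine_map A v) g Es Eu" for g Es Eu x
      using hyperbolic_anosov_index[OF assms(2) hyp _ that(2)] that(1)
      by (simp add: complete_riemannian_metric_def)
    then show "index_spectrum (affine_map A v) \<subseteq> {dim (stable_eigenspace A)}"
      unfolding index_spectrum_def by fastforce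
    \<comment> \<open>The assumed complete Anosov metric makes the spectrum nonempty.\<close>
    show "{dim (stable_eigenspace A)} \<subseteq> index_spectrum (affine_map A v)"
      using assms(3) index unfolding complete_anosov_metric_def index_spectrum_def by blast
  qed
  assume "\<not> hyperbolic A \<and> v \<notin> range (\<lambda>x. (mat 1 - A) *v x)"
  then obtain a where a: "\<And>x. a \<bullet> (A *v x) = a \<bullet> x" "a \<bullet> v = 1"
    using invariant_functional by metis
  let ?K = "{1..CARD('n) - 1}"
  have "\<exists>g Es Eu. complete_riemannian_metric g \<and> anosov_splitting (affine_map A v) g Es Eu \<and>
      (\<forall>x. dim (Es x) = k \<and> dim (Eu x) = CARD('n) - k)" if "k \<in> ?K" for k
    using exists_anosov_metric[OF a, of k] that by simp
  then obtain g Es Eu where gk: "\<forall>k\<in>?K. complete_riemannian_metric (g k) \<and>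
      anosov_splitting (affine_map A v) (g k) (Es k) (Eu k) \<and>
      (\<forall>x. dim (Es k x) = k \<and> dim (Eu k x) = CARD('n) - k)"
    by metis
  have lin: "linear ((\<bullet>) a)" by (rule linearI) (simp_all add: inner_add_right)
  show "index_spectrum (affine_map A v) = ?K"
  proof
    show "index_spectrum (affine_map A v) \<subseteq> ?K"
    proof
      fix k assume "k \<in> index_spectrum (affine_map A v)"
      then obtain h Es' Eu' where h: "complete_riemannian_metric h"
        "anosov_splitting (affine_map A v) h Es' Eu'" "\<forall>x. dim (Es' x) = k"
        unfolding index_spectrum_def by blast
      have "dim (Es' 0) \<in> {1..DIM(real^'n) - 1}"
        by (rule anosov_index_bounds[OF h(1,2) lin a(1)]) (simp add: a(2))
      then show "k \<in> ?K" using h(3) by simp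
    qed
    show "?K \<subseteq> index_spectrum (affine_map A v)"
      unfolding index_spectrum_def using gk by blast
  qed
  \<comment> \<open>The metric of larger index supplies the stable vector, so pairs are ordered by
    index and both orders of the arguments are settled together.\<close>
  have less: "\<not> uniformly_equivalent (g k) (g j) \<and> \<not> uniformly_equivalent (g j) (g k)"
    if kj: "k \<in> ?K" "j \<in> ?K" "j < k" for k j
  proof -
    have r: "riemannian_metric (g k)" "riemannian_metric (g j)"
      using gk kj by (auto simp: complete_riemannian_metric_def)
    have A: "anosov_splitting (affine_map A v) (g k) (Es k) (Eu k)"
      "anosov_splitting (affine_map A v) (g j) (Es j) (Eu j)"
      and "dim (Es j 0) < dim (Es k 0)"
      using gk kj by auto
    from anosov_not_uniformly_equivalent[OF r(1) A(1) r(2) A(2) this(3)]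
    show ?thesis unfolding uniformly_equivalent_def by blast
  qed
  show "\<exists>(g :: nat \<Rightarrow> real^'n \<Rightarrow> real^'n \<Rightarrow> real^'n \<Rightarrow> real)
               (Es :: nat \<Rightarrow> real^'n \<Rightarrow> (real^'n) set) (Eu :: nat \<Rightarrow> real^'n \<Rightarrow> (real^'n) set).
       (\<forall>k\<in>?K. complete_riemannian_metric (g k) \<and>
                  anosov_splitting (affine_map A v) (g k) (Es k) (Eu k) \<and>
                  (\<forall>x. dim (Es k x) = k \<and> dim (Eu k x) = CARD('n) - k)) \<and>
       (\<forall>k\<in>?K. \<forall>j\<in>?K. k \<noteq> j \<longrightarrow> \<not> uniformly_equivalent (g k) (g j))"
  proof (intro exI conjI ballI impI)
    show "\<not> uniformly_equivalent (g k) (g j)" if "k \<in> ?K" "j \<in> ?K" "k \<noteq> j" for k j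
      using less that by (cases "j < k") auto
  qed (use gk in auto)
qed

end
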